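(* Let $p\ge1$ and let $\alpha\in[0,1/2)\cap[0,1/p]$. For each $n\ge 1$ let $X_{n,1},\dots,X_{n,m_n}$ be independent real random variables with $\mathbf{E}X_{n,k}=0$, $\sigma_{n,k}^2:=\operatorname{Var}(X_{n,k})\in(0,\infty)$ for $1\le k\le m_n$, and $\sum_{k=1}^{m_n}\sigma_{n,k}^2=1$. Suppose that the Lindeberg condition is satisfied, that is, $$\text{for each }\varepsilon>0,\qquad \lim_{n\to\infty}\sum_{k=1}^{m_n}\mathbf{E}\left[X_{n,k}^2\,\mathbf{1}\{|X_{n,k}|\ge\varepsilon\}\right]=0.$$ Then, as $n\to\infty$, the polygonal line process $\mathbb{S}_n=(S_n(t),\,t\in[0,1])$ associated with the array converges in distribution in the space $B^{o}_{p,\alpha}([0,1])$ to a standard Wiener process $\mathbb{W}=(W(t),\,t\in[0,1])$.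
   Context: Polygonal line process. Given the array, put $a_{n,0}:=0$, $a_{n,j}:=\sum_{i=1}^{j}\sigma_{n,i}^2$ (so $a_{n,m_n}=1$), $S_{n,0}:=0$, $S_{n,j}:=\sum_{i=1}^{j}X_{n,i}$ for $1\le j\le m_n$. The process $\mathbb{S}_n=(S_n(t),\,t\in[0,1])$ is the affine interpolation between the points $(a_{n,k},S_{n,k})$, $k=0,\dots,m_n$: $$S_n(t)=S_{n,k-1}+\frac{t-a_{n,k-1}}{\sigma_{n,k}^2}X_{n,k},\qquad a_{n,k-1}\le t\le a_{n,k},\quad k=1,\dots,m_n.$$ Besov space. For $p\ge 1$, $\mathbb{L}_p([0,1])$ is the usual space of (a.e. equivalence classes of) functions $x:[0,1]\to\mathbb{R}$ with $\int_0^1|x(t)|^p\,\mathrm{d}t<\infty$, with norm $\|\cdot\|_p$. For $x\in\mathbb{L}_p([0,1])$ and $0<\delta<1$, $$\omega_p(x,\delta):=\sup_{|h|\le\delta}\left(\int_{I_h}|x(u+h)-x(u)|^p\,\mathrm{d}u\right)^{1/p},\qquad I_h:=[0,1]\cap[-h,1-h].$$ For $\alpha\in[0,1]$ and $p\ge1$, $$B^{o}_{p,\alpha}([0,1]):=\left\{x\in\mathbb{L}_p([0,1]):\ \lim_{\delta\to0}\delta^{-\alpha}\omega_p(x,\delta)=0\right\},$$ equipped with the norm $\|x\|_{B^{o}_{p,\alpha}([0,1])}:=\|x\|_p+\sup_{0<\delta<1}\delta^{-\alpha}\omega_p(x,\delta)$, which makes it a separable Banach space. Convergence in distribution in this space means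 weak convergence of the laws of the processes, viewed as random elements of this Banach space. *)

theory Defs
  imports "HOL-Probability.Probability"
begin

section \<open>The $L_p$ seminorm and Minkowski's inequality\<close>

definition Lp_norm :: "'a measure \<Rightarrow> real \<Rightarrow> ('a \<Rightarrow> real) \<Rightarrow> real" where
  "Lp_norm M p f = (\<integral>u. \<bar>f u\<bar> powr p \<partial>M) powr (1 / p)"

definition Lp_fun :: "'a measure \<Rightarrow> real \<Rightarrow> ('a \<Rightarrow> real) \<Rightarrow> bool" where
  "Lp_fun M p f \<longleftrightarrow> f \<in> borel_measurable M \<and> integrable M (\<lambda>u. \<bar>f u\<bar> powr p)"

lemma Lp_norm_nonneg: "0 \<le> Lp_norm M p f"
  by (simp add: Lp_norm_def)

lemma Lp_norm_cong_AE:
  assumes "f \<in> borel_measurable M" "g \<in> borel_measurable M" "AE u in M. f u = g u"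
  shows "Lp_norm M p f = Lp_norm M p g"
proof -
  have "(\<integral>u. \<bar>f u\<bar> powr p \<partial>M) = (\<integral>u. \<bar>g u\<bar> powr p \<partial>M)"
    using assms by (intro integral_cong_AE) auto
  then show ?thesis by (simp add: Lp_norm_def)
qed

lemma powr_convex_comb:
  fixes x y a b p :: real
  assumes p: "1 \<le> p" and nn: "0 \<le> x" "0 \<le> y" and ab: "0 < a" "0 < b" "a + b = 1"
  shows "(a * x + b * y) powr p \<le> a * x powr p + b * y powr p"
proof -
  have le: "(c * z) powr p \<le> c * z powr p" if "0 < c" "c \<le> 1" "0 \<le> z" for c z :: real
  proof -
    have "c powr p \<le> c powr 1"
      using p that by (intro powr_mono') auto
    then have "c powr p * z powr p \<le> c * z powr p"
      using that by (intro mult_right_mono) auto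
    then show ?thesis using that by (simp add: powr_mult)
  qed
  consider "x = 0" | "y = 0" | "0 < x" "0 < y" using nn by linarith
  then show ?thesis
  proof cases
    case 1
    then show ?thesis using le[of b y] ab nn p by simp
  next
    case 2
    then show ?thesis using le[of a x] ab nn p by simp
  next
    case 3
    have a: "a = 1 - b" using ab by simp
    show ?thesis
      using convex_onD[OF powr_convex[OF p], of b x y] ab 3 unfolding a by simp
  qed
qed

lemma Lp_norm_power:
  assumes "1 \<le> p"
  shows "Lp_norm M p f powr p = (\<integral>u. \<bar>f u\<bar> powr p \<partial>M)"
  using assms by (simp add: Lp_norm_def powr_powr)

lemma Lp_norm_eq_0:
  assumes "1 \<le> p" "Lp_fun M p f" "Lp_norm M p f = 0"
  shows "AE u in M. f u = 0"
proof -
  have "(\<integral>u. \<bar>f u\<bar> powr p \<partial>M) = 0"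
    using Lp_norm_power[OF assms(1), of M f] assms by simp
  then have "AE u in M. \<bar>f u\<bar> powr p = 0"
    using assms(2) by (subst (asm) integral_nonneg_eq_0_iff_AE) (auto simp: Lp_fun_def)
  then show ?thesis by simp
qed

lemma Lp_fun_uminus: "Lp_fun M p f \<Longrightarrow> Lp_fun M p (\<lambda>u. - f u)"
  by (simp add: Lp_fun_def)

lemma Lp_norm_uminus: "Lp_norm M p (\<lambda>u. - f u) = Lp_norm M p f"
  by (simp add: Lp_norm_def)

lemma Lp_fun_add:
  assumes p: "1 \<le> p" and f: "Lp_fun M p f" and g: "Lp_fun M p g"
  shows "Lp_fun M p (\<lambda>u. f u + g u)"
proof -
  have [measurable]: "f \<in> borel_measurable M" "g \<in> borel_measurable M"
    using f g by (auto simp: Lp_fun_def)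
  have int: "integrable M (\<lambda>u. 2 powr p * (\<bar>f u\<bar> powr p + \<bar>g u\<bar> powr p))"
    using f g by (auto simp: Lp_fun_def)
  have "\<bar>f u + g u\<bar> powr p \<le> 2 powr p * (\<bar>f u\<bar> powr p + \<bar>g u\<bar> powr p)" for u
  proof -
    have "\<bar>f u + g u\<bar> powr p \<le> (2 * max \<bar>f u\<bar> \<bar>g u\<bar>) powr p"
      using p by (intro powr_mono2) auto
    also have "\<dots> = 2 powr p * max \<bar>f u\<bar> \<bar>g u\<bar> powr p"
      by (simp add: powr_mult)
    also have "\<dots> \<le> 2 powr p * (\<bar>f u\<bar> powr p + \<bar>g u\<bar> powr p)"
      by (intro mult_left_mono) (auto simp: max_def)
    finally show ?thesis .
  qed
  then have "integrable M (\<lambda>u. \<bar>f u + g u\<bar> powr p)"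
    by (intro Bochner_Integration.integrable_bound[OF int]) auto
  then show ?thesis by (simp add: Lp_fun_def)
qed

lemma Lp_norm_add_le:
  assumes p: "1 \<le> p" and f: "Lp_fun M p f" and g: "Lp_fun M p g"
  shows "Lp_norm M p (\<lambda>u. f u + g u) \<le> Lp_norm M p f + Lp_norm M p g"
proof -
  define A B where "A = Lp_norm M p f" and "B = Lp_norm M p g"
  have [measurable]: "f \<in> borel_measurable M" "g \<in> borel_measurable M"
    using f g by (auto simp: Lp_fun_def)
  have AB: "0 \<le> A" "0 \<le> B" by (auto simp: A_def B_def Lp_norm_nonneg)
  consider "A = 0" | "B = 0" | "0 < A" "0 < B" using AB by linarith
  then show ?thesis
  proof cases
    case 1
    then have "AE u in M. f u = 0" using Lp_norm_eq_0[OF p f] by (simp add: A_def)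
    then have "Lp_norm M p (\<lambda>u. f u + g u) = B"
      unfolding B_def by (intro Lp_norm_cong_AE) auto
    with 1 show ?thesis by (simp add: A_def B_def Lp_norm_nonneg)
  next
    case 2
    then have "AE u in M. g u = 0" using Lp_norm_eq_0[OF p g] by (simp add: B_def)
    then have "Lp_norm M p (\<lambda>u. f u + g u) = A"
      unfolding A_def by (intro Lp_norm_cong_AE) auto
    with 2 show ?thesis by (simp add: A_def B_def Lp_norm_nonneg)
  next
    case 3
    define a b where "a = A / (A + B)" and "b = B / (A + B)"
    have ab: "0 < a" "0 < b" "a + b = 1"
      using 3 by (auto simp: a_def b_def add_divide_distrib[symmetric])
    have fi: "integrable M (\<lambda>u. \<bar>f u\<bar> powr p)" and gi: "integrable M (\<lambda>u. \<bar>g u\<bar> powr p)"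
      and fgi: "integrable M (\<lambda>u. \<bar>f u + g u\<bar> powr p)"
      using f g Lp_fun_add[OF p f g] by (auto simp: Lp_fun_def)
    have pw: "\<bar>f u + g u\<bar> powr p
        \<le> (A + B) powr p * (a * (\<bar>f u\<bar> powr p / A powr p) + b * (\<bar>g u\<bar> powr p / B powr p))" for u
    proof -
      have "\<bar>f u + g u\<bar> powr p \<le> (\<bar>f u\<bar> + \<bar>g u\<bar>) powr p"
        using p by (intro powr_mono2) auto
      also have "\<bar>f u\<bar> + \<bar>g u\<bar> = (A + B) * (a * (\<bar>f u\<bar> / A) + b * (\<bar>g u\<bar> / B))"
      proof -
        have "(A + B) * a = A" "(A + B) * b = B"
          using 3 by (auto simp: a_def b_def)
        then have "(A + B) * (a * (\<bar>f u\<bar> / A)) = A * (\<bar>f u\<bar> / A)"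
          "(A + B) * (b * (\<bar>g u\<bar> / B)) = B * (\<bar>g u\<bar> / B)"
          by (metis mult.assoc)+
        then show ?thesis using 3 by (simp only: distrib_left) simp
      qed
      also have "((A + B) * (a * (\<bar>f u\<bar> / A) + b * (\<bar>g u\<bar> / B))) powr p
          = (A + B) powr p * (a * (\<bar>f u\<bar> / A) + b * (\<bar>g u\<bar> / B)) powr p"
        using 3 ab by (intro powr_mult)
      also have "\<dots> \<le> (A + B) powr p * (a * (\<bar>f u\<bar> / A) powr p + b * (\<bar>g u\<bar> / B) powr p)"
        using 3 ab p by (intro mult_left_mono powr_convex_comb) auto
      finally show ?thesis using 3 by (simp add: powr_divide)
    qed
    have "(\<integral>u. \<bar>f u + g u\<bar> powr p \<partial>M)
        \<le> (\<integral>u. (A + B) powr p * (a * (\<bar>f u\<bar> powr p / A powr p) + b * (\<bar>g u\<bar> powr p / B powr p)) \<partial>M)"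
      using fi gi fgi pw by (intro integral_mono) auto
    also have "\<dots> = (A + B) powr p * (a * ((\<integral>u. \<bar>f u\<bar> powr p \<partial>M) / A powr p)
        + b * ((\<integral>u. \<bar>g u\<bar> powr p \<partial>M) / B powr p))"
      using fi gi by simp
    also have "\<dots> = (A + B) powr p"
      using 3 ab by (simp add: Lp_norm_power[OF p, symmetric] A_def[symmetric] B_def[symmetric])
    finally have "Lp_norm M p (\<lambda>u. f u + g u) powr p \<le> (A + B) powr p"
      by (simp add: Lp_norm_power[OF p])
    then have "Lp_norm M p (\<lambda>u. f u + g u) \<le> A + B"
      using p 3 powr_less_mono2[of p "A + B" "Lp_norm M p (\<lambda>u. f u + g u)"] by linarith
    then show ?thesis by (simp add: A_def B_def)
  qed
qed


section \<open>Almost everywhere equality classes of measurable functions on the unit interval\<close>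

definition ae_rel :: "(real \<Rightarrow> real) \<Rightarrow> (real \<Rightarrow> real) \<Rightarrow> bool" where
  "ae_rel x y \<longleftrightarrow> x \<in> borel_measurable (lebesgue_on {0..1}) \<and>
     y \<in> borel_measurable (lebesgue_on {0..1}) \<and> (AE t in lebesgue_on {0..1}. x t = y t)"

quotient_type l0 = "real \<Rightarrow> real" / partial: ae_rel
  morphisms rep_l0 ae_class
proof (rule part_equivpI)
  show "\<exists>x. ae_rel x x"
    by (rule exI[of _ "\<lambda>_. 0"]) (simp add: ae_rel_def)
  show "symp ae_rel"
    by (rule sympI) (auto simp: ae_rel_def)
  show "transp ae_rel"
  proof (rule transpI)
    fix x y z assume "ae_rel x y" "ae_rel y z"
    then have xz: "x \<in> borel_measurable (lebesgue_on {0..1})" "z \<in> borel_measurable (lebesgue_on {0..1})"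
      and "AE t in lebesgue_on {0..1}. x t = y t" "AE t in lebesgue_on {0..1}. y t = z t"
      by (simp_all add: ae_rel_def)
    from this(3,4) have "AE t in lebesgue_on {0..1}. x t = z t"
      by eventually_elim simp
    with xz show "ae_rel x z" by (simp add: ae_rel_def)
  qed
qed

instantiation l0 :: real_vector
begin

lift_definition zero_l0 :: l0 is "\<lambda>_. 0" by (simp add: ae_rel_def)
lift_definition plus_l0 :: "l0 \<Rightarrow> l0 \<Rightarrow> l0" is "\<lambda>x y t. x t + y t" by (auto simp: ae_rel_def)
lift_definition minus_l0 :: "l0 \<Rightarrow> l0 \<Rightarrow> l0" is "\<lambda>x y t. x t - y t" by (auto simp: ae_rel_def)
lift_definition uminus_l0 :: "l0 \<Rightarrow> l0" is "\<lambda>x t. - x t" by (auto simp: ae_rel_def)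
lift_definition scaleR_l0 :: "real \<Rightarrow> l0 \<Rightarrow> l0" is "\<lambda>c x t. c * x t" by (auto simp: ae_rel_def)

instance
proof
  fix a b :: real and x y z :: l0
  show "x + y + z = x + (y + z)" by transfer (auto simp: ae_rel_def)
  show "x + y = y + x" by transfer (auto simp: ae_rel_def)
  show "0 + x = x" by transfer (auto simp: ae_rel_def)
  show "- x + x = 0" by transfer (auto simp: ae_rel_def)
  show "x - y = x + - y" by transfer (auto simp: ae_rel_def)
  show "a *\<^sub>R (x + y) = a *\<^sub>R x + a *\<^sub>R y" by transfer (auto simp: ae_rel_def distrib_left)
  show "(a + b) *\<^sub>R x = a *\<^sub>R x + b *\<^sub>R x" by transfer (auto simp: ae_rel_def distrib_right)
  show "a *\<^sub>R b *\<^sub>R x = (a * b) *\<^sub>R x" by transfer (auto simp: ae_rel_def)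
  show "1 *\<^sub>R x = x" by transfer (auto simp: ae_rel_def)
qed

end


section \<open>The Besov space\<close>

abbreviation shift_dom :: "real \<Rightarrow> real set" where
  "shift_dom h \<equiv> {0..1} \<inter> {- h..1 - h}"

lemma lebesgue_shift: "distr lebesgue lebesgue (\<lambda>u. u + h) = (lebesgue :: real measure)"
  using lebesgue_real_affine[of 1 h] by (simp add: density_1 add.commute)

lemma shift_measurable [measurable]: "(\<lambda>u::real. u + h) \<in> lebesgue \<rightarrow>\<^sub>M lebesgue"
  using lebesgue_affine_measurable[of "\<lambda>_. 1" h] by (simp add: add.commute)

lemma shift_dom_measurable [measurable]: "shift_dom h \<in> sets lebesgue"
  by simp

lemma shift_borel_measurable:
  assumes "x \<in> borel_measurable (lebesgue_on {0..1})"
  shows "(\<lambda>u. x (u + h)) \<in> borel_measurable (lebesgue_on (shift_dom h))"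
proof -
  have "(\<lambda>u. u + h) \<in> lebesgue_on (shift_dom h) \<rightarrow>\<^sub>M lebesgue_on {0..1}"
    by (intro measurable_restrict_space3 shift_measurable) auto
  from measurable_compose[OF this assms] show ?thesis .
qed

lemma restrict_borel_measurable:
  assumes "x \<in> borel_measurable (lebesgue_on {0..1})"
  shows "x \<in> borel_measurable (lebesgue_on (shift_dom h))"
  by (rule measurable_restrict_mono[OF assms]) auto

lemma shift_AE:
  assumes "AE t in lebesgue_on {0..1}. P t"
  shows "AE u in lebesgue_on (shift_dom h). P u \<and> P (u + h)"
proof -
  have 1: "AE t in lebesgue. t \<in> {0..1} \<longrightarrow> P t"
    using assms by (subst (asm) AE_restrict_space_iff) auto
  then have "AE t in distr lebesgue lebesgue (\<lambda>u. u + h). t \<in> {0..1} \<longrightarrow> P t"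
    by (simp only: lebesgue_shift)
  then have 2: "AE u in lebesgue. u + h \<in> {0..1} \<longrightarrow> P (u + h)"
    by (rule AE_distrD[OF shift_measurable])
  have "AE u in lebesgue. u \<in> shift_dom h \<longrightarrow> P u \<and> P (u + h)"
    using 1 2 by eventually_elim auto
  then show ?thesis by (subst AE_restrict_space_iff) auto
qed

lift_definition lp_mem :: "real \<Rightarrow> l0 \<Rightarrow> bool" is "\<lambda>p x. Lp_fun (lebesgue_on {0..1}) p x"
proof -
  fix p and x y :: "real \<Rightarrow> real"
  assume xy: "ae_rel x y"
  then have [measurable]: "x \<in> borel_measurable (lebesgue_on {0..1})"
    "y \<in> borel_measurable (lebesgue_on {0..1})"
    by (auto simp: ae_rel_def)
  have "integrable (lebesgue_on {0..1}) (\<lambda>u. \<bar>x u\<bar> powr p)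
      \<longleftrightarrow> integrable (lebesgue_on {0..1}) (\<lambda>u. \<bar>y u\<bar> powr p)"
    using xy by (intro integrable_cong_AE) (auto simp: ae_rel_def elim: eventually_mono)
  then show "Lp_fun (lebesgue_on {0..1}) p x = Lp_fun (lebesgue_on {0..1}) p y"
    by (simp add: Lp_fun_def)
qed

lift_definition lp_norm :: "real \<Rightarrow> l0 \<Rightarrow> real" is "\<lambda>p x. Lp_norm (lebesgue_on {0..1}) p x"
  unfolding ae_rel_def by (intro Lp_norm_cong_AE) simp_all

lift_definition lp_modulus :: "real \<Rightarrow> l0 \<Rightarrow> real \<Rightarrow> real" is
  "\<lambda>p x \<delta>. SUP h\<in>{- \<delta>..\<delta>}. Lp_norm (lebesgue_on (shift_dom h)) p (\<lambda>u. x (u + h) - x u)"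
proof -
  fix p :: real and x y :: "real \<Rightarrow> real"
  assume xy: "ae_rel x y"
  have "Lp_norm (lebesgue_on (shift_dom h)) p (\<lambda>u. x (u + h) - x u)
      = Lp_norm (lebesgue_on (shift_dom h)) p (\<lambda>u. y (u + h) - y u)" for h
  proof (rule Lp_norm_cong_AE)
    show "(\<lambda>u. x (u + h) - x u) \<in> borel_measurable (lebesgue_on (shift_dom h))"
      "(\<lambda>u. y (u + h) - y u) \<in> borel_measurable (lebesgue_on (shift_dom h))"
      using xy unfolding ae_rel_def
      by (intro borel_measurable_diff shift_borel_measurable restrict_borel_measurable; simp)+
    have "AE t in lebesgue_on {0..1}. x t = y t" using xy by (simp add: ae_rel_def)
    from shift_AE[OF this, of h]
    show "AE u in lebesgue_on (shift_dom h). x (u + h) - x u = y (u + h) - y u"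
      by (rule eventually_mono) simp
  qed
  then show "(\<lambda>\<delta>. SUP h\<in>{- \<delta>..\<delta>}. Lp_norm (lebesgue_on (shift_dom h)) p (\<lambda>u. x (u + h) - x u))
      = (\<lambda>\<delta>. SUP h\<in>{- \<delta>..\<delta>}. Lp_norm (lebesgue_on (shift_dom h)) p (\<lambda>u. y (u + h) - y u))"
    by simp
qed

definition besov_space :: "real \<Rightarrow> real \<Rightarrow> l0 set" where
  "besov_space p \<alpha> = {x. lp_mem p x \<and>
     ((\<lambda>\<delta>. \<delta> powr (- \<alpha>) * lp_modulus p x \<delta>) \<longlongrightarrow> 0) (at_right 0)}"

definition besov_norm :: "real \<Rightarrow> real \<Rightarrow> l0 \<Rightarrow> real" where
  "besov_norm p \<alpha> x = lp_norm p x + (SUP \<delta>\<in>{0<..<1}. \<delta> powr (- \<alpha>) * lp_modulus p x \<delta>)"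

lemma Lp_fun_restrict:
  assumes "Lp_fun (lebesgue_on {0..1}) p x"
  shows "Lp_fun (lebesgue_on (shift_dom h)) p x"
    and "(\<integral>u. \<bar>x u\<bar> powr p \<partial>lebesgue_on (shift_dom h)) \<le> (\<integral>u. \<bar>x u\<bar> powr p \<partial>lebesgue_on {0..1})"
proof -
  have xm: "x \<in> borel_measurable (lebesgue_on {0..1})"
    and "integrable (lebesgue_on {0..1}) (\<lambda>u. \<bar>x u\<bar> powr p)"
    using assms by (auto simp: Lp_fun_def)
  then have F: "integrable lebesgue (\<lambda>t. indicator {0..1} t *\<^sub>R \<bar>x t\<bar> powr p)"
    by (subst (asm) integrable_restrict_space) auto
  have m: "(\<lambda>u. \<bar>x u\<bar> powr p) \<in> borel_measurable (lebesgue_on (shift_dom h))"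
    using restrict_borel_measurable[OF xm, of h] by simp
  then have Gm: "(\<lambda>u. indicator (shift_dom h) u *\<^sub>R \<bar>x u\<bar> powr p) \<in> borel_measurable lebesgue"
    by (subst (asm) borel_measurable_restrict_space_iff) auto
  have le: "indicator (shift_dom h) u *\<^sub>R \<bar>x u\<bar> powr p \<le> indicator {0..1} u *\<^sub>R \<bar>x u\<bar> powr p" for u
    by (auto simp: indicator_def)
  have G: "integrable lebesgue (\<lambda>u. indicator (shift_dom h) u *\<^sub>R \<bar>x u\<bar> powr p)"
    using le by (intro Bochner_Integration.integrable_bound[OF F Gm]) (auto simp: indicator_def)
  show "Lp_fun (lebesgue_on (shift_dom h)) p x"
    using G restrict_borel_measurable[OF xm] unfolding Lp_fun_def
    by (subst integrable_restrict_space) auto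
  show "(\<integral>u. \<bar>x u\<bar> powr p \<partial>lebesgue_on (shift_dom h)) \<le> (\<integral>u. \<bar>x u\<bar> powr p \<partial>lebesgue_on {0..1})"
    using integral_mono[OF G F le] by (simp add: integral_restrict_space)
qed

lemma Lp_fun_shift:
  assumes "Lp_fun (lebesgue_on {0..1}) p x"
  shows "Lp_fun (lebesgue_on (shift_dom h)) p (\<lambda>u. x (u + h))"
    and "(\<integral>u. \<bar>x (u + h)\<bar> powr p \<partial>lebesgue_on (shift_dom h)) \<le> (\<integral>u. \<bar>x u\<bar> powr p \<partial>lebesgue_on {0..1})"
proof -
  have xm: "x \<in> borel_measurable (lebesgue_on {0..1})"
    and "integrable (lebesgue_on {0..1}) (\<lambda>u. \<bar>x u\<bar> powr p)"
    using assms by (auto simp: Lp_fun_def)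
  then have F: "integrable lebesgue (\<lambda>t. indicator {0..1} t *\<^sub>R \<bar>x t\<bar> powr p)"
    by (subst (asm) integrable_restrict_space) auto
  have F': "integrable lebesgue (\<lambda>u. indicator {0..1} (u + h) *\<^sub>R \<bar>x (u + h)\<bar> powr p)"
    using F integrable_distr_eq[OF shift_measurable borel_measurable_integrable[OF F], of h]
    by (simp only: lebesgue_shift)
  have FI: "(\<integral>u. indicator {0..1} (u + h) *\<^sub>R \<bar>x (u + h)\<bar> powr p \<partial>lebesgue)
      = (\<integral>t. indicator {0..1} t *\<^sub>R \<bar>x t\<bar> powr p \<partial>lebesgue)"
    using integral_distr[OF shift_measurable borel_measurable_integrable[OF F], of h]
    by (simp only: lebesgue_shift)
  have m: "(\<lambda>u. \<bar>x (u + h)\<bar> powr p) \<in> borel_measurable (lebesgue_on (shift_dom h))"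
    using shift_borel_measurable[OF xm, of h] by simp
  then have Gm: "(\<lambda>u. indicator (shift_dom h) u *\<^sub>R \<bar>x (u + h)\<bar> powr p) \<in> borel_measurable lebesgue"
    by (subst (asm) borel_measurable_restrict_space_iff) auto
  have le: "indicator (shift_dom h) u *\<^sub>R \<bar>x (u + h)\<bar> powr p
      \<le> indicator {0..1} (u + h) *\<^sub>R \<bar>x (u + h)\<bar> powr p" for u
    by (auto simp: indicator_def)
  have G: "integrable lebesgue (\<lambda>u. indicator (shift_dom h) u *\<^sub>R \<bar>x (u + h)\<bar> powr p)"
    using le by (intro Bochner_Integration.integrable_bound[OF F' Gm]) (auto simp: indicator_def)
  show "Lp_fun (lebesgue_on (shift_dom h)) p (\<lambda>u. x (u + h))"
    using G shift_borel_measurable[OF xm] unfolding Lp_fun_def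
    by (subst integrable_restrict_space) auto
  show "(\<integral>u. \<bar>x (u + h)\<bar> powr p \<partial>lebesgue_on (shift_dom h)) \<le> (\<integral>u. \<bar>x u\<bar> powr p \<partial>lebesgue_on {0..1})"
    using integral_mono[OF G F' le] FI by (simp add: integral_restrict_space)
qed

lemma Lp_norm_increment:
  assumes p: "1 \<le> p" and x: "Lp_fun (lebesgue_on {0..1}) p x"
  shows "Lp_fun (lebesgue_on (shift_dom h)) p (\<lambda>u. x (u + h) - x u)"
    and "Lp_norm (lebesgue_on (shift_dom h)) p (\<lambda>u. x (u + h) - x u)
      \<le> 2 * Lp_norm (lebesgue_on {0..1}) p x"
proof -
  note s = Lp_fun_shift[OF x, of h] and r = Lp_fun_restrict[OF x, of h]
  show "Lp_fun (lebesgue_on (shift_dom h)) p (\<lambda>u. x (u + h) - x u)"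
    using Lp_fun_add[OF p s(1) Lp_fun_uminus[OF r(1)]] by simp
  have "Lp_norm (lebesgue_on (shift_dom h)) p (\<lambda>u. x (u + h)) \<le> Lp_norm (lebesgue_on {0..1}) p x"
    "Lp_norm (lebesgue_on (shift_dom h)) p x \<le> Lp_norm (lebesgue_on {0..1}) p x"
    unfolding Lp_norm_def using s r p by (auto intro!: powr_mono2)
  then show "Lp_norm (lebesgue_on (shift_dom h)) p (\<lambda>u. x (u + h) - x u)
      \<le> 2 * Lp_norm (lebesgue_on {0..1}) p x"
    using Lp_norm_add_le[OF p s(1) Lp_fun_uminus[OF r(1)]] by (simp add: Lp_norm_uminus)
qed

lemma lp_mem_add: "1 \<le> p \<Longrightarrow> lp_mem p x \<Longrightarrow> lp_mem p y \<Longrightarrow> lp_mem p (x + y)"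
  by transfer (rule Lp_fun_add)

lemma lp_mem_uminus: "lp_mem p x \<Longrightarrow> lp_mem p (- x)"
  by transfer (rule Lp_fun_uminus)

lemma lp_norm_nonneg: "0 \<le> lp_norm p x"
  by transfer (rule Lp_norm_nonneg)

lemma lp_norm_zero: "lp_norm p 0 = 0"
  by transfer (simp add: Lp_norm_def)

lemma lp_norm_add_le:
  "1 \<le> p \<Longrightarrow> lp_mem p x \<Longrightarrow> lp_mem p y \<Longrightarrow> lp_norm p (x + y) \<le> lp_norm p x + lp_norm p y"
  by transfer (rule Lp_norm_add_le)

lemma lp_norm_uminus: "lp_norm p (- x) = lp_norm p x"
  by transfer (rule Lp_norm_uminus)

lemma lp_norm_eq_0: "1 \<le> p \<Longrightarrow> lp_mem p x \<Longrightarrow> lp_norm p x = 0 \<Longrightarrow> x = 0"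
  by transfer (auto simp: ae_rel_def dest: Lp_norm_eq_0)

lemma lp_modulus_zero: "0 \<le> \<delta> \<Longrightarrow> lp_modulus p 0 \<delta> = 0"
  by transfer (simp add: Lp_norm_def)

lemma lp_modulus_uminus: "lp_modulus p (- x) \<delta> = lp_modulus p x \<delta>"
proof transfer
  fix p \<delta> :: real and x :: "real \<Rightarrow> real"
  have "Lp_norm (lebesgue_on (shift_dom h)) p (\<lambda>u. - x (u + h) - - x u)
      = Lp_norm (lebesgue_on (shift_dom h)) p (\<lambda>u. x (u + h) - x u)" for h
    using Lp_norm_uminus[of _ p "\<lambda>u. x (u + h) - x u"] by simp
  then show "(SUP h\<in>{- \<delta>..\<delta>}. Lp_norm (lebesgue_on (shift_dom h)) p (\<lambda>u. - x (u + h) - - x u))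
      = (SUP h\<in>{- \<delta>..\<delta>}. Lp_norm (lebesgue_on (shift_dom h)) p (\<lambda>u. x (u + h) - x u))"
    by simp
qed

lemma increment_bdd_above:
  assumes "1 \<le> p" "Lp_fun (lebesgue_on {0..1}) p x"
  shows "bdd_above ((\<lambda>h. Lp_norm (lebesgue_on (shift_dom h)) p (\<lambda>u. x (u + h) - x u)) ` A)"
  using Lp_norm_increment(2)[OF assms] by (auto simp: bdd_above_def)

lemma lp_modulus_bounds:
  "1 \<le> p \<Longrightarrow> lp_mem p x \<Longrightarrow> 0 \<le> \<delta> \<Longrightarrow> 0 \<le> lp_modulus p x \<delta> \<and> lp_modulus p x \<delta> \<le> 2 * lp_norm p x"
proof transfer
  fix p \<delta> :: real and x :: "real \<Rightarrow> real"
  assume a: "1 \<le> p" "Lp_fun (lebesgue_on {0..1}) p x" and d: "0 \<le> \<delta>"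
  show "0 \<le> (SUP h\<in>{- \<delta>..\<delta>}. Lp_norm (lebesgue_on (shift_dom h)) p (\<lambda>u. x (u + h) - x u)) \<and>
    (SUP h\<in>{- \<delta>..\<delta>}. Lp_norm (lebesgue_on (shift_dom h)) p (\<lambda>u. x (u + h) - x u))
      \<le> 2 * Lp_norm (lebesgue_on {0..1}) p x"
  proof
    show "0 \<le> (SUP h\<in>{- \<delta>..\<delta>}. Lp_norm (lebesgue_on (shift_dom h)) p (\<lambda>u. x (u + h) - x u))"
      using d by (intro cSUP_upper2[OF increment_bdd_above[OF a], of 0] Lp_norm_nonneg) simp
    show "(SUP h\<in>{- \<delta>..\<delta>}. Lp_norm (lebesgue_on (shift_dom h)) p (\<lambda>u. x (u + h) - x u))
      \<le> 2 * Lp_norm (lebesgue_on {0..1}) p x"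
      using d by (intro cSUP_least Lp_norm_increment(2)[OF a]) simp
  qed
qed

lemma lp_modulus_add_le:
  "1 \<le> p \<Longrightarrow> lp_mem p x \<Longrightarrow> lp_mem p y \<Longrightarrow> 0 \<le> \<delta> \<Longrightarrow>
    lp_modulus p (x + y) \<delta> \<le> lp_modulus p x \<delta> + lp_modulus p y \<delta>"
proof transfer
  fix p \<delta> :: real and x y :: "real \<Rightarrow> real"
  assume p: "1 \<le> p" and x: "Lp_fun (lebesgue_on {0..1}) p x" and y: "Lp_fun (lebesgue_on {0..1}) p y"
    and d: "0 \<le> \<delta>"
  let ?N = "\<lambda>z h. Lp_norm (lebesgue_on (shift_dom h)) p (\<lambda>u. z (u + h) - z u)"
  show "(SUP h\<in>{- \<delta>..\<delta>}. Lp_norm (lebesgue_on (shift_dom h)) p (\<lambda>u. x (u + h) + y (u + h) - (x u + y u)))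
      \<le> (SUP h\<in>{- \<delta>..\<delta>}. ?N x h) + (SUP h\<in>{- \<delta>..\<delta>}. ?N y h)"
  proof (rule cSUP_least)
    show "{- \<delta>..\<delta>} \<noteq> {}" using d by simp
    fix h assume h: "h \<in> {- \<delta>..\<delta>}"
    have "Lp_norm (lebesgue_on (shift_dom h)) p (\<lambda>u. x (u + h) + y (u + h) - (x u + y u)) \<le> ?N x h + ?N y h"
      using Lp_norm_add_le[OF p Lp_norm_increment(1)[OF p x] Lp_norm_increment(1)[OF p y], of h]
      by (simp add: algebra_simps)
    also have "\<dots> \<le> (SUP h\<in>{- \<delta>..\<delta>}. ?N x h) + (SUP h\<in>{- \<delta>..\<delta>}. ?N y h)"
      using h by (intro add_mono cSUP_upper increment_bdd_above p x y)
    finally show "Lp_norm (lebesgue_on (shift_dom h)) p (\<lambda>u. x (u + h) + y (u + h) - (x u + y u))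
        \<le> (SUP h\<in>{- \<delta>..\<delta>}. ?N x h) + (SUP h\<in>{- \<delta>..\<delta>}. ?N y h)" .
  qed
qed

lemma besov_space_add:
  assumes p: "1 \<le> p" and x: "x \<in> besov_space p \<alpha>" and y: "y \<in> besov_space p \<alpha>"
  shows "x + y \<in> besov_space p \<alpha>"
proof -
  have m: "lp_mem p x" "lp_mem p y" using x y by (auto simp: besov_space_def)
  have lim: "((\<lambda>\<delta>. \<delta> powr (- \<alpha>) * lp_modulus p x \<delta> + \<delta> powr (- \<alpha>) * lp_modulus p y \<delta>) \<longlongrightarrow> 0) (at_right 0)"
    using x y by (intro tendsto_add_zero) (auto simp: besov_space_def)
  have "((\<lambda>\<delta>. \<delta> powr (- \<alpha>) * lp_modulus p (x + y) \<delta>) \<longlongrightarrow> 0) (at_right 0)"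
  proof (rule tendsto_sandwich[OF _ _ tendsto_const lim])
    show "\<forall>\<^sub>F \<delta> in at_right 0. 0 \<le> \<delta> powr (- \<alpha>) * lp_modulus p (x + y) \<delta>"
      using lp_modulus_bounds[OF p lp_mem_add[OF p m]]
      by (intro eventually_at_rightI[of 0 1]) auto
    show "\<forall>\<^sub>F \<delta> in at_right 0. \<delta> powr (- \<alpha>) * lp_modulus p (x + y) \<delta>
        \<le> \<delta> powr (- \<alpha>) * lp_modulus p x \<delta> + \<delta> powr (- \<alpha>) * lp_modulus p y \<delta>"
      using lp_modulus_add_le[OF p m]
      by (intro eventually_at_rightI[of 0 1]) (auto simp: distrib_left[symmetric] intro!: mult_left_mono)
  qed
  then show ?thesis using lp_mem_add[OF p m] by (simp add: besov_space_def)
qed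

lemma besov_space_uminus: "x \<in> besov_space p \<alpha> \<Longrightarrow> - x \<in> besov_space p \<alpha>"
  by (simp add: besov_space_def lp_mem_uminus lp_modulus_uminus)

lemma besov_space_diff:
  "1 \<le> p \<Longrightarrow> x \<in> besov_space p \<alpha> \<Longrightarrow> y \<in> besov_space p \<alpha> \<Longrightarrow> x - y \<in> besov_space p \<alpha>"
  using besov_space_add[of p x \<alpha> "- y"] besov_space_uminus[of y p \<alpha>] by simp

lemma besov_bdd_above:
  assumes p: "1 \<le> p" and a: "0 \<le> \<alpha>" and x: "x \<in> besov_space p \<alpha>"
  shows "bdd_above ((\<lambda>\<delta>. \<delta> powr (- \<alpha>) * lp_modulus p x \<delta>) ` {0<..<1})"
proof -
  have m: "lp_mem p x" and lim: "((\<lambda>\<delta>. \<delta> powr (- \<alpha>) * lp_modulus p x \<delta>) \<longlongrightarrow> 0) (at_right 0)"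
    using x by (auto simp: besov_space_def)
  have "\<forall>\<^sub>F \<delta> in at_right 0. \<delta> powr (- \<alpha>) * lp_modulus p x \<delta> < 1"
    using order_tendstoD(2)[OF lim, of 1] by simp
  then obtain b where b: "0 < b" "\<And>\<delta>. 0 < \<delta> \<Longrightarrow> \<delta> < b \<Longrightarrow> \<delta> powr (- \<alpha>) * lp_modulus p x \<delta> < 1"
    by (auto simp: eventually_at_right_field)
  have "\<delta> powr (- \<alpha>) * lp_modulus p x \<delta> \<le> max 1 (b powr (- \<alpha>) * (2 * lp_norm p x))"
    if "0 < \<delta>" for \<delta>
  proof (cases "\<delta> < b")
    case True
    then show ?thesis using b(2)[of \<delta>] that by simp
  next
    case False
    have "\<delta> powr (- \<alpha>) \<le> b powr (- \<alpha>)"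
      using False b(1) a by (intro powr_mono2') auto
    then have "\<delta> powr (- \<alpha>) * lp_modulus p x \<delta> \<le> b powr (- \<alpha>) * (2 * lp_norm p x)"
      using lp_modulus_bounds[OF p m, of \<delta>] that by (intro mult_mono) auto
    then show ?thesis by simp
  qed
  then show ?thesis by (intro bdd_aboveI2) auto
qed

lemma besov_norm_ge_lp_norm:
  assumes p: "1 \<le> p" and a: "0 \<le> \<alpha>" and x: "x \<in> besov_space p \<alpha>"
  shows "lp_norm p x \<le> besov_norm p \<alpha> x"
proof -
  have m: "lp_mem p x" using x by (auto simp: besov_space_def)
  have "0 \<le> (SUP \<delta>\<in>{0<..<1}. \<delta> powr (- \<alpha>) * lp_modulus p x \<delta>)"
    using lp_modulus_bounds[OF p m, of "1/2"]
    by (intro cSUP_upper2[OF besov_bdd_above[OF p a x], of "1/2"]) auto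
  then show ?thesis by (simp add: besov_norm_def)
qed

lemma besov_norm_add_le:
  assumes p: "1 \<le> p" and a: "0 \<le> \<alpha>" and x: "x \<in> besov_space p \<alpha>" and y: "y \<in> besov_space p \<alpha>"
  shows "besov_norm p \<alpha> (x + y) \<le> besov_norm p \<alpha> x + besov_norm p \<alpha> y"
proof -
  have m: "lp_mem p x" "lp_mem p y" using x y by (auto simp: besov_space_def)
  let ?S = "\<lambda>z. (SUP \<delta>\<in>{0<..<1}. \<delta> powr (- \<alpha>) * lp_modulus p z \<delta>)"
  have "?S (x + y) \<le> ?S x + ?S y"
  proof (rule cSUP_least)
    fix \<delta> :: real assume d: "\<delta> \<in> {0<..<1}"
    have "\<delta> powr (- \<alpha>) * lp_modulus p (x + y) \<delta>
        \<le> \<delta> powr (- \<alpha>) * lp_modulus p x \<delta> + \<delta> powr (- \<alpha>) * lp_modulus p y \<delta>"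
      using lp_modulus_add_le[OF p m, of \<delta>] d
      by (auto simp: distrib_left[symmetric] intro!: mult_left_mono)
    also have "\<dots> \<le> ?S x + ?S y"
      using d by (intro add_mono cSUP_upper besov_bdd_above[OF p a] x y)
    finally show "\<delta> powr (- \<alpha>) * lp_modulus p (x + y) \<delta> \<le> ?S x + ?S y" .
  qed simp
  then show ?thesis using lp_norm_add_le[OF p m] by (simp add: besov_norm_def)
qed

(* The metric locale demands nonnegativity on the whole type, and outside the Besov space the
   real-valued supremum in besov_norm may be over an unbounded set; hence the case distinction. *)
definition besov_dist :: "real \<Rightarrow> real \<Rightarrow> l0 \<Rightarrow> l0 \<Rightarrow> real" where
  "besov_dist p \<alpha> x y =
     (if x \<in> besov_space p \<alpha> \<and> y \<in> besov_space p \<alpha> then besov_norm p \<alpha> (x - y) else 0)"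

definition besov_topology :: "real \<Rightarrow> real \<Rightarrow> l0 topology" where
  "besov_topology p \<alpha> = Metric_space.mtopology (besov_space p \<alpha>) (besov_dist p \<alpha>)"

lemma Metric_space_besov:
  assumes p: "1 \<le> p" and a: "0 \<le> \<alpha>"
  shows "Metric_space (besov_space p \<alpha>) (besov_dist p \<alpha>)"
proof
  fix x y z
  show "0 \<le> besov_dist p \<alpha> x y"
    using besov_norm_ge_lp_norm[OF p a besov_space_diff[OF p], of x y] lp_norm_nonneg[of p "x - y"]
    by (auto simp: besov_dist_def)
  have "besov_norm p \<alpha> (- v) = besov_norm p \<alpha> v" for v
    by (simp add: besov_norm_def lp_norm_uminus lp_modulus_uminus)
  from this[of "x - y"] show "besov_dist p \<alpha> x y = besov_dist p \<alpha> y x"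
    by (simp add: besov_dist_def)
  assume x: "x \<in> besov_space p \<alpha>" and y: "y \<in> besov_space p \<alpha>"
  have z: "besov_norm p \<alpha> 0 = 0"
    by (simp add: besov_norm_def lp_norm_zero lp_modulus_zero cong: image_cong_simp)
  show "besov_dist p \<alpha> x y = 0 \<longleftrightarrow> x = y"
  proof
    assume "besov_dist p \<alpha> x y = 0"
    then have "lp_norm p (x - y) = 0"
      using besov_norm_ge_lp_norm[OF p a besov_space_diff[OF p x y]] lp_norm_nonneg[of p "x - y"] x y
      by (simp add: besov_dist_def)
    moreover have "lp_mem p (x - y)"
      using besov_space_diff[OF p x y] by (simp add: besov_space_def)
    ultimately show "x = y" using lp_norm_eq_0[OF p] by force
  qed (simp add: besov_dist_def z)
  assume w: "z \<in> besov_space p \<alpha>"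
  show "besov_dist p \<alpha> x z \<le> besov_dist p \<alpha> x y + besov_dist p \<alpha> y z"
    using besov_norm_add_le[OF p a besov_space_diff[OF p x y] besov_space_diff[OF p y w]] x y w
    by (simp add: besov_dist_def)
qed

lemma topspace_besov_topology:
  assumes "1 \<le> p" "0 \<le> \<alpha>"
  shows "topspace (besov_topology p \<alpha>) = besov_space p \<alpha>"
  using Metric_space.topspace_mtopology[OF Metric_space_besov[OF assms]]
  by (simp add: besov_topology_def)


section \<open>Convergence in distribution in a topological space\<close>

definition borel_of :: "'a topology \<Rightarrow> 'a measure" where
  "borel_of T = sigma (topspace T) {U. openin T U}"

definition weak_conv_on :: "'a topology \<Rightarrow> (nat \<Rightarrow> 'a measure) \<Rightarrow> 'a measure \<Rightarrow> bool" where
  "weak_conv_on T \<mu>s \<mu> \<longleftrightarrow>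
     (\<forall>f. continuous_map T euclideanreal f \<and> bounded (f ` topspace T) \<longrightarrow>
          (\<lambda>n. \<integral>x. f x \<partial>\<mu>s n) \<longlonglongrightarrow> (\<integral>x. f x \<partial>\<mu>))"

(* The sequence is indexed by n >= 1.  The limit only has to agree almost surely with a random
   element Z' of the space: a Wiener process has its paths in the Besov space only almost surely. *)
definition conv_in_distr ::
  "'c topology \<Rightarrow> (nat \<Rightarrow> 'a measure) \<Rightarrow> (nat \<Rightarrow> 'a \<Rightarrow> 'c) \<Rightarrow> 'b measure \<Rightarrow> ('b \<Rightarrow> 'c) \<Rightarrow> bool" where
  "conv_in_distr T M Y N Z \<longleftrightarrow>
     (\<forall>n\<ge>1. Y n \<in> M n \<rightarrow>\<^sub>M borel_of T) \<and>
     (\<exists>Z'. Z' \<in> N \<rightarrow>\<^sub>M borel_of T \<and> (AE \<omega> in N. Z' \<omega> = Z \<omega>) \<and>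
           weak_conv_on T (\<lambda>n. distr (M n) (borel_of T) (Y n)) (distr N (borel_of T) Z'))"


section \<open>Polygonal lines and the Wiener process\<close>

(* The affine interpolation through the points (v 1 + ... + v k, x 1 + ... + x k), k = 0, 1, ...;
   see polygonal_line_eq for the interpolation formula. *)
definition polygonal_line :: "(nat \<Rightarrow> real) \<Rightarrow> (nat \<Rightarrow> real) \<Rightarrow> real \<Rightarrow> real" where
  "polygonal_line v x t =
     (let k = (LEAST k. 1 \<le> k \<and> t \<le> (\<Sum>i=1..k. v i))
      in (\<Sum>i=1..k-1. x i) + (t - (\<Sum>i=1..k-1. v i)) / v k * x k)"

lemma polygonal_line_eq:
  assumes v: "\<And>j. j \<in> {1..m} \<Longrightarrow> 0 < v j" and k: "k \<in> {1..m}"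
    and t: "(\<Sum>i=1..k-1. v i) \<le> t" "t \<le> (\<Sum>i=1..k. v i)"
  shows "polygonal_line v x t = (\<Sum>i=1..k-1. x i) + (t - (\<Sum>i=1..k-1. v i)) / v k * x k"
proof -
  define l where "l = (LEAST l. 1 \<le> l \<and> t \<le> (\<Sum>i=1..l. v i))"
  have Pk: "1 \<le> k \<and> t \<le> (\<Sum>i=1..k. v i)" using k t by simp
  have l: "1 \<le> l" "t \<le> (\<Sum>i=1..l. v i)" and lk: "l \<le> k"
    using LeastI[of "\<lambda>l. 1 \<le> l \<and> t \<le> (\<Sum>i=1..l. v i)", OF Pk]
      Least_le[of "\<lambda>l. 1 \<le> l \<and> t \<le> (\<Sum>i=1..l. v i)", OF Pk]
    by (auto simp: l_def)
  have eq: "polygonal_line v x t = (\<Sum>i=1..l-1. x i) + (t - (\<Sum>i=1..l-1. v i)) / v l * x l"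
    by (simp add: polygonal_line_def l_def Let_def)
  have split: "(\<Sum>i=1..j. f i) = (\<Sum>i=1..j-1. f i) + f j" if "1 \<le> j" for j and f :: "nat \<Rightarrow> real"
    using that by (cases j) auto
  show ?thesis
  proof (cases "l = k")
    case False
    then have "l \<le> k - 1" using lk by simp
    have tl: "t = (\<Sum>i=1..l. v i)" and lk1: "l = k - 1"
    proof -
      have sub: "(\<Sum>i=1..k-1. v i) = (\<Sum>i=1..l. v i) + (\<Sum>i\<in>{l<..k-1}. v i)"
        using \<open>l \<le> k - 1\<close> by (subst sum.union_disjoint[symmetric]) (auto intro!: sum.cong)
      have "0 \<le> (\<Sum>i\<in>{l<..k-1}. v i)"
        using k by (intro sum_nonneg less_imp_le v) auto
      then show "t = (\<Sum>i=1..l. v i)" using sub t l by linarith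
      with sub t have s0: "(\<Sum>i\<in>{l<..k-1}. v i) \<le> 0" by simp
      show "l = k - 1"
      proof (rule ccontr)
        assume "l \<noteq> k - 1"
        then have "0 < (\<Sum>i\<in>{l<..k-1}. v i)"
          using \<open>l \<le> k - 1\<close> k by (intro sum_pos v) auto
        with s0 show False by simp
      qed
    qed
    have "0 < v l" using l(1) lk k by (intro v) auto
    then show ?thesis
      unfolding eq using tl lk1 split[OF l(1), of v] split[OF l(1), of x] by simp
  qed (simp add: eq)
qed

definition standard_wiener :: "'b measure \<Rightarrow> (real \<Rightarrow> 'b \<Rightarrow> real) \<Rightarrow> bool" where
  "standard_wiener N W \<longleftrightarrow>
     prob_space N \<and>
     (\<forall>t\<in>{0..1}. W t \<in> borel_measurable N) \<and>
     (AE \<omega> in N. W 0 \<omega> = 0) \<and>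
     (\<forall>r (t :: nat \<Rightarrow> real). strict_mono_on {..r} t \<and> t ` {..r} \<subseteq> {0..1} \<longrightarrow>
        prob_space.indep_vars N (\<lambda>_. borel) (\<lambda>i \<omega>. W (t (Suc i)) \<omega> - W (t i) \<omega>) {..<r}) \<and>
     (\<forall>s t. 0 \<le> s \<and> s < t \<and> t \<le> 1 \<longrightarrow>
        distributed N lborel (\<lambda>\<omega>. W t \<omega> - W s \<omega>) (normal_density 0 (sqrt (t - s)))) \<and>
     (AE \<omega> in N. continuous_on {0..1} (\<lambda>t. W t \<omega>))"

end

theory Submission
  imports Defs
begin

text \<open>
Everything reduces to the quadratic oscillation \<open>sq_osc x h\<close>, the integral of
\<open>(x (u + h) - x u)\<^sup>2\<close> over \<open>[0, 1 - h]\<close>. Suppose that \<open>sq_osc x h \<le> A * h\<close> for all \<open>h\<close> and that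
\<open>\<bar>x\<bar> \<le> b\<close> on the unit interval. Since \<open>\<alpha> < 1/2\<close> and \<open>\<alpha> \<le> 1/p\<close>, there is \<open>q > 2\<close> with \<open>p \<le> q\<close> and
\<open>\<alpha> * q \<le> 1\<close>. Interpolation between the quadratic mean and the supremum bounds the \<open>p\<close>-mean of an increment of
step \<open>h\<close> by a multiple of \<open>(A * h) powr (1/q) * b powr (1 - 2/q)\<close>, hence the Besov norm of \<open>x\<close> by \<open>b\<close> plus a
multiple of \<open>A powr (1/q) * b powr (1 - 2/q)\<close>. So for paths with a common constant \<open>A\<close>, uniform closeness implies
closeness in the Besov space (\<open>besov_dist_ae_class_le\<close>), and continuous paths with such a constant lie in
that space (\<open>besov_space_ae_class\<close>).

A common constant exists off an event of small probability, uniformly in the array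
(\<open>sq_osc_weighted_sum\<close>). A polygonal line is a sum of independent centred variables times monotone ramps, so
\<open>sq_osc\<close> is a quadratic form in these variables. Its diagonal part is at most \<open>h\<close> times the sum of the squares.
Its off-diagonal part is a martingale transform with second moment of order \<open>h ^ 3\<close>, so Chebyshev's inequality
at level \<open>h\<close> leaves a probability of order \<open>h\<close>, which is summable over dyadic \<open>h\<close>. As the square root of
\<open>sq_osc x\<close> is subadditive, the dyadic steps control all others (\<open>sq_osc_le_of_dyadic\<close>).

It remains to compare paths uniformly. The polygonal line is compared with the coarse polygon over the grid of
mesh \<open>1/K\<close>, whose increments are the sums of the variables over the blocks of nodes in the grid cells. Ottaviani's
inequality bounds the fluctuation inside a block by the block sum, which is close to a normal variable of variance
\<open>1/K\<close> by Lindeberg's central limit theorem. Its fourth moment is of order \<open>1/K\<^sup>2\<close>, so all \<open>K\<close> blocks together fail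
with a probability of order \<open>1/K\<close> (\<open>coarse_uniformly_close\<close>). For fixed \<open>K\<close>, the coarse polygon is a continuous
function of \<open>K\<close> independent block sums, which converge jointly to the increments of the Wiener process
(\<open>joint_block_limit\<close>). The Wiener path is close to its own interpolation on a fine grid by uniform continuity,
and it inherits the oscillation bound from its interpolations (\<open>trajectory_sq_osc\<close>).

These comparisons give convergence of the expectations of bounded Lipschitz functions, and a bounded continuous function is
an increasing limit of such functions, which gives weak convergence (\<open>weak_conv_on_of_lipschitz\<close>). A
measurable version of the Wiener path is obtained as an almost sure limit of its interpolations
(\<open>wiener_random_element\<close>).
\<close>


section \<open>Quadratic oscillation of a continuous function\<close>

definition sq_osc :: "(real \<Rightarrow> real) \<Rightarrow> real \<Rightarrow> real" where
  "sq_osc x h = integral {0..1 - h} (\<lambda>u. (x (u + h) - x u)\<^sup>2)"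

lemma continuous_on_shift:
  fixes x :: "real \<Rightarrow> real"
  assumes "continuous_on UNIV x"
  shows "continuous_on S (\<lambda>u. x (u + h))"
  by (rule continuous_on_compose2[OF assms]) (auto intro!: continuous_intros)

lemma continuous_on_increment:
  fixes x :: "real \<Rightarrow> real"
  assumes "continuous_on UNIV x"
  shows "continuous_on S (\<lambda>u. x (u + h) - x u)"
  by (intro continuous_intros continuous_on_shift assms continuous_on_subset[OF assms]) auto

lemma sq_increment_integrable:
  fixes x :: "real \<Rightarrow> real"
  assumes "continuous_on UNIV x"
  shows "(\<lambda>u. (x (u + h) - x u)\<^sup>2) integrable_on {a..b}"
  by (intro integrable_continuous_interval continuous_on_power continuous_on_increment assms)

lemma sq_osc_nonneg:
  assumes "continuous_on UNIV x"
  shows "0 \<le> sq_osc x h"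
  unfolding sq_osc_def by (intro integral_nonneg sq_increment_integrable assms) auto

lemma sq_osc_0 [simp]: "sq_osc x 0 = 0"
  by (simp add: sq_osc_def)

lemma continuous_on_abs_powr:
  fixes f :: "real \<Rightarrow> real"
  assumes "continuous_on S f" "1 \<le> p"
  shows "continuous_on S (\<lambda>u. \<bar>f u\<bar> powr p)"
  using assms by (intro continuous_on_powr' continuous_intros) auto

lemma Lp_fun_continuous:
  fixes f :: "real \<Rightarrow> real"
  assumes "continuous_on {a..b} f" "1 \<le> p"
  shows "Lp_fun (lebesgue_on {a..b}) p f"
    and "(\<integral>u. \<bar>f u\<bar> powr p \<partial>lebesgue_on {a..b}) = integral {a..b} (\<lambda>u. \<bar>f u\<bar> powr p)"
  using assms unfolding Lp_fun_def
  by (auto intro!: continuous_imp_integrable_real continuous_on_abs_powr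
      continuous_imp_measurable_on_sets_lebesgue lebesgue_integral_eq_integral)

lemma sqrt_integral_power2_add_le:
  fixes f g :: "real \<Rightarrow> real"
  assumes f: "continuous_on {a..b} f" and g: "continuous_on {a..b} g"
  shows "sqrt (integral {a..b} (\<lambda>u. (f u + g u)\<^sup>2))
    \<le> sqrt (integral {a..b} (\<lambda>u. (f u)\<^sup>2)) + sqrt (integral {a..b} (\<lambda>u. (g u)\<^sup>2))"
proof -
  have eq: "Lp_norm (lebesgue_on {a..b}) 2 F = sqrt (integral {a..b} (\<lambda>u. (F u)\<^sup>2))"
    if "continuous_on {a..b} F" for F :: "real \<Rightarrow> real"
  proof -
    have "0 \<le> integral {a..b} (\<lambda>u. (F u)\<^sup>2)"
      by (intro integral_nonneg integrable_continuous_interval continuous_intros that) auto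
    then show ?thesis
      unfolding Lp_norm_def using Lp_fun_continuous(2)[OF that, of 2] by (simp add: powr_half_sqrt)
  qed
  show ?thesis
    using Lp_norm_add_le[OF _ Lp_fun_continuous(1)[OF f] Lp_fun_continuous(1)[OF g], of 2]
    by (simp add: eq f g continuous_on_add)
qed

text \<open>An increment of step \<open>h + k\<close> is the sum of an increment of step \<open>h\<close> and one of step \<open>k\<close>, so
this is Minkowski's inequality in the space of square integrable functions.\<close>

lemma sqrt_sq_osc_add_le:
  assumes c: "continuous_on UNIV x" and "0 \<le> h" "0 \<le> k" "h + k \<le> 1"
  shows "sqrt (sq_osc x (h + k)) \<le> sqrt (sq_osc x h) + sqrt (sq_osc x k)"
proof -
  let ?I = "{0..1 - (h + k)}"
  have eq: "(x (u + (h + k)) - x u) = ((x (u + k + h) - x (u + k)) + (x (u + k) - x u))" for u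
    by (simp add: algebra_simps)
  have 1: "integral ?I (\<lambda>u. (x (u + k + h) - x (u + k))\<^sup>2) \<le> sq_osc x h"
  proof -
    have "integral ?I ((\<lambda>u. (x (u + h) - x u)\<^sup>2) \<circ> (\<lambda>u. u + k))
      = integral {0 + k..1 - (h + k) + k} (\<lambda>u. (x (u + h) - x u)\<^sup>2)"
      by (intro integral_shift continuous_on_power continuous_on_increment c)
    also have "\<dots> \<le> sq_osc x h"
      unfolding sq_osc_def using assms
      by (intro integral_subset_le sq_increment_integrable c) auto
    finally show ?thesis by (simp add: o_def)
  qed
  have 2: "integral ?I (\<lambda>u. (x (u + k) - x u)\<^sup>2) \<le> sq_osc x k"
    unfolding sq_osc_def using assms
    by (intro integral_subset_le sq_increment_integrable c) auto
  have "sqrt (sq_osc x (h + k)) \<le> sqrt (integral ?I (\<lambda>u. (x (u + k + h) - x (u + k))\<^sup>2))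
      + sqrt (integral ?I (\<lambda>u. (x (u + k) - x u)\<^sup>2))"
    unfolding sq_osc_def eq
    by (intro sqrt_integral_power2_add_le continuous_on_increment c
        continuous_on_compose2[OF continuous_on_increment[OF c, where S=UNIV]] continuous_intros) auto
  with real_sqrt_le_mono[OF 1] real_sqrt_le_mono[OF 2] show ?thesis by linarith
qed

lemma sq_osc_diff_le:
  assumes x: "continuous_on UNIV x" and y: "continuous_on UNIV y"
  shows "sq_osc (\<lambda>t. x t - y t) h \<le> 2 * sq_osc x h + 2 * sq_osc y h"
proof -
  have "sq_osc (\<lambda>t. x t - y t) h
      \<le> integral {0..1 - h} (\<lambda>u. 2 * (x (u + h) - x u)\<^sup>2 + 2 * (y (u + h) - y u)\<^sup>2)"
    unfolding sq_osc_def
  proof (intro integral_le sq_increment_integrable continuous_on_diff x y integrable_add)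
    fix u
    show "(x (u + h) - y (u + h) - (x u - y u))\<^sup>2 \<le> 2 * (x (u + h) - x u)\<^sup>2 + 2 * (y (u + h) - y u)\<^sup>2"
      using sum_squares_bound[of "x (u + h) - x u" "- (y (u + h) - y u)"]
      by (auto simp: power2_eq_square algebra_simps)
  qed (intro integrable_on_mult_right sq_increment_integrable x y)+
  also have "\<dots> = 2 * sq_osc x h + 2 * sq_osc y h"
    unfolding sq_osc_def
    by (subst integral_add) (auto intro!: integrable_on_mult_right sq_increment_integrable x y)
  finally show ?thesis .
qed

text \<open>Oscillation bounds survive bounded pointwise convergence, even when the step converges as well.
It is used for the passage from dyadic steps to all steps and for the passage from interpolations to the Wiener path.\<close>

lemma sq_osc_le_of_limit:
  assumes x: "continuous_on UNIV x" and y: "\<And>m::nat. continuous_on UNIV (y m)"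
    and h: "0 \<le> h" "h \<le> 1" and k: "\<And>m. 0 \<le> k m" "\<And>m. k m \<le> h"
    and lim: "\<And>u. 0 \<le> u \<Longrightarrow> u \<le> 1 - h \<Longrightarrow> (\<lambda>m. y m (u + k m) - y m u) \<longlonglongrightarrow> x (u + h) - x u"
    and bd: "\<And>m t. 0 \<le> t \<Longrightarrow> t \<le> 1 \<Longrightarrow> \<bar>y m t\<bar> \<le> C"
    and le: "\<And>m. sq_osc (y m) (k m) \<le> B"
  shows "sq_osc x h \<le> B"
proof -
  have "(\<lambda>m. integral {0..1 - h} (\<lambda>u. (y m (u + k m) - y m u)\<^sup>2)) \<longlonglongrightarrow> sq_osc x h"
    unfolding sq_osc_def
  proof (rule dominated_convergence(2)[where h = "\<lambda>_. (2 * C)\<^sup>2"])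
    fix m u assume u: "u \<in> {0..1 - h}"
    then have "\<bar>y m (u + k m)\<bar> \<le> C" "\<bar>y m u\<bar> \<le> C"
      using k[of m] h by (intro bd; simp)+
    then have "\<bar>y m (u + k m) - y m u\<bar> \<le> 2 * C" by linarith
    then show "norm ((y m (u + k m) - y m u)\<^sup>2) \<le> (2 * C)\<^sup>2"
      using power_mono[of "\<bar>y m (u + k m) - y m u\<bar>" "2 * C" 2] by simp
  qed (auto intro!: sq_increment_integrable y tendsto_power lim)
  moreover have "integral {0..1 - h} (\<lambda>u. (y m (u + k m) - y m u)\<^sup>2) \<le> B" for m
  proof -
    have "integral {0..1 - h} (\<lambda>u. (y m (u + k m) - y m u)\<^sup>2) \<le> sq_osc (y m) (k m)"
      unfolding sq_osc_def using k[of m]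
      by (intro integral_subset_le sq_increment_integrable y) auto
    with le[of m] show ?thesis by linarith
  qed
  ultimately show ?thesis by (auto intro: LIMSEQ_le_const2)
qed

text \<open>Halving \<open>l\<close> splits off at most one dyadic step of the finest scale, so the binary expansion of the
step uses each of the scales \<open>j\<close>, ..., \<open>j + m\<close> at most once.\<close>

lemma sqrt_sq_osc_dyadic_rational:
  assumes c: "continuous_on UNIV x" and s: "0 \<le> s" "0 \<le> r"
    and le: "\<And>j. sqrt (sq_osc x (1 / 2 ^ j)) \<le> s * r ^ j"
    and l: "l \<le> 2 ^ m"
  shows "sqrt (sq_osc x (real l / 2 ^ (j + m))) \<le> (\<Sum>i=j..j+m. s * r ^ i)"
  using l
proof (induction m arbitrary: l)
  case 0
  then have "l = 0 \<or> l = 1" by auto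
  then show ?case using le[of j] s by auto
next
  case (Suc m)
  define k where "k = l div 2"
  have k: "k \<le> 2 ^ m" using Suc.prems by (simp add: k_def)
  have half: "real (2 * k) / 2 ^ (j + Suc m) = real k / 2 ^ (j + m)" by simp
  have p: "0 \<le> s * r ^ (j + Suc m)" using s by simp
  have sm: "(\<Sum>i=j..j+Suc m. s * r ^ i) = (\<Sum>i=j..j+m. s * r ^ i) + s * r ^ (j + Suc m)"
    by simp
  consider "l = 2 * k" | "l = 2 * k + 1" unfolding k_def by linarith
  then show ?case
  proof cases
    case 1
    then show ?thesis using Suc.IH[OF k] half p sm by simp
  next
    case 2
    have "real l \<le> 2 ^ Suc m" using Suc.prems by (metis of_nat_le_iff of_nat_numeral of_nat_power)
    also have "\<dots> \<le> 2 ^ (j + Suc m)" by (intro power_increasing) auto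
    finally have l1: "real l / 2 ^ (j + Suc m) \<le> 1" by simp
    have eq: "real l / 2 ^ (j + Suc m) = real k / 2 ^ (j + m) + 1 / 2 ^ (j + Suc m)"
      using 2 half by (simp add: add_divide_distrib)
    have "sqrt (sq_osc x (real l / 2 ^ (j + Suc m)))
        \<le> sqrt (sq_osc x (real k / 2 ^ (j + m))) + sqrt (sq_osc x (1 / 2 ^ (j + Suc m)))"
      unfolding eq using l1[unfolded eq] by (intro sqrt_sq_osc_add_le c) auto
    also have "\<dots> \<le> (\<Sum>i=j..j+m. s * r ^ i) + s * r ^ (j + Suc m)"
      by (intro add_mono Suc.IH k le)
    finally show ?thesis using sm by simp
  qed
qed

text \<open>For the scale \<open>j\<close> with \<open>1 / 2 ^ Suc j < h \<le> 1 / 2 ^ j\<close>, the binary expansion of \<open>h\<close>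
starts at \<open>j\<close>, and the roots of the dyadic bounds form a geometric series of ratio \<open>1 / sqrt 2 \<le> 3 / 4\<close>, whose sum
is at most \<open>4\<close> times its first term. Squaring gives \<open>16 * a / 2 ^ j \<le> 32 * a * h\<close>.\<close>

lemma sq_osc_le_of_dyadic:
  assumes c: "continuous_on UNIV x" and a: "0 \<le> a"
    and le: "\<And>j. sq_osc x (1 / 2 ^ j) \<le> a / 2 ^ j"
    and h: "0 \<le> h" "h \<le> 1"
  shows "sq_osc x h \<le> 32 * a * h"
proof (cases "h = 0")
  case False
  with h have h0: "0 < h" by simp
  define r :: real where "r = 1 / sqrt 2"
  have r: "0 \<le> r" "r ^ 2 = 1 / 2" by (auto simp: r_def power_divide)
  have r34: "r \<le> 3 / 4" by (rule power2_le_imp_le) (auto simp: r(2) power_divide)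
  have rp: "(r ^ j) ^ 2 = 1 / 2 ^ j" for j
    by (metis power_mult mult.commute r(2) power_one_over)
  have sle: "sqrt (sq_osc x (1 / 2 ^ j)) \<le> sqrt a * r ^ j" for j
    using real_sqrt_le_mono[OF le[of j]] r(1) a
    by (metis rp real_sqrt_mult real_sqrt_unique zero_le_power mult.right_neutral times_divide_eq_right)
  \<comment> \<open>the dyadic scale just above \<open>h\<close>, and the truncations \<open>k m\<close> of the binary expansion of \<open>h\<close>\<close>
  have "\<exists>j. 1 / 2 ^ Suc j < h"
  proof -
    obtain n where "(1 / 2) ^ n < h" using real_arch_pow_inv[OF h0, of "1/2"] by auto
    moreover have "1 / 2 ^ Suc n \<le> (1 / 2 :: real) ^ n" by (simp add: power_one_over field_simps)
    ultimately show ?thesis by (intro exI[of _ n]) linarith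
  qed
  define j where "j = (LEAST j. 1 / 2 ^ Suc j < h)"
  have j1: "1 / 2 ^ Suc j < h" unfolding j_def by (rule LeastI_ex) fact
  have j2: "h \<le> 1 / 2 ^ j"
  proof (cases j)
    case (Suc i)
    then have "\<not> 1 / 2 ^ Suc i < h" unfolding j_def by (metis not_less_Least lessI)
    then show ?thesis using Suc by simp
  qed (use h in simp)
  define l where "l m = nat \<lfloor>h * 2 ^ (j + m)\<rfloor>" for m
  define k where "k m = real (l m) / 2 ^ (j + m)" for m
  have lr: "real (l m) \<le> h * 2 ^ (j + m)" "h * 2 ^ (j + m) < real (l m) + 1" for m
    unfolding l_def using h0 by (auto simp: of_nat_nat)
  have l2: "l m \<le> 2 ^ m" for m
  proof -
    have "real (l m) \<le> h * 2 ^ (j + m)" by (rule lr)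
    also have "\<dots> \<le> 1 / 2 ^ j * 2 ^ (j + m)" by (intro mult_right_mono j2) auto
    also have "\<dots> = 2 ^ m" by (simp add: power_add)
    finally show ?thesis by (metis of_nat_le_iff of_nat_numeral of_nat_power)
  qed
  have geo: "(\<Sum>i=j..j+m. sqrt a * r ^ i) \<le> 4 * sqrt a * r ^ j" for m
  proof -
    have "(\<Sum>i=j..j+m. r ^ i) = r ^ j * (\<Sum>i\<le>m. r ^ i)"
      by (simp add: sum_distrib_left power_add[symmetric] atMost_atLeast0 
          sum.shift_bounds_cl_nat_ivl[of _ 0 j m, simplified, symmetric] add.commute)
    also have "\<dots> \<le> r ^ j * 4"
    proof (intro mult_left_mono)
      have "(\<Sum>i\<le>m. r ^ i) * (1 - r) = 1 - r ^ Suc m"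
        using r34 by (simp add: sum_gp0 )
      also have "\<dots> \<le> 1" using r by simp
      finally have "(\<Sum>i\<le>m. r ^ i) * (1 - r) \<le> 1" .
      moreover have "(\<Sum>i\<le>m. r ^ i) * (1 / 4) \<le> (\<Sum>i\<le>m. r ^ i) * (1 - r)"
        using r34 r by (intro mult_left_mono sum_nonneg) auto
      ultimately show "(\<Sum>i\<le>m. r ^ i) \<le> 4" by linarith
    qed (use r in simp)
    finally have "(\<Sum>i=j..j+m. r ^ i) \<le> 4 * r ^ j" by simp
    then have "sqrt a * (\<Sum>i=j..j+m. r ^ i) \<le> sqrt a * (4 * r ^ j)"
      using a by (intro mult_left_mono) auto
    then show ?thesis by (simp add: sum_distrib_left mult_ac)
  qed
  have osc: "sq_osc x (k m) \<le> 32 * a * h" for m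
  proof -
    have "sqrt (sq_osc x (k m)) \<le> 4 * sqrt a * r ^ j"
      unfolding k_def
      using sqrt_sq_osc_dyadic_rational[OF c _ r(1) sle l2[of m], of j] a geo[of m] by simp
    then have "(sqrt (sq_osc x (k m)))\<^sup>2 \<le> (4 * sqrt a * r ^ j)\<^sup>2"
      by (intro power_mono) (auto simp: sq_osc_nonneg[OF c])
    then have "sq_osc x (k m) \<le> 16 * a * (1 / 2 ^ j)"
      using a by (simp add: power_mult_distrib rp sq_osc_nonneg[OF c])
    also have "\<dots> \<le> 16 * a * (2 * h)"
      using j1 a by (intro mult_left_mono) auto
    finally show ?thesis by simp
  qed
  have k: "0 \<le> k m" "k m \<le> h" for m
    using lr(1)[of m] by (auto simp: k_def field_simps)
  have klim: "k \<longlonglongrightarrow> h"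
  proof (rule tendsto_sandwich[OF _ _ _ tendsto_const])
    show "\<forall>\<^sub>F m in sequentially. h - (1/2) ^ m \<le> k m"
    proof (rule always_eventually, rule allI)
      fix m
      have "h * 2 ^ (j + m) \<le> real (l m) + 1" using lr(2)[of m] by simp
      then have "h \<le> (real (l m) + 1) / 2 ^ (j + m)" by (simp add: field_simps)
      also have "\<dots> = k m + 1 / 2 ^ (j + m)" by (simp add: k_def add_divide_distrib)
      also have "1 / 2 ^ (j + m) \<le> 1 / (2::real) ^ m"
        by (intro divide_left_mono power_increasing) auto
      finally show "h - (1/2) ^ m \<le> k m" by (simp add: power_one_over)
    qed
    have "(\<lambda>m. h - (1/2) ^ m) \<longlonglongrightarrow> h - 0" by (intro tendsto_intros) auto
    then show "(\<lambda>m. h - (1/2) ^ m) \<longlonglongrightarrow> h" by simp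
  qed (use k in auto)
  have "compact (x ` {0..1})"
    by (intro compact_continuous_image continuous_on_subset[OF c]) auto
  then obtain C where C: "\<And>t. t \<in> {0..1} \<Longrightarrow> \<bar>x t\<bar> \<le> C"
    by (metis compact_imp_bounded bounded_iff imageI real_norm_def)
  show ?thesis
  proof (rule sq_osc_le_of_limit[OF c, of "\<lambda>_. x" h k C])
    fix u :: real
    have "isCont x (u + h)" using c by (simp add: continuous_on_eq_continuous_at)
    moreover have "(\<lambda>m. u + k m) \<longlonglongrightarrow> u + h" by (intro tendsto_intros klim)
    ultimately have "(\<lambda>m. x (u + k m)) \<longlonglongrightarrow> x (u + h)" by (rule isCont_tendsto_compose)
    then show "(\<lambda>m. x (u + k m) - x u) \<longlonglongrightarrow> x (u + h) - x u" by (intro tendsto_intros)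
  qed (use c h k osc C in auto)
qed simp


section \<open>Besov norm bounds from quadratic oscillation\<close>

locale besov_exponents =
  fixes p \<alpha> q :: real
  assumes p: "1 \<le> p" and \<alpha>: "0 \<le> \<alpha>" and q: "2 < q" and pq: "p \<le> q" and \<alpha>q: "\<alpha> * q \<le> 1"

text \<open>The exponent is \<open>p\<close> itself if \<open>p > 2\<close>, and \<open>1 / \<alpha>\<close> (or any number above \<open>2\<close> if \<open>\<alpha> = 0\<close>) otherwise.
This is where both upper bounds on \<open>\<alpha>\<close> enter.\<close>

lemma besov_exponents_exist:
  fixes p \<alpha> :: real
  assumes "1 \<le> p" "0 \<le> \<alpha>" "\<alpha> < 1 / 2" "\<alpha> \<le> 1 / p"
  shows "\<exists>q. besov_exponents p \<alpha> q"
proof -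
  consider "2 < p" | "p \<le> 2" "\<alpha> = 0" | "p \<le> 2" "0 < \<alpha>" using assms by linarith
  then show ?thesis
  proof cases
    case 1
    then have "besov_exponents p \<alpha> p" using assms by unfold_locales (auto simp: field_simps)
    then show ?thesis ..
  next
    case 2
    then have "besov_exponents p \<alpha> 3" using assms by unfold_locales auto
    then show ?thesis ..
  next
    case 3
    then have "besov_exponents p \<alpha> (1 / \<alpha>)" using assms by unfold_locales (auto simp: field_simps)
    then show ?thesis ..
  qed
qed

lemma ae_rel_continuous: "continuous_on {0..1} x \<Longrightarrow> ae_rel x x"
  by (simp add: ae_rel_def continuous_imp_measurable_on_sets_lebesgue)

context besov_exponents
begin

text \<open>A bound for the \<open>p\<close>-mean of a function on an interval of length at most one with quadratic integral at
most \<open>A\<close> and supremum at most \<open>b\<close>; since \<open>q > 2\<close>, it vanishes with \<open>b\<close>.\<close>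

definition besov_bound :: "real \<Rightarrow> real \<Rightarrow> real" where
  "besov_bound A b = 2 * (A powr (1 / q) * b powr (1 - 2 / q))"

lemma besov_bound_nonneg: "0 \<le> besov_bound A b"
  by (simp add: besov_bound_def)

lemma besov_bound_tendsto_0: "((\<lambda>b. besov_bound A b) \<longlongrightarrow> 0) (at_right 0)"
proof -
  have "((\<lambda>b. b powr (1 - 2 / q)) \<longlongrightarrow> 0 powr (1 - 2 / q)) (at_right 0)"
    using q by (intro tendsto_powr' tendsto_intros) (auto intro: eventually_at_rightI[of 0 1])
  then have "((\<lambda>b. 2 * (A powr (1 / q) * b powr (1 - 2 / q))) \<longlongrightarrow> 2 * (A powr (1 / q) * 0)) (at_right 0)"
    by (intro tendsto_intros) simp
  then show ?thesis by (simp add: besov_bound_def)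
qed

text \<open>Pointwise, \<open>\<bar>f\<bar> powr p\<close> is at most \<open>c powr p\<close> where \<open>\<bar>f\<bar> \<le> c\<close>, and at most
\<open>c powr (p - q) * B powr (q - 2) * f\<^sup>2\<close> elsewhere, because \<open>p \<le> q\<close>. The threshold
\<open>c = V powr (1/q) * B powr (1 - 2/q)\<close> makes the two contributions to the integral equal.\<close>

lemma Lp_norm_le_of_integral_power2:
  fixes f :: "real \<Rightarrow> real"
  assumes c: "continuous_on {a..b} f" and len: "a \<le> b" "b - a \<le> 1"
    and bd: "\<And>u. u \<in> {a..b} \<Longrightarrow> \<bar>f u\<bar> \<le> B" and B: "0 < B"
    and I: "integral {a..b} (\<lambda>u. (f u)\<^sup>2) \<le> V" and V: "0 < V"
  shows "Lp_norm (lebesgue_on {a..b}) p f \<le> besov_bound V B"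
proof -
  define c where "c = V powr (1 / q) * B powr (1 - 2 / q)"
  have c0: "0 < c" using V B by (simp add: c_def)
  have cq: "c powr q = V * B powr (q - 2)"
  proof -
    have "(1 - 2 / q) * q = q - 2" using q by (simp add: field_simps)
    then show ?thesis using V B q by (simp add: c_def powr_mult powr_powr)
  qed
  have pw: "\<bar>f u\<bar> powr p \<le> c powr p + c powr (p - q) * (B powr (q - 2) * (f u)\<^sup>2)"
    if u: "u \<in> {a..b}" for u
  proof (cases "\<bar>f u\<bar> \<le> c")
    case True
    then have "\<bar>f u\<bar> powr p \<le> c powr p" using p by (intro powr_mono2) auto
    then show ?thesis by (simp add: add_increasing2)
  next
    case False
    then have f0: "0 < \<bar>f u\<bar>" using c0 by linarith
    have "\<bar>f u\<bar> powr p = \<bar>f u\<bar> powr ((p - q) + ((q - 2) + 2))" by simp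
    also have "\<dots> = \<bar>f u\<bar> powr (p - q) * (\<bar>f u\<bar> powr (q - 2) * \<bar>f u\<bar> powr 2)"
      by (simp only: powr_add)
    also have "\<dots> \<le> c powr (p - q) * (B powr (q - 2) * \<bar>f u\<bar> powr 2)"
      using False f0 c0 q pq bd[OF u] by (intro mult_mono powr_mono2 powr_mono2') auto
    also have "\<bar>f u\<bar> powr 2 = (f u)\<^sup>2" by simp
    finally show ?thesis by (simp add: add_increasing)
  qed
  have int2: "(\<lambda>u. (f u)\<^sup>2) integrable_on {a..b}"
    by (intro integrable_continuous_interval continuous_intros c)
  have "integral {a..b} (\<lambda>u. \<bar>f u\<bar> powr p)
      \<le> integral {a..b} (\<lambda>u. c powr p + c powr (p - q) * (B powr (q - 2) * (f u)\<^sup>2))"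
    by (intro integral_le pw integrable_add integrable_on_mult_right int2
        integrable_continuous_interval continuous_on_abs_powr c p continuous_intros)
  also have "\<dots> = (b - a) * c powr p + c powr (p - q) * (B powr (q - 2) * integral {a..b} (\<lambda>u. (f u)\<^sup>2))"
    using len by (subst integral_add) (auto intro!: integrable_on_mult_right int2)
  also have "\<dots> \<le> 1 * c powr p + c powr (p - q) * (B powr (q - 2) * V)"
    using len by (intro add_mono mult_right_mono mult_left_mono I) auto
  also have "c powr (p - q) * (B powr (q - 2) * V) = c powr p"
    using c0 by (simp add: mult.commute[of _ V] cq[symmetric] powr_add[symmetric])
  finally have "integral {a..b} (\<lambda>u. \<bar>f u\<bar> powr p) \<le> 2 * c powr p" by simp
  also have "\<dots> \<le> 2 powr p * c powr p"
    using p powr_mono[of 1 p 2] by (intro mult_right_mono) auto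
  also have "\<dots> = (2 * c) powr p" using c0 by (simp add: powr_mult)
  finally have le: "integral {a..b} (\<lambda>u. \<bar>f u\<bar> powr p) \<le> (2 * c) powr p" .
  have "Lp_norm (lebesgue_on {a..b}) p f = integral {a..b} (\<lambda>u. \<bar>f u\<bar> powr p) powr (1 / p)"
    using Lp_fun_continuous(2)[OF c p] by (simp add: Lp_norm_def)
  also have "\<dots> \<le> ((2 * c) powr p) powr (1 / p)"
    using p le by (intro powr_mono2 integral_nonneg integrable_continuous_interval continuous_on_abs_powr c) auto
  also have "\<dots> = 2 * c" using p c0 by (simp add: powr_powr)
  finally show ?thesis by (simp add: besov_bound_def c_def)
qed

text \<open>The modulus of smoothness takes both signs of the step, and a translation exchanges them.\<close>

lemma Lp_norm_increment_neg:
  fixes x :: "real \<Rightarrow> real"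
  assumes x: "continuous_on UNIV x" and h: "0 \<le> h"
  shows "Lp_norm (lebesgue_on (shift_dom (- h))) p (\<lambda>u. x (u + - h) - x u)
    = Lp_norm (lebesgue_on (shift_dom h)) p (\<lambda>u. x (u + h) - x u)"
proof -
  have d: "shift_dom (- h) = {0 + h..1 - h + h}" "shift_dom h = {0..1 - h}" using h by auto
  have c: "continuous_on S (\<lambda>u. x (u + - h) - x u)" for S
    by (intro continuous_on_increment x)
  have "integral {0 + h..1 - h + h} (\<lambda>u. \<bar>x (u + - h) - x u\<bar> powr p)
      = integral {0..1 - h} ((\<lambda>u. \<bar>x (u + - h) - x u\<bar> powr p) \<circ> (\<lambda>u. u + h))"
    by (rule integral_shift[symmetric]) (intro continuous_on_abs_powr c p)
  also have "\<dots> = integral {0..1 - h} (\<lambda>u. \<bar>x (u + h) - x u\<bar> powr p)"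
    by (simp add: o_def abs_minus_commute)
  finally show ?thesis
    unfolding Lp_norm_def d
    using Lp_fun_continuous(2)[OF c[of "{0 + h..1 - h + h}"] p]
      Lp_fun_continuous(2)[OF continuous_on_increment[OF x, of "{0..1 - h}" h] p] by simp
qed

text \<open>The quadratic integral of an increment of step \<open>h \<le> \<delta>\<close> is at most \<open>A * h\<close>, which puts the factor
\<open>h powr (1 / q) \<le> \<delta> powr (1 / q) \<le> \<delta> powr \<alpha>\<close> in front of the bound.\<close>

lemma lp_modulus_le:
  assumes x: "continuous_on UNIV x" and A: "0 < A" "\<And>h. 0 \<le> h \<Longrightarrow> h \<le> 1 \<Longrightarrow> sq_osc x h \<le> A * h"
    and d: "0 < \<delta>" "\<delta> < 1"
    and b: "0 < b" "\<And>u v. u \<in> {0..1} \<Longrightarrow> v \<in> {0..1} \<Longrightarrow> \<bar>u - v\<bar> \<le> \<delta> \<Longrightarrow> \<bar>x u - x v\<bar> \<le> b"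
  shows "lp_modulus p (ae_class x) \<delta> \<le> \<delta> powr \<alpha> * besov_bound A b"
proof -
  have pos: "Lp_norm (lebesgue_on (shift_dom h)) p (\<lambda>u. x (u + h) - x u) \<le> \<delta> powr \<alpha> * besov_bound A b"
    if h: "0 \<le> h" "h \<le> \<delta>" for h
  proof (cases "h = 0")
    case True
    then show ?thesis using besov_bound_nonneg[of A b] p by (simp add: Lp_norm_def)
  next
    case False
    with h have h0: "0 < h" by simp
    have dom: "shift_dom h = {0..1 - h}" using h by auto
    have "Lp_norm (lebesgue_on {0..1 - h}) p (\<lambda>u. x (u + h) - x u) \<le> besov_bound (A * h) b"
      using h0 h d A(1) A(2)[of h] b
      by (intro Lp_norm_le_of_integral_power2 continuous_on_increment x) (auto simp: sq_osc_def)
    also have "besov_bound (A * h) b = h powr (1 / q) * besov_bound A b"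
      using A h0 by (simp add: besov_bound_def powr_mult)
    also have "\<dots> \<le> \<delta> powr \<alpha> * besov_bound A b"
    proof (intro mult_right_mono besov_bound_nonneg)
      have "h powr (1 / q) \<le> \<delta> powr (1 / q)" using h h0 q by (intro powr_mono2) auto
      also have "\<dots> \<le> \<delta> powr \<alpha>"
        using d \<alpha>q q by (intro powr_mono') (auto simp: field_simps)
      finally show "h powr (1 / q) \<le> \<delta> powr \<alpha>" .
    qed
    finally show ?thesis unfolding dom .
  qed
  have "Lp_norm (lebesgue_on (shift_dom h)) p (\<lambda>u. x (u + h) - x u) \<le> \<delta> powr \<alpha> * besov_bound A b"
    if h: "h \<in> {- \<delta>..\<delta>}" for h
  proof (cases "0 \<le> h")
    case True then show ?thesis using pos[of h] h by simp
  next
    case False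
    then show ?thesis using pos[of "- h"] Lp_norm_increment_neg[OF x, of "- h"] h by simp
  qed
  then have "(SUP h\<in>{- \<delta>..\<delta>}. Lp_norm (lebesgue_on (shift_dom h)) p (\<lambda>u. x (u + h) - x u))
      \<le> \<delta> powr \<alpha> * besov_bound A b"
    using d by (intro cSUP_least) auto
  then show ?thesis
    using lp_modulus.abs_eq[OF ae_rel_continuous[OF continuous_on_subset[OF x]], of p] by simp
qed

lemma lp_mem_continuous: "continuous_on UNIV x \<Longrightarrow> lp_mem p (ae_class x)"
  by (subst lp_mem.abs_eq)
    (auto intro!: ae_rel_continuous Lp_fun_continuous p elim: continuous_on_subset)

text \<open>Uniform continuity makes the increments of small step uniformly small, so the second argument of
\<open>besov_bound\<close> may be taken arbitrarily small, and with it the limit in the definition of the space.\<close>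

lemma besov_space_ae_class:
  assumes x: "continuous_on UNIV x" and A: "0 < A" "\<And>h. 0 \<le> h \<Longrightarrow> h \<le> 1 \<Longrightarrow> sq_osc x h \<le> A * h"
  shows "ae_class x \<in> besov_space p \<alpha>"
proof -
  have "((\<lambda>\<delta>. \<delta> powr (- \<alpha>) * lp_modulus p (ae_class x) \<delta>) \<longlongrightarrow> 0) (at_right 0)"
  proof (rule tendstoI)
    fix e :: real assume e: "0 < e"
    have "\<forall>\<^sub>F b in at_right 0. besov_bound A b < e"
      using order_tendstoD(2)[OF besov_bound_tendsto_0 e] .
    then obtain b where b: "0 < b" "besov_bound A b < e"
      by (metis (mono_tags) dense eventually_at_right_field)
    have "uniformly_continuous_on {0..1} x"
      by (intro compact_uniformly_continuous continuous_on_subset[OF x]) auto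
    then obtain d where d: "0 < d"
      "\<And>u v. u \<in> {0..1} \<Longrightarrow> v \<in> {0..1} \<Longrightarrow> dist v u < d \<Longrightarrow> dist (x v) (x u) < b"
      using b(1) unfolding uniformly_continuous_on_def by metis
    have "dist (\<delta> powr (- \<alpha>) * lp_modulus p (ae_class x) \<delta>) 0 < e"
      if \<delta>: "0 < \<delta>" "\<delta> < min 1 d" for \<delta>
    proof -
      have "lp_modulus p (ae_class x) \<delta> \<le> \<delta> powr \<alpha> * besov_bound A b"
        using \<delta> d b by (intro lp_modulus_le x A) (auto simp: dist_real_def less_imp_le)
      then have "\<delta> powr (- \<alpha>) * lp_modulus p (ae_class x) \<delta> \<le> \<delta> powr (- \<alpha>) * (\<delta> powr \<alpha> * besov_bound A b)"
        by (intro mult_left_mono) auto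
      also have "\<dots> = besov_bound A b" using \<delta> by (simp add: powr_minus field_simps)
      finally show ?thesis
        using b(2) lp_modulus_bounds[OF p lp_mem_continuous[OF x], of \<delta>] \<delta> by (simp add: dist_real_def)
    qed
    then show "\<forall>\<^sub>F \<delta> in at_right 0. dist (\<delta> powr (- \<alpha>) * lp_modulus p (ae_class x) \<delta>) 0 < e"
      using d(1) by (intro eventually_at_rightI[of 0 "min 1 d"]) auto
  qed
  then show ?thesis using lp_mem_continuous[OF x] by (simp add: besov_space_def)
qed

lemma besov_norm_ae_class_le:
  assumes x: "continuous_on UNIV x" and A: "0 < A" "\<And>h. 0 \<le> h \<Longrightarrow> h \<le> 1 \<Longrightarrow> sq_osc x h \<le> A * h"
    and b: "0 < b" "\<And>u. u \<in> {0..1} \<Longrightarrow> \<bar>x u\<bar> \<le> b"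
  shows "besov_norm p \<alpha> (ae_class x) \<le> b + besov_bound A (2 * b)"
proof -
  have "lp_norm p (ae_class x) \<le> b"
  proof -
    have c: "continuous_on {0..1} x" by (rule continuous_on_subset[OF x]) simp
    have "lp_norm p (ae_class x) = integral {0..1} (\<lambda>u. \<bar>x u\<bar> powr p) powr (1 / p)"
      by (subst lp_norm.abs_eq) (auto intro!: ae_rel_continuous c simp: Lp_norm_def Lp_fun_continuous(2)[OF c p])
    also have "\<dots> \<le> integral {0..1} (\<lambda>u::real. b powr p) powr (1 / p)"
      using p b by (intro powr_mono2 integral_nonneg integral_le integrable_continuous_interval
          continuous_on_abs_powr c continuous_intros powr_mono2) auto
    also have "\<dots> = b" using b p by (simp add: powr_powr)
    finally show ?thesis .
  qed
  moreover have "(SUP \<delta>\<in>{0<..<1}. \<delta> powr (- \<alpha>) * lp_modulus p (ae_class x) \<delta>) \<le> besov_bound A (2 * b)"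
  proof (rule cSUP_least)
    fix \<delta> :: real assume \<delta>: "\<delta> \<in> {0<..<1}"
    have "lp_modulus p (ae_class x) \<delta> \<le> \<delta> powr \<alpha> * besov_bound A (2 * b)"
    proof (intro lp_modulus_le x A)
      fix u v :: real assume "u \<in> {0..1}" "v \<in> {0..1}"
      then show "\<bar>x u - x v\<bar> \<le> 2 * b" using b(2)[of u] b(2)[of v] by linarith
    qed (use \<delta> b in auto)
    then have "\<delta> powr (- \<alpha>) * lp_modulus p (ae_class x) \<delta> \<le> \<delta> powr (- \<alpha>) * (\<delta> powr \<alpha> * besov_bound A (2 * b))"
      by (intro mult_left_mono) auto
    also have "\<dots> = besov_bound A (2 * b)" using \<delta> by (simp add: powr_minus field_simps)
    finally show "\<delta> powr (- \<alpha>) * lp_modulus p (ae_class x) \<delta> \<le> besov_bound A (2 * b)" .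
  qed simp
  ultimately show ?thesis by (simp add: besov_norm_def)
qed

end


section \<open>Second moments of martingale transforms and quadratic forms\<close>

lemma (in prob_space) indep_vars_product_split:
  fixes f g :: "(nat \<Rightarrow> real) \<Rightarrow> real"
  assumes ind: "indep_vars (\<lambda>_. borel) X I" and AB: "A \<inter> B = {}" "A \<subseteq> I" "B \<subseteq> I"
    and f: "f \<in> borel_measurable (Pi\<^sub>M A (\<lambda>_. borel))" and g: "g \<in> borel_measurable (Pi\<^sub>M B (\<lambda>_. borel))"
    and fi: "integrable M (\<lambda>\<omega>. f (restrict (\<lambda>i. X i \<omega>) A))"
    and gi: "integrable M (\<lambda>\<omega>. g (restrict (\<lambda>i. X i \<omega>) B))"
  shows "integrable M (\<lambda>\<omega>. f (restrict (\<lambda>i. X i \<omega>) A) * g (restrict (\<lambda>i. X i \<omega>) B))"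
    and "expectation (\<lambda>\<omega>. f (restrict (\<lambda>i. X i \<omega>) A) * g (restrict (\<lambda>i. X i \<omega>) B))
      = expectation (\<lambda>\<omega>. f (restrict (\<lambda>i. X i \<omega>) A)) * expectation (\<lambda>\<omega>. g (restrict (\<lambda>i. X i \<omega>) B))"
proof -
  have iv: "indep_var borel (\<lambda>\<omega>. f (restrict (\<lambda>i. X i \<omega>) A)) borel (\<lambda>\<omega>. g (restrict (\<lambda>i. X i \<omega>) B))"
    using indep_var_compose[OF indep_var_restrict[OF ind AB] f g] by (simp add: comp_def)
  show "integrable M (\<lambda>\<omega>. f (restrict (\<lambda>i. X i \<omega>) A) * g (restrict (\<lambda>i. X i \<omega>) B))"
    by (rule indep_var_integrable[OF iv fi gi])
  show "expectation (\<lambda>\<omega>. f (restrict (\<lambda>i. X i \<omega>) A) * g (restrict (\<lambda>i. X i \<omega>) B))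
      = expectation (\<lambda>\<omega>. f (restrict (\<lambda>i. X i \<omega>) A)) * expectation (\<lambda>\<omega>. g (restrict (\<lambda>i. X i \<omega>) B))"
    by (rule indep_var_lebesgue_integral[OF iv fi gi])
qed

lemma integrable_mult_of_squares:
  fixes f g :: "'a \<Rightarrow> real"
  assumes "f \<in> borel_measurable M" "g \<in> borel_measurable M"
    "integrable M (\<lambda>x. (f x)\<^sup>2)" "integrable M (\<lambda>x. (g x)\<^sup>2)"
  shows "integrable M (\<lambda>x. f x * g x)"
proof (rule Bochner_Integration.integrable_bound)
  show "integrable M (\<lambda>x. (f x)\<^sup>2 + (g x)\<^sup>2)" using assms by simp
  have "\<bar>f x * g x\<bar> \<le> (f x)\<^sup>2 + (g x)\<^sup>2" for x
  proof -
    have "2 * \<bar>f x * g x\<bar> \<le> (f x)\<^sup>2 + (g x)\<^sup>2"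
      using sum_squares_bound[of "\<bar>f x\<bar>" "\<bar>g x\<bar>"] by (simp add: abs_mult)
    then show ?thesis using abs_ge_zero[of "f x * g x"] by linarith
  qed
  then show "AE x in M. norm (f x * g x) \<le> norm ((f x)\<^sup>2 + (g x)\<^sup>2)" by simp
qed (intro borel_measurable_times assms)

text \<open>Orthogonality of martingale differences: each \<open>R k\<close> depends only on the variables before
\<open>k\<close>, so \<open>X k\<close> is independent of \<open>R k\<close> and of the preceding partial sum, and the cross terms vanish.\<close>

lemma (in prob_space) martingale_transform_second_moment:
  fixes X :: "nat \<Rightarrow> 'a \<Rightarrow> real" and r :: "nat \<Rightarrow> (nat \<Rightarrow> real) \<Rightarrow> real"
  defines "R \<equiv> \<lambda>k \<omega>. r k (restrict (\<lambda>i. X i \<omega>) {1..<k})"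
  assumes ind: "indep_vars (\<lambda>_. borel) X {1..m}"
    and sq: "\<And>k. k \<in> {1..m} \<Longrightarrow> integrable M (\<lambda>\<omega>. (X k \<omega>)\<^sup>2)"
    and mean: "\<And>k. k \<in> {1..m} \<Longrightarrow> expectation (X k) = 0"
    and r: "\<And>k. k \<in> {1..m} \<Longrightarrow> r k \<in> borel_measurable (Pi\<^sub>M {1..<k} (\<lambda>_. borel))"
    and R: "\<And>k. k \<in> {1..m} \<Longrightarrow> integrable M (\<lambda>\<omega>. (R k \<omega>)\<^sup>2)"
    and n: "n \<le> m"
  shows "integrable M (\<lambda>\<omega>. (\<Sum>k=1..n. X k \<omega> * R k \<omega>)\<^sup>2) \<and>
    expectation (\<lambda>\<omega>. (\<Sum>k=1..n. X k \<omega> * R k \<omega>)\<^sup>2)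
      = (\<Sum>k=1..n. expectation (\<lambda>\<omega>. (X k \<omega>)\<^sup>2) * expectation (\<lambda>\<omega>. (R k \<omega>)\<^sup>2))"
  using n
proof (induction n)
  case (Suc n)
  let ?P = "\<lambda>J. Pi\<^sub>M J (\<lambda>_. borel :: real measure)"
  let ?j = "Suc n" and ?A = "{Suc n}" and ?B = "{1..<Suc n}"
  have rv: "random_variable borel (X k)" if "k \<in> {1..m}" for k
    using ind that by (auto simp: indep_vars_def)
  have Xi: "integrable M (X k)" if "k \<in> {1..m}" for k
    by (rule square_integrable_imp_integrable) (use rv sq that in auto)
  have j: "?j \<in> {1..m}" using Suc.prems by simp
  define z where "z y = (\<Sum>k=1..n. y k * r k (restrict y {1..<k}))" for y
  define Z where "Z \<omega> = (\<Sum>k=1..n. X k \<omega> * R k \<omega>)" for \<omega>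
  have z: "z \<in> borel_measurable (?P ?B)"
    unfolding z_def
  proof (intro borel_measurable_sum borel_measurable_times)
    fix k assume k: "k \<in> {1..n}"
    then show "(\<lambda>y. y k) \<in> borel_measurable (?P ?B)"
      by (intro measurable_component_singleton) auto
    have "(\<lambda>y. restrict y {1..<k}) \<in> ?P ?B \<rightarrow>\<^sub>M ?P {1..<k}"
      using k by (intro measurable_restrict_subset) auto
    then show "(\<lambda>y. r k (restrict y {1..<k})) \<in> borel_measurable (?P ?B)"
      using k Suc.prems by (intro measurable_compose[OF _ r]) auto
  qed
  have rj: "r ?j \<in> borel_measurable (?P ?B)" using r[OF j] by simp
  have Zz: "Z \<omega> = z (restrict (\<lambda>i. X i \<omega>) ?B)" for \<omega>
    unfolding Z_def z_def R_def
    by (intro sum.cong arg_cong2[where f = "(*)"] arg_cong[where f = "r _"]) (auto simp: restrict_def fun_eq_iff)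
  have Rj: "R ?j \<omega> = r ?j (restrict (\<lambda>i. X i \<omega>) ?B)" for \<omega> by (simp add: R_def)
  have rvX: "(\<lambda>\<omega>. restrict (\<lambda>i. X i \<omega>) ?B) \<in> M \<rightarrow>\<^sub>M ?P ?B"
    using rv Suc.prems by (intro measurable_restrict) auto
  have [measurable]: "Z \<in> borel_measurable M" "R ?j \<in> borel_measurable M" "X ?j \<in> borel_measurable M"
    using measurable_compose[OF rvX z] measurable_compose[OF rvX rj] rv[OF j]
    by (simp_all add: Zz[abs_def] Rj[abs_def])
  have IH: "integrable M (\<lambda>\<omega>. (Z \<omega>)\<^sup>2)"
    "expectation (\<lambda>\<omega>. (Z \<omega>)\<^sup>2) = (\<Sum>k=1..n. expectation (\<lambda>\<omega>. (X k \<omega>)\<^sup>2) * expectation (\<lambda>\<omega>. (R k \<omega>)\<^sup>2))"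
    using Suc by (auto simp: Z_def)
  have Rint: "integrable M (\<lambda>\<omega>. (R ?j \<omega>)\<^sup>2)" by (rule R[OF j])
  have ZR: "integrable M (\<lambda>\<omega>. Z \<omega> * R ?j \<omega>)"
    by (intro integrable_mult_of_squares IH Rint) measurable
  have AB: "?A \<inter> ?B = {}" "?A \<subseteq> {1..m}" "?B \<subseteq> {1..m}" using Suc.prems by auto
  have comp: "(\<lambda>y. y ?j) \<in> borel_measurable (?P ?A)"
    by (rule measurable_component_singleton) simp
  have XA: "restrict (\<lambda>i. X i \<omega>) ?A ?j = X ?j \<omega>" for \<omega> by simp
  note split = indep_vars_product_split[OF ind AB]
  have cross: "integrable M (\<lambda>\<omega>. X ?j \<omega> * (Z \<omega> * R ?j \<omega>))"
    "expectation (\<lambda>\<omega>. X ?j \<omega> * (Z \<omega> * R ?j \<omega>)) = 0"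
    using split[OF comp borel_measurable_times[OF z rj], unfolded XA Zz[symmetric] Rj[symmetric], OF Xi[OF j] ZR]
      mean[OF j] by simp_all
  have sqr: "integrable M (\<lambda>\<omega>. (X ?j \<omega>)\<^sup>2 * (R ?j \<omega>)\<^sup>2)"
    "expectation (\<lambda>\<omega>. (X ?j \<omega>)\<^sup>2 * (R ?j \<omega>)\<^sup>2)
      = expectation (\<lambda>\<omega>. (X ?j \<omega>)\<^sup>2) * expectation (\<lambda>\<omega>. (R ?j \<omega>)\<^sup>2)"
    using split[OF borel_measurable_power[OF comp, of 2] borel_measurable_power[OF rj, of 2],
        unfolded XA Rj[symmetric], OF sq[OF j] Rint] by simp_all
  have eq: "(\<Sum>k=1..Suc n. X k \<omega> * R k \<omega>)\<^sup>2
      = (Z \<omega>)\<^sup>2 + 2 * (X ?j \<omega> * (Z \<omega> * R ?j \<omega>)) + (X ?j \<omega>)\<^sup>2 * (R ?j \<omega>)\<^sup>2" for \<omega>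
  proof -
    have "(\<Sum>k=1..Suc n. X k \<omega> * R k \<omega>) = Z \<omega> + X ?j \<omega> * R ?j \<omega>" by (simp add: Z_def)
    then show ?thesis by (simp add: power2_eq_square algebra_simps)
  qed
  have i2: "integrable M (\<lambda>\<omega>. 2 * (X ?j \<omega> * (Z \<omega> * R ?j \<omega>)))"
    using cross(1) by (rule integrable_mult_right)
  have int: "integrable M (\<lambda>\<omega>. (\<Sum>k=1..Suc n. X k \<omega> * R k \<omega>)\<^sup>2)"
    unfolding eq by (intro Bochner_Integration.integrable_add IH(1) i2 sqr(1))
  have "expectation (\<lambda>\<omega>. (\<Sum>k=1..Suc n. X k \<omega> * R k \<omega>)\<^sup>2)
      = expectation (\<lambda>\<omega>. (Z \<omega>)\<^sup>2) + expectation (\<lambda>\<omega>. 2 * (X ?j \<omega> * (Z \<omega> * R ?j \<omega>)))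
        + expectation (\<lambda>\<omega>. (X ?j \<omega>)\<^sup>2 * (R ?j \<omega>)\<^sup>2)"
    unfolding eq
    by (simp only: Bochner_Integration.integral_add Bochner_Integration.integrable_add IH(1) i2 sqr(1))
  also have "expectation (\<lambda>\<omega>. 2 * (X ?j \<omega> * (Z \<omega> * R ?j \<omega>))) = 0"
    by (simp only: integral_mult_right_zero cross(2) mult_zero_right)
  finally show ?case
    using int unfolding IH(2) sqr(2) by simp
qed simp

lemma (in prob_space) weighted_sum_second_moment:
  fixes X :: "nat \<Rightarrow> 'a \<Rightarrow> real"
  assumes "indep_vars (\<lambda>_. borel) X {1..m}"
    and "\<And>k. k \<in> {1..m} \<Longrightarrow> integrable M (\<lambda>\<omega>. (X k \<omega>)\<^sup>2)"
    and "\<And>k. k \<in> {1..m} \<Longrightarrow> expectation (X k) = 0" and "n \<le> m"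
  shows "integrable M (\<lambda>\<omega>. (\<Sum>k=1..n. c k * X k \<omega>)\<^sup>2)"
    and "expectation (\<lambda>\<omega>. (\<Sum>k=1..n. c k * X k \<omega>)\<^sup>2)
      = (\<Sum>k=1..n. (c k)\<^sup>2 * expectation (\<lambda>\<omega>. (X k \<omega>)\<^sup>2))"
proof -
  note mt = martingale_transform_second_moment[OF assms(1-3), of "\<lambda>k _. c k" n]
  have eq: "(\<Sum>k=1..n. c k * X k \<omega>) = (\<Sum>k=1..n. X k \<omega> * c k)" for \<omega>
    by (simp only: mult.commute)
  show "integrable M (\<lambda>\<omega>. (\<Sum>k=1..n. c k * X k \<omega>)\<^sup>2)"
    unfolding eq using mt assms(4) by auto
  have "expectation (\<lambda>\<omega>. (\<Sum>k=1..n. X k \<omega> * c k)\<^sup>2)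
      = (\<Sum>k=1..n. expectation (\<lambda>\<omega>. (X k \<omega>)\<^sup>2) * expectation (\<lambda>\<omega>. (c k)\<^sup>2))"
    using mt assms(4) by auto
  then show "expectation (\<lambda>\<omega>. (\<Sum>k=1..n. c k * X k \<omega>)\<^sup>2)
      = (\<Sum>k=1..n. (c k)\<^sup>2 * expectation (\<lambda>\<omega>. (X k \<omega>)\<^sup>2))"
    unfolding eq by (simp add: prob_space mult.commute)
qed

text \<open>An off-diagonal quadratic form is a martingale transform whose factor at \<open>k\<close> is a linear form in the
earlier variables, so only second moments enter.\<close>

lemma (in prob_space) quadratic_form_second_moment:
  fixes X :: "nat \<Rightarrow> 'a \<Rightarrow> real" and w :: "nat \<Rightarrow> nat \<Rightarrow> real" and m :: nat
  defines "Q \<equiv> \<lambda>\<omega>. \<Sum>k=1..m. X k \<omega> * (\<Sum>i\<in>{1..<k}. w i k * X i \<omega>)"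
  assumes ind: "indep_vars (\<lambda>_. borel) X {1..m}"
    and sq: "\<And>k. k \<in> {1..m} \<Longrightarrow> integrable M (\<lambda>\<omega>. (X k \<omega>)\<^sup>2)"
    and mean: "\<And>k. k \<in> {1..m} \<Longrightarrow> expectation (X k) = 0"
  shows "integrable M (\<lambda>\<omega>. (Q \<omega>)\<^sup>2)"
    and "expectation (\<lambda>\<omega>. (Q \<omega>)\<^sup>2) = (\<Sum>k=1..m. expectation (\<lambda>\<omega>. (X k \<omega>)\<^sup>2) *
      (\<Sum>i\<in>{1..<k}. (w i k)\<^sup>2 * expectation (\<lambda>\<omega>. (X i \<omega>)\<^sup>2)))"
proof -
  define r where "r k y = (\<Sum>i\<in>{1..<k}. w i k * y i)" for k :: nat and y :: "nat \<Rightarrow> real"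
  have rX: "r k (restrict (\<lambda>i. X i \<omega>) {1..<k}) = (\<Sum>i\<in>{1..<k}. w i k * X i \<omega>)" for k \<omega>
    by (simp add: r_def)
  have rm: "r k \<in> borel_measurable (Pi\<^sub>M {1..<k} (\<lambda>_. borel))" for k
    unfolding r_def by (intro borel_measurable_sum borel_measurable_times measurable_component_singleton) auto
  have T: "integrable M (\<lambda>\<omega>. (\<Sum>i\<in>{1..<k}. w i k * X i \<omega>)\<^sup>2)"
    "expectation (\<lambda>\<omega>. (\<Sum>i\<in>{1..<k}. w i k * X i \<omega>)\<^sup>2)
      = (\<Sum>i\<in>{1..<k}. (w i k)\<^sup>2 * expectation (\<lambda>\<omega>. (X i \<omega>)\<^sup>2))" if k: "k \<in> {1..m}" for k
  proof -
    obtain n where n: "k = Suc n" using k by (cases k) auto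
    then show "integrable M (\<lambda>\<omega>. (\<Sum>i\<in>{1..<k}. w i k * X i \<omega>)\<^sup>2)"
      "expectation (\<lambda>\<omega>. (\<Sum>i\<in>{1..<k}. w i k * X i \<omega>)\<^sup>2)
      = (\<Sum>i\<in>{1..<k}. (w i k)\<^sup>2 * expectation (\<lambda>\<omega>. (X i \<omega>)\<^sup>2))"
      using weighted_sum_second_moment[OF ind sq mean, of n "\<lambda>i. w i k"] k
      by (simp_all add: atLeastLessThanSuc_atLeastAtMost)
  qed
  note mt = martingale_transform_second_moment[OF ind sq mean rm, unfolded rX, of m, OF _ _ T(1)]
  show "integrable M (\<lambda>\<omega>. (Q \<omega>)\<^sup>2)" using mt by (simp add: Q_def)
  have "expectation (\<lambda>\<omega>. (Q \<omega>)\<^sup>2) = (\<Sum>k=1..m. expectation (\<lambda>\<omega>. (X k \<omega>)\<^sup>2) *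
      expectation (\<lambda>\<omega>. (\<Sum>i\<in>{1..<k}. w i k * X i \<omega>)\<^sup>2))"
    using mt by (simp add: Q_def)
  then show "expectation (\<lambda>\<omega>. (Q \<omega>)\<^sup>2) = (\<Sum>k=1..m. expectation (\<lambda>\<omega>. (X k \<omega>)\<^sup>2) *
      (\<Sum>i\<in>{1..<k}. (w i k)\<^sup>2 * expectation (\<lambda>\<omega>. (X i \<omega>)\<^sup>2)))"
    using T(2) by simp
qed

text \<open>The integral telescopes to the integral over \<open>[1 - h, 1]\<close> minus the one over \<open>[0, h]\<close>.\<close>

lemma integral_increment_mono_le:
  fixes g :: "real \<Rightarrow> real"
  assumes c: "continuous_on UNIV g" and g: "\<And>t. 0 \<le> g t" "\<And>t. g t \<le> 1" and h: "0 \<le> h" "h \<le> 1"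
  shows "integral {0..1 - h} (\<lambda>u. g (u + h) - g u) \<le> h"
proof -
  have int: "g integrable_on {a..b}" for a b
    by (intro integrable_continuous_interval continuous_on_subset[OF c]) simp
  have "integral {0..1 - h} (g \<circ> (\<lambda>u. u + h)) = integral {0 + h..1 - h + h} g"
    by (intro integral_shift continuous_on_subset[OF c]) simp
  then have 1: "integral {0..1 - h} (\<lambda>u. g (u + h)) = integral {h..1} g" by (simp add: o_def)
  have i1: "(\<lambda>u. g (u + h)) integrable_on {0..1 - h}"
    by (intro integrable_continuous_interval continuous_on_shift c)
  have "integral {0..1 - h} (\<lambda>u. g (u + h) - g u) = integral {h..1} g - integral {0..1 - h} g"
    using integral_diff[OF i1 int] 1 by simp
  also have "integral {h..1} g = integral {0..1} g - integral {0..h} g"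
    using Henstock_Kurzweil_Integration.integral_combine[of 0 h 1 g] h int by simp
  also have "integral {0..1 - h} g = integral {0..1} g - integral {1 - h..1} g"
    using Henstock_Kurzweil_Integration.integral_combine[of 0 "1 - h" 1 g] h int by simp
  finally have "integral {0..1 - h} (\<lambda>u. g (u + h) - g u) = integral {1 - h..1} g - integral {0..h} g" by simp
  moreover have "integral {1 - h..1} g \<le> integral {1 - h..1} (\<lambda>_. 1)"
    by (intro integral_le int g) auto
  moreover have "0 \<le> integral {0..h} g" by (intro integral_nonneg int g)
  ultimately show ?thesis using h by simp
qed


section \<open>Oscillation of random weighted sums of ramps\<close>

lemma sum_power2_triangle:
  fixes a :: "nat \<Rightarrow> real"
  shows "(\<Sum>k=1..m. a k)\<^sup>2 = (\<Sum>k=1..m. (a k)\<^sup>2) + 2 * (\<Sum>k=1..m. a k * (\<Sum>i\<in>{1..<k}. a i))"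
proof (induction m)
  case (Suc m)
  have "{1..<Suc m} = {1..m}" by auto
  then show ?case using Suc by (simp add: power2_sum algebra_simps)
qed simp

lemma sq_osc_weighted_sum_eq:
  fixes x :: "nat \<Rightarrow> real" and g :: "nat \<Rightarrow> real \<Rightarrow> real" and h :: real
  assumes c: "\<And>k. continuous_on UNIV (g k)"
  defines "w \<equiv> \<lambda>i k. integral {0..1 - h} (\<lambda>u. (g i (u + h) - g i u) * (g k (u + h) - g k u))"
  shows "sq_osc (\<lambda>t. \<Sum>k=1..m. x k * g k t) h
    = (\<Sum>k=1..m. (x k)\<^sup>2 * w k k) + 2 * (\<Sum>k=1..m. x k * (\<Sum>i\<in>{1..<k}. w i k * x i))"
proof -
  define d where "d k u = g k (u + h) - g k u" for k u
  have wd: "w i k = integral {0..1 - h} (\<lambda>u. d i u * d k u)" for i k by (simp add: w_def d_def)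
  have dc: "continuous_on S (d k)" for S k unfolding d_def by (intro continuous_on_increment c)
  have di: "(\<lambda>u. d i u * d k u) integrable_on {0..1 - h}" for i k
    by (intro integrable_continuous_interval continuous_intros dc)
  have "sq_osc (\<lambda>t. \<Sum>k=1..m. x k * g k t) h = integral {0..1 - h} (\<lambda>u. (\<Sum>k=1..m. x k * d k u)\<^sup>2)"
    by (simp add: sq_osc_def d_def sum_subtractf[symmetric] right_diff_distrib)
  also have "\<dots> = integral {0..1 - h} (\<lambda>u. (\<Sum>k=1..m. (x k)\<^sup>2 * (d k u * d k u))
      + 2 * (\<Sum>k=1..m. x k * (\<Sum>i\<in>{1..<k}. x i * (d i u * d k u))))"
    unfolding sum_power2_triangle by (simp add: power2_eq_square sum_distrib_left mult_ac)
  also have "\<dots> = (\<Sum>k=1..m. (x k)\<^sup>2 * w k k) + 2 * (\<Sum>k=1..m. x k * (\<Sum>i\<in>{1..<k}. x i * w i k))"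
    unfolding wd
    by (intro integral_unique has_integral_add has_integral_mult_right has_integral_sum
        integrable_integral di finite_atLeastAtMost finite_atLeastLessThan)
  finally show ?thesis by (simp add: mult.commute)
qed

text \<open>The oscillation is a quadratic form with weights \<open>w h i k\<close>, the scalar products of the increments of
\<open>g i\<close> and \<open>g k\<close>. Monotonicity of the functions \<open>g k\<close> gives \<open>0 \<le> w h i k \<le> h\<close>, and the hypothesis \<open>lin\<close>,
applied under the integral, gives the double sum of \<open>v i * v k * w h i k\<close> at most \<open>(c * h)\<^sup>2\<close>. Together they bound
the second moment of the off-diagonal part by \<open>c\<^sup>2 * h ^ 3\<close>. Outside \<open>E\<close> the sum of the squares is below
\<open>a / 2\<close> and the off-diagonal part is below \<open>a * h / 4\<close> for every dyadic \<open>h\<close>, hence the oscillation is at most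
\<open>a * h\<close> there.\<close>

lemma (in prob_space) sq_osc_weighted_sum:
  fixes X :: "nat \<Rightarrow> 'a \<Rightarrow> real" and g :: "nat \<Rightarrow> real \<Rightarrow> real"
  assumes ind: "indep_vars (\<lambda>_. borel) X {1..m}"
    and sq: "\<And>k. k \<in> {1..m} \<Longrightarrow> integrable M (\<lambda>\<omega>. (X k \<omega>)\<^sup>2)"
    and mean: "\<And>k. k \<in> {1..m} \<Longrightarrow> expectation (X k) = 0"
    and v: "\<And>k. k \<in> {1..m} \<Longrightarrow> expectation (\<lambda>\<omega>. (X k \<omega>)\<^sup>2) = v k"
    and tot: "(\<Sum>k=1..m. v k) \<le> 1"
    and gc: "\<And>k. continuous_on UNIV (g k)" and gm: "\<And>k. mono (g k)"
    and g01: "\<And>k t. 0 \<le> g k t" "\<And>k t. g k t \<le> 1"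
    and lin: "\<And>u h. 0 \<le> h \<Longrightarrow> (\<Sum>k=1..m. v k * (g k (u + h) - g k u)) \<le> c * h"
    and a: "1 \<le> a"
  shows "\<exists>E\<in>events. prob E \<le> (2 + 32 * c\<^sup>2) / a \<and>
    (\<forall>\<omega>\<in>space M - E. \<forall>h\<in>{0..1}. sq_osc (\<lambda>t. \<Sum>k=1..m. X k \<omega> * g k t) h \<le> 32 * a * h)"
proof -
  define d where "d h k u = g k (u + h) - g k u" for h k u
  define w where "w h i k = integral {0..1 - h} (\<lambda>u. d h i u * d h k u)" for h i k
  define Q where "Q h \<omega> = (\<Sum>k=1..m. X k \<omega> * (\<Sum>i\<in>{1..<k}. w h i k * X i \<omega>))" for h \<omega>
  have rv [measurable]: "random_variable borel (X k)" if "k \<in> {1..m}" for k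
    using ind that by (auto simp: indep_vars_def)
  have v0: "0 \<le> v k" if "k \<in> {1..m}" for k unfolding v[OF that, symmetric] by simp
  have dc: "continuous_on S (d h k)" for S h k unfolding d_def by (intro continuous_on_increment gc)
  have di: "(\<lambda>u. d h i u * d h k u) integrable_on {0..1 - h}" "d h i integrable_on {0..1 - h}" for i k h
    by (intro integrable_continuous_interval continuous_intros dc)+
  have d01: "0 \<le> d h k u" "d h k u \<le> 1" if "0 \<le> h" for h k u
    using monoD[OF gm, of u "u + h" k] g01(1)[of k u] g01(2)[of k "u + h"] that by (auto simp: d_def)
  have w0: "0 \<le> w h i k" if "0 \<le> h" for h i k
    unfolding w_def by (intro integral_nonneg di) (simp add: d01[OF that])
  have wh: "w h i k \<le> h" if "0 \<le> h" "h \<le> 1" for h i k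
  proof -
    have "w h i k \<le> integral {0..1 - h} (d h i)"
      unfolding w_def
    proof (intro integral_le di)
      fix u show "d h i u * d h k u \<le> d h i u"
        using mult_left_le[OF d01(2)[OF that(1)] d01(1)[OF that(1)]] .
    qed
    also have "\<dots> \<le> h"
      using integral_increment_mono_le[OF gc[of i] g01(1)[of i] g01(2)[of i] that] by (simp add: d_def[abs_def])
    finally show ?thesis .
  qed
  \<comment> \<open>one factor \<open>w h i k\<close> is replaced by \<open>h\<close>, the other one is summed\<close>
  have Qsq: "integrable M (\<lambda>\<omega>. (Q h \<omega>)\<^sup>2)" for h
    unfolding Q_def by (rule quadratic_form_second_moment[OF ind sq mean])
  have EQ: "expectation (\<lambda>\<omega>. (Q h \<omega>)\<^sup>2) \<le> c\<^sup>2 * h ^ 3" if h: "0 \<le> h" "h \<le> 1" for h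
  proof -
    have "expectation (\<lambda>\<omega>. (Q h \<omega>)\<^sup>2) = (\<Sum>k=1..m. expectation (\<lambda>\<omega>. (X k \<omega>)\<^sup>2) *
        (\<Sum>i\<in>{1..<k}. (w h i k)\<^sup>2 * expectation (\<lambda>\<omega>. (X i \<omega>)\<^sup>2)))"
      unfolding Q_def by (rule quadratic_form_second_moment(2)[OF ind sq mean])
    also have "\<dots> = (\<Sum>k=1..m. v k * (\<Sum>i\<in>{1..<k}. (w h i k)\<^sup>2 * v i))"
    proof (intro sum.cong refl)
      fix k assume k: "k \<in> {1..m}"
      have "(\<Sum>i\<in>{1..<k}. (w h i k)\<^sup>2 * expectation (\<lambda>\<omega>. (X i \<omega>)\<^sup>2)) = (\<Sum>i\<in>{1..<k}. (w h i k)\<^sup>2 * v i)"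
        using k by (intro sum.cong refl) (simp add: v)
      then show "expectation (\<lambda>\<omega>. (X k \<omega>)\<^sup>2) * (\<Sum>i\<in>{1..<k}. (w h i k)\<^sup>2 * expectation (\<lambda>\<omega>. (X i \<omega>)\<^sup>2))
          = v k * (\<Sum>i\<in>{1..<k}. (w h i k)\<^sup>2 * v i)"
        using v[OF k] by simp
    qed
    also have "\<dots> \<le> (\<Sum>k=1..m. v k * (\<Sum>i=1..m. (h * w h i k) * v i))"
    proof (intro sum_mono mult_left_mono v0)
      fix k assume k: "k \<in> {1..m}"
      have "(\<Sum>i\<in>{1..<k}. (w h i k)\<^sup>2 * v i) \<le> (\<Sum>i\<in>{1..<k}. (h * w h i k) * v i)"
        using k by (intro sum_mono mult_right_mono v0) (auto simp: power2_eq_square intro!: mult_right_mono wh w0 h)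
      also have "\<dots> \<le> (\<Sum>i=1..m. (h * w h i k) * v i)"
        using k h by (intro sum_mono2 mult_nonneg_nonneg w0 v0) auto
      finally show "(\<Sum>i\<in>{1..<k}. (w h i k)\<^sup>2 * v i) \<le> (\<Sum>i=1..m. (h * w h i k) * v i)" .
    qed
    also have "\<dots> = h * (\<Sum>k=1..m. \<Sum>i=1..m. (v k * v i) * w h i k)"
      by (simp add: sum_distrib_left mult_ac)
    also have "\<dots> \<le> h * (c * h)\<^sup>2"
    proof (intro mult_left_mono h)
    have "(\<Sum>k=1..m. \<Sum>i=1..m. (v k * v i) * w h i k)
        = integral {0..1 - h} (\<lambda>u. \<Sum>k=1..m. \<Sum>i=1..m. (v k * v i) * (d h i u * d h k u))"
      unfolding w_def
      by (intro integral_unique[symmetric] has_integral_mult_right has_integral_sum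
        integrable_integral di finite_atLeastAtMost)
    also have "\<dots> \<le> integral {0..1 - h} (\<lambda>u. (c * h)\<^sup>2)"
    proof (intro integral_le integrable_sum integrable_on_mult_right di finite_atLeastAtMost)
      fix u
      have "(\<Sum>k=1..m. \<Sum>i=1..m. (v k * v i) * (d h i u * d h k u)) = (\<Sum>k=1..m. v k * d h k u)\<^sup>2"
        by (simp add: power2_eq_square sum_product mult_ac)
      also have "\<dots> \<le> (c * h)\<^sup>2"
        using lin[OF h(1), of u] h by (intro power_mono sum_nonneg mult_nonneg_nonneg v0 d01) (auto simp: d_def)
      finally show "(\<Sum>k=1..m. \<Sum>i=1..m. (v k * v i) * (d h i u * d h k u)) \<le> (c * h)\<^sup>2" .
    qed auto
    also have "\<dots> = (1 - h) * (c * h)\<^sup>2" using h by simp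
    also have "\<dots> \<le> 1 * (c * h)\<^sup>2" using h by (intro mult_right_mono) auto
    finally show "(\<Sum>k=1..m. \<Sum>i=1..m. (v k * v i) * w h i k) \<le> (c * h)\<^sup>2" by simp
    qed
    also have "\<dots> = c\<^sup>2 * h ^ 3" by (simp add: power_mult_distrib power3_eq_cube power2_eq_square)
    finally show ?thesis .
  qed
  define H where "H j = (1 / 2 ^ j :: real)" for j :: nat
  have H: "0 < H j" "H j \<le> 1" for j by (auto simp: H_def)
  define E0 where "E0 = {\<omega>\<in>space M. a / 2 \<le> (\<Sum>k=1..m. (X k \<omega>)\<^sup>2)}"
  define E1 where "E1 j = {\<omega>\<in>space M. a * H j / 4 \<le> \<bar>Q (H j) \<omega>\<bar>}" for j
  have Qm [measurable]: "Q h \<in> borel_measurable M" for h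
    unfolding Q_def by (intro borel_measurable_sum borel_measurable_times rv borel_measurable_const) auto
  have Sm [measurable]: "(\<lambda>\<omega>. \<Sum>k=1..m. (X k \<omega>)\<^sup>2) \<in> borel_measurable M"
    by (intro borel_measurable_sum borel_measurable_power rv) auto
  have ev: "E0 \<in> events" "E1 j \<in> events" for j unfolding E0_def E1_def by measurable
  have P0: "prob E0 \<le> 2 / a"
  proof -
    have Si: "integrable M (\<lambda>\<omega>. \<Sum>k=1..m. (X k \<omega>)\<^sup>2)" using sq by auto
    have "prob E0 \<le> expectation (\<lambda>\<omega>. \<Sum>k=1..m. (X k \<omega>)\<^sup>2) / (a / 2)"
      unfolding E0_def using a by (intro integral_Markov_inequality_measure[where A = "space M"] Si) (auto intro!: sum_nonneg)
    also have "expectation (\<lambda>\<omega>. \<Sum>k=1..m. (X k \<omega>)\<^sup>2) = (\<Sum>k=1..m. v k)"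
      using sq v by (subst Bochner_Integration.integral_sum) auto
    also have "\<dots> / (a / 2) \<le> 1 / (a / 2)" using tot a by (intro divide_right_mono) auto
    finally show ?thesis by simp
  qed
  have P1: "prob (E1 j) \<le> 16 * c\<^sup>2 / a\<^sup>2 * (1 / 2) ^ j" for j
  proof -
    have aH: "0 < a * H j / 4" using a H by simp
    have "prob (E1 j) \<le> expectation (\<lambda>\<omega>. (Q (H j) \<omega>)\<^sup>2) / (a * H j / 4)\<^sup>2"
      unfolding E1_def by (intro second_moment_method Qm Qsq aH)
    also have "\<dots> \<le> c\<^sup>2 * H j ^ 3 / (a * H j / 4)\<^sup>2"
      using H[of j] by (intro divide_right_mono EQ) auto
    also have "\<dots> = 16 * c\<^sup>2 / a\<^sup>2 * H j"
      using H(1)[of j] a by (simp add: power_divide power_mult_distrib field_simps power3_eq_cube power2_eq_square)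
    finally show ?thesis by (simp add: H_def power_one_over)
  qed
  have sm: "summable (\<lambda>j. 16 * c\<^sup>2 / a\<^sup>2 * (1 / 2) ^ j)" by (intro summable_mult summable_geometric) simp
  have sP: "summable (\<lambda>j. prob (E1 j))"
  proof (rule summable_comparison_test[OF _ sm], intro exI[of _ 0] allI impI)
    fix j show "norm (prob (E1 j)) \<le> 16 * c\<^sup>2 / a\<^sup>2 * (1 / 2) ^ j" using P1[of j] by simp
  qed
  have "prob (\<Union>j. E1 j) \<le> (\<Sum>j. prob (E1 j))"
    using ev sP by (intro finite_measure_subadditive_countably) auto
  also have "\<dots> \<le> (\<Sum>j. 16 * c\<^sup>2 / a\<^sup>2 * (1 / 2) ^ j)"
    by (intro suminf_le P1 sP sm)
  also have "\<dots> = 16 * c\<^sup>2 / a\<^sup>2 * 2"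
    by (subst suminf_mult) (auto simp: suminf_geometric)
  also have "\<dots> \<le> 32 * c\<^sup>2 / a"
  proof -
    have "a \<le> a\<^sup>2" using a by (simp add: power2_eq_square)
    then have "32 * c\<^sup>2 / a\<^sup>2 \<le> 32 * c\<^sup>2 / a" using a by (intro divide_left_mono) auto
    then show ?thesis by simp
  qed
  finally have PU: "prob (\<Union>j. E1 j) \<le> 32 * c\<^sup>2 / a" .
  define E where "E = E0 \<union> (\<Union>j. E1 j)"
  have E: "E \<in> events" unfolding E_def using ev by auto
  have "prob E \<le> prob E0 + prob (\<Union>j. E1 j)"
    unfolding E_def using ev by (intro measure_Un_le) auto
  also have "\<dots> \<le> (2 + 32 * c\<^sup>2) / a" using P0 PU by (simp add: add_divide_distrib)
  finally have PE: "prob E \<le> (2 + 32 * c\<^sup>2) / a" .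
  have "sq_osc (\<lambda>t. \<Sum>k=1..m. X k \<omega> * g k t) h \<le> 32 * a * h"
    if \<omega>: "\<omega> \<in> space M - E" and h: "h \<in> {0..1}" for \<omega> h
  proof (rule sq_osc_le_of_dyadic)
    show "continuous_on UNIV (\<lambda>t. \<Sum>k=1..m. X k \<omega> * g k t)" by (intro continuous_intros gc)
    fix j
    have "sq_osc (\<lambda>t. \<Sum>k=1..m. X k \<omega> * g k t) (H j) = (\<Sum>k=1..m. (X k \<omega>)\<^sup>2 * w (H j) k k) + 2 * Q (H j) \<omega>"
      unfolding sq_osc_weighted_sum_eq[OF gc] Q_def w_def d_def by simp
    also have "(\<Sum>k=1..m. (X k \<omega>)\<^sup>2 * w (H j) k k) \<le> (\<Sum>k=1..m. (X k \<omega>)\<^sup>2 * H j)"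
      using H[of j] by (intro sum_mono mult_left_mono wh) auto
    also have "\<dots> = (\<Sum>k=1..m. (X k \<omega>)\<^sup>2) * H j" by (simp add: sum_distrib_right)
    also have "\<dots> \<le> (a / 2) * H j"
      using \<omega> H[of j] by (intro mult_right_mono) (auto simp: E_def E0_def)
    also have "2 * Q (H j) \<omega> \<le> 2 * (a * H j / 4)"
    proof -
      have "\<bar>Q (H j) \<omega>\<bar> < a * H j / 4" using \<omega> by (auto simp: E_def E1_def not_le)
      then show ?thesis by linarith
    qed
    finally show "sq_osc (\<lambda>t. \<Sum>k=1..m. X k \<omega> * g k t) (1 / 2 ^ j) \<le> a / 2 ^ j"
      by (simp add: H_def)
  qed (use a h in auto)
  then show ?thesis using E PE by (intro bexI[of _ E]) auto
qed


section \<open>Lindeberg's central limit theorem for block sums\<close>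

lemma eventually_at_right_0_imp_ex:
  fixes P :: "real \<Rightarrow> bool"
  assumes "eventually P (at_right 0)"
  shows "\<exists>x>0. P x"
proof -
  obtain c where "0 < c" "\<And>x. 0 < x \<Longrightarrow> x < c \<Longrightarrow> P x"
    using assms by (auto simp: eventually_at_right_field)
  then show ?thesis by (intro exI[of _ "c / 2"]) auto
qed

lemma exp_minus_approx:
  fixes x :: real
  assumes "0 \<le> x"
  shows "\<bar>exp (- x) - (1 - x)\<bar> \<le> x\<^sup>2"
proof -
  have 1: "1 - x \<le> exp (- x)" using exp_ge_add_one_self[of "- x"] by simp
  have "(1 + x) * exp (- x) \<le> exp x * exp (- x)"
    by (intro mult_right_mono exp_ge_add_one_self) auto
  also have "\<dots> = 1" by (simp add: exp_add[symmetric])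
  also have "1 \<le> (1 + x) * (1 - x + x\<^sup>2)"
  proof -
    have "(1 + x) * (1 - x + x\<^sup>2) = 1 + x ^ 3" by (simp add: power2_eq_square power3_eq_cube algebra_simps)
    then show ?thesis using assms by simp
  qed
  finally have "exp (- x) \<le> 1 - x + x\<^sup>2" using assms by (simp add: mult_le_cancel_left_pos)
  with 1 show ?thesis by simp
qed

text \<open>Taylor expansion of the characteristic function, with the remainder bounded by the square where
\<open>\<bar>X\<bar> \<ge> \<epsilon>\<close> and by the cube elsewhere, against the expansion of the Gaussian one.\<close>

lemma (in prob_space) char_near_gaussian:
  fixes X :: "'a \<Rightarrow> real" and \<epsilon> t :: real
  assumes rv [measurable]: "random_variable borel X" and sq: "integrable M (\<lambda>\<omega>. (X \<omega>)\<^sup>2)"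
    and mean: "expectation X = 0" and \<epsilon>: "0 < \<epsilon>"
  defines "v \<equiv> expectation (\<lambda>\<omega>. (X \<omega>)\<^sup>2)"
    and "l \<equiv> expectation (\<lambda>\<omega>. (X \<omega>)\<^sup>2 * indicator {\<omega>. \<epsilon> \<le> \<bar>X \<omega>\<bar>} \<omega>)"
  shows "v \<le> \<epsilon>\<^sup>2 + l"
    and "cmod (char (distr M borel X) t - complex_of_real (exp (- (t\<^sup>2 * v / 2))))
      \<le> t\<^sup>2 * l + \<bar>t\<bar> ^ 3 * \<epsilon> / 6 * v + t ^ 4 / 4 * v\<^sup>2"
proof -
  have li: "integrable M (\<lambda>\<omega>. (X \<omega>)\<^sup>2 * indicator {\<omega>. \<epsilon> \<le> \<bar>X \<omega>\<bar>} \<omega>)"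
    by (rule Bochner_Integration.integrable_bound[OF sq]) (auto simp: indicator_def)
  have Xi: "integrable M X" by (rule square_integrable_imp_integrable[OF rv sq])
  have "v \<le> expectation (\<lambda>\<omega>. \<epsilon>\<^sup>2 + (X \<omega>)\<^sup>2 * indicator {\<omega>. \<epsilon> \<le> \<bar>X \<omega>\<bar>} \<omega>)"
    unfolding v_def
  proof (intro integral_mono sq Bochner_Integration.integrable_add li integrable_const)
    fix \<omega>
    have "(X \<omega>)\<^sup>2 \<le> \<epsilon>\<^sup>2" if "\<not> \<epsilon> \<le> \<bar>X \<omega>\<bar>"
      using power_mono[of "\<bar>X \<omega>\<bar>" \<epsilon> 2] that by simp
    then show "(X \<omega>)\<^sup>2 \<le> \<epsilon>\<^sup>2 + (X \<omega>)\<^sup>2 * indicator {\<omega>. \<epsilon> \<le> \<bar>X \<omega>\<bar>} \<omega>"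
      by (auto simp: indicator_def)
  qed
  also have "\<dots> = \<epsilon>\<^sup>2 + l" unfolding l_def using li by (simp add: prob_space)
  finally show "v \<le> \<epsilon>\<^sup>2 + l" .
  have v0: "0 \<le> v" by (simp add: v_def)
  have mi: "integrable M (\<lambda>\<omega>. min (6 * (X \<omega>)\<^sup>2) (\<bar>t\<bar> * \<bar>X \<omega>\<bar> ^ 3))"
    by (rule Bochner_Integration.integrable_bound[of _ "\<lambda>\<omega>. 6 * (X \<omega>)\<^sup>2"]) (use sq in auto)
  have "expectation (\<lambda>\<omega>. min (6 * (X \<omega>)\<^sup>2) (\<bar>t\<bar> * \<bar>X \<omega>\<bar> ^ 3))
      \<le> expectation (\<lambda>\<omega>. 6 * ((X \<omega>)\<^sup>2 * indicator {\<omega>. \<epsilon> \<le> \<bar>X \<omega>\<bar>} \<omega>) + \<bar>t\<bar> * \<epsilon> * (X \<omega>)\<^sup>2)"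
  proof (intro integral_mono mi Bochner_Integration.integrable_add integrable_mult_right li sq)
    fix \<omega>
    show "min (6 * (X \<omega>)\<^sup>2) (\<bar>t\<bar> * \<bar>X \<omega>\<bar> ^ 3)
        \<le> 6 * ((X \<omega>)\<^sup>2 * indicator {\<omega>. \<epsilon> \<le> \<bar>X \<omega>\<bar>} \<omega>) + \<bar>t\<bar> * \<epsilon> * (X \<omega>)\<^sup>2"
    proof (cases "\<epsilon> \<le> \<bar>X \<omega>\<bar>")
      case True
      then show ?thesis using \<epsilon> by (simp add: min.coboundedI1)
    next
      case False
      have "\<bar>t\<bar> * \<bar>X \<omega>\<bar> ^ 3 = \<bar>t\<bar> * (\<bar>X \<omega>\<bar> * (X \<omega>)\<^sup>2)"
        by (simp add: power3_eq_cube power2_eq_square abs_mult[symmetric])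
      also have "\<dots> \<le> \<bar>t\<bar> * (\<epsilon> * (X \<omega>)\<^sup>2)"
        using False by (intro mult_left_mono mult_right_mono) auto
      finally show ?thesis using False by (simp add: min.coboundedI2 mult.assoc)
    qed
  qed
  also have "\<dots> = 6 * l + \<bar>t\<bar> * \<epsilon> * v" unfolding l_def v_def using li sq by simp
  finally have m: "expectation (\<lambda>\<omega>. min (6 * (X \<omega>)\<^sup>2) (\<bar>t\<bar> * \<bar>X \<omega>\<bar> ^ 3)) \<le> 6 * l + \<bar>t\<bar> * \<epsilon> * v" .
  have "cmod (char (distr M borel X) t - (1 - t\<^sup>2 * v / 2))
      \<le> t\<^sup>2 / 6 * expectation (\<lambda>\<omega>. min (6 * (X \<omega>)\<^sup>2) (\<bar>t\<bar> * \<bar>X \<omega>\<bar> ^ 3))"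
    by (rule char_approx3'[OF rv Xi sq mean]) (simp_all add: v_def mean)
  also have "\<dots> \<le> t\<^sup>2 / 6 * (6 * l + \<bar>t\<bar> * \<epsilon> * v)" by (intro mult_left_mono m) auto
  also have "\<dots> = t\<^sup>2 * l + \<bar>t\<bar> ^ 3 * \<epsilon> / 6 * v"
    by (simp add: algebra_simps power3_eq_cube power2_eq_square)
  finally have a: "cmod (char (distr M borel X) t - (1 - t\<^sup>2 * v / 2)) \<le> t\<^sup>2 * l + \<bar>t\<bar> ^ 3 * \<epsilon> / 6 * v" .
  have "cmod (complex_of_real (exp (- (t\<^sup>2 * v / 2))) - (1 - t\<^sup>2 * v / 2))
      = \<bar>exp (- (t\<^sup>2 * v / 2)) - (1 - t\<^sup>2 * v / 2)\<bar>"
    by (metis norm_of_real of_real_1 of_real_diff)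
  also have "\<dots> \<le> (t\<^sup>2 * v / 2)\<^sup>2" using v0 by (intro exp_minus_approx) simp
  also have "\<dots> = t ^ 4 / 4 * v\<^sup>2"
    by (simp add: power_divide power_mult_distrib power_mult[symmetric])
  finally have b: "cmod (complex_of_real (exp (- (t\<^sup>2 * v / 2))) - (1 - t\<^sup>2 * v / 2)) \<le> t ^ 4 / 4 * v\<^sup>2" .
  show "cmod (char (distr M borel X) t - complex_of_real (exp (- (t\<^sup>2 * v / 2))))
      \<le> t\<^sup>2 * l + \<bar>t\<bar> ^ 3 * \<epsilon> / 6 * v + t ^ 4 / 4 * v\<^sup>2"
    using norm_triangle_ineq4[of "char (distr M borel X) t - (1 - t\<^sup>2 * v / 2)"
        "complex_of_real (exp (- (t\<^sup>2 * v / 2))) - (1 - t\<^sup>2 * v / 2)"] a b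
    by simp
qed

locale lindeberg_array =
  fixes M :: "nat \<Rightarrow> 'a measure" and m :: "nat \<Rightarrow> nat" and X :: "nat \<Rightarrow> nat \<Rightarrow> 'a \<Rightarrow> real"
    and v :: "nat \<Rightarrow> nat \<Rightarrow> real"
  assumes prob_space_M: "prob_space (M n)"
    and indep: "prob_space.indep_vars (M n) (\<lambda>_. borel) (X n) {1..m n}"
    and sq_integrable: "k \<in> {1..m n} \<Longrightarrow> integrable (M n) (\<lambda>\<omega>. (X n k \<omega>)\<^sup>2)"
    and mean_0: "k \<in> {1..m n} \<Longrightarrow> prob_space.expectation (M n) (X n k) = 0"
    and second_moment: "k \<in> {1..m n} \<Longrightarrow> prob_space.expectation (M n) (\<lambda>\<omega>. (X n k \<omega>)\<^sup>2) = v n k"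
    and v_pos: "k \<in> {1..m n} \<Longrightarrow> 0 < v n k"
    and v_total: "(\<Sum>k=1..m n. v n k) = 1"
    and lindeberg: "0 < \<epsilon> \<Longrightarrow>
      (\<lambda>n. \<Sum>k=1..m n. prob_space.expectation (M n)
         (\<lambda>\<omega>. (X n k \<omega>)\<^sup>2 * indicator {\<omega>. \<epsilon> \<le> \<bar>X n k \<omega>\<bar>} \<omega>)) \<longlonglongrightarrow> 0"
begin

definition tail :: "real \<Rightarrow> nat \<Rightarrow> real" where
  "tail \<epsilon> n = (\<Sum>k=1..m n. prob_space.expectation (M n)
     (\<lambda>\<omega>. (X n k \<omega>)\<^sup>2 * indicator {\<omega>. \<epsilon> \<le> \<bar>X n k \<omega>\<bar>} \<omega>))"

lemma tail_tendsto_0: "0 < \<epsilon> \<Longrightarrow> tail \<epsilon> \<longlonglongrightarrow> 0"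
  unfolding tail_def[abs_def] by (rule lindeberg)

lemma X_measurable [measurable]: "k \<in> {1..m n} \<Longrightarrow> X n k \<in> borel_measurable (M n)"
  using indep[of n] unfolding prob_space.indep_vars_def[OF prob_space_M] by blast

lemma truncated_moment_le_tail: "k \<in> {1..m n} \<Longrightarrow>
    prob_space.expectation (M n) (\<lambda>\<omega>. (X n k \<omega>)\<^sup>2 * indicator {\<omega>. \<epsilon> \<le> \<bar>X n k \<omega>\<bar>} \<omega>) \<le> tail \<epsilon> n"
  unfolding tail_def by (rule member_le_sum) auto

lemma v_le: "k \<in> {1..m n} \<Longrightarrow> 0 < \<epsilon> \<Longrightarrow> v n k \<le> \<epsilon>\<^sup>2 + tail \<epsilon> n"
proof -
  assume k: "k \<in> {1..m n}" and \<epsilon>: "0 < \<epsilon>"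
  have "v n k \<le> \<epsilon>\<^sup>2 + prob_space.expectation (M n) (\<lambda>\<omega>. (X n k \<omega>)\<^sup>2 * indicator {\<omega>. \<epsilon> \<le> \<bar>X n k \<omega>\<bar>} \<omega>)"
    unfolding second_moment[OF k, symmetric]
    by (rule prob_space.char_near_gaussian(1)[OF prob_space_M X_measurable[OF k] sq_integrable[OF k] mean_0[OF k] \<epsilon>])
  then show ?thesis using truncated_moment_le_tail[OF k, of \<epsilon>] by linarith
qed

text \<open>A difference of products of numbers of modulus at most one is at most the sum of the differences of the
factors. The quadratic terms \<open>(v n k)\<^sup>2\<close> are handled by the bound \<open>\<epsilon>\<^sup>2 + tail \<epsilon> n\<close> on a single variance, which
leaves the sum of the variances as the other factor.\<close>

lemma char_block_sum:
  assumes B: "B \<subseteq> {1..m n}" and \<epsilon>: "0 < \<epsilon>"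
  shows "cmod (char (distr (M n) borel (\<lambda>\<omega>. \<Sum>k\<in>B. X n k \<omega>)) t
      - complex_of_real (exp (- (t\<^sup>2 * (\<Sum>k\<in>B. v n k) / 2))))
    \<le> (t\<^sup>2 + t ^ 4 / 4) * tail \<epsilon> n + (\<bar>t\<bar> ^ 3 * \<epsilon> / 6 + t ^ 4 / 4 * \<epsilon>\<^sup>2)"
proof -
  interpret prob_space "M n" by (rule prob_space_M)
  define l where "l k = expectation (\<lambda>\<omega>. (X n k \<omega>)\<^sup>2 * indicator {\<omega>. \<epsilon> \<le> \<bar>X n k \<omega>\<bar>} \<omega>)" for k
  have fin: "finite B" using B finite_subset by blast
  have l0: "0 \<le> l k" for k unfolding l_def by simp
  have lB: "(\<Sum>k\<in>B. l k) \<le> tail \<epsilon> n"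
    unfolding tail_def l_def[symmetric] by (intro sum_mono2 B l0) auto
  have vB: "(\<Sum>k\<in>B. v n k) \<le> 1"
    unfolding v_total[of n, symmetric] using v_pos B by (intro sum_mono2) (auto intro: less_imp_le)
  have t0: "0 \<le> tail \<epsilon> n" unfolding tail_def l_def[symmetric] by (intro sum_nonneg l0)
  have "char (distr (M n) borel (\<lambda>\<omega>. \<Sum>k\<in>B. X n k \<omega>)) t = (\<Prod>k\<in>B. char (distr (M n) borel (X n k)) t)"
    by (rule char_distr_sum) (rule indep_vars_subset[OF indep B])
  moreover have "complex_of_real (exp (- (t\<^sup>2 * (\<Sum>k\<in>B. v n k) / 2)))
      = (\<Prod>k\<in>B. complex_of_real (exp (- (t\<^sup>2 * v n k / 2))))"
    using fin by (simp add: exp_sum[symmetric] of_real_prod[symmetric] sum_negf sum_distrib_left sum_divide_distrib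
        del: of_real_prod)
  ultimately have "cmod (char (distr (M n) borel (\<lambda>\<omega>. \<Sum>k\<in>B. X n k \<omega>)) t
      - complex_of_real (exp (- (t\<^sup>2 * (\<Sum>k\<in>B. v n k) / 2))))
    = cmod ((\<Prod>k\<in>B. char (distr (M n) borel (X n k)) t) - (\<Prod>k\<in>B. complex_of_real (exp (- (t\<^sup>2 * v n k / 2)))))"
    by simp
  also have "\<dots> \<le> (\<Sum>k\<in>B. cmod (char (distr (M n) borel (X n k)) t - complex_of_real (exp (- (t\<^sup>2 * v n k / 2)))))"
  proof (rule norm_prod_diff)
    fix k assume k: "k \<in> B"
    show "cmod (char (distr (M n) borel (X n k)) t) \<le> 1"
      using k B by (intro real_distribution.cmod_char_le_1 real_distribution_distr X_measurable) auto
    show "cmod (complex_of_real (exp (- (t\<^sup>2 * v n k / 2)))) \<le> 1"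
      using k B v_pos[of k n] by (auto simp: norm_of_real)
  qed
  also have "\<dots> \<le> (\<Sum>k\<in>B. t\<^sup>2 * l k + \<bar>t\<bar> ^ 3 * \<epsilon> / 6 * v n k + t ^ 4 / 4 * ((\<epsilon>\<^sup>2 + tail \<epsilon> n) * v n k))"
  proof (rule sum_mono)
    fix k assume k: "k \<in> B"
    then have k': "k \<in> {1..m n}" using B by auto
    have "cmod (char (distr (M n) borel (X n k)) t - complex_of_real (exp (- (t\<^sup>2 * v n k / 2))))
      \<le> t\<^sup>2 * l k + \<bar>t\<bar> ^ 3 * \<epsilon> / 6 * v n k + t ^ 4 / 4 * (v n k)\<^sup>2"
      using char_near_gaussian(2)[OF X_measurable[OF k'] sq_integrable[OF k'] mean_0[OF k'] \<epsilon>, of t]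
      by (simp add: l_def second_moment[OF k'])
    also have "t ^ 4 / 4 * (v n k)\<^sup>2 \<le> t ^ 4 / 4 * ((\<epsilon>\<^sup>2 + tail \<epsilon> n) * v n k)"
      using v_le[OF k' \<epsilon>] v_pos[OF k'] unfolding power2_eq_square[of "v n k"]
      by (intro mult_left_mono mult_right_mono) auto
    finally show "cmod (char (distr (M n) borel (X n k)) t - complex_of_real (exp (- (t\<^sup>2 * v n k / 2))))
      \<le> t\<^sup>2 * l k + \<bar>t\<bar> ^ 3 * \<epsilon> / 6 * v n k + t ^ 4 / 4 * ((\<epsilon>\<^sup>2 + tail \<epsilon> n) * v n k)" by simp
  qed
  also have "\<dots> = t\<^sup>2 * (\<Sum>k\<in>B. l k) + \<bar>t\<bar> ^ 3 * \<epsilon> / 6 * (\<Sum>k\<in>B. v n k)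
      + t ^ 4 / 4 * ((\<epsilon>\<^sup>2 + tail \<epsilon> n) * (\<Sum>k\<in>B. v n k))"
    by (simp only: sum.distrib sum_distrib_left)
  also have "\<dots> \<le> t\<^sup>2 * tail \<epsilon> n + \<bar>t\<bar> ^ 3 * \<epsilon> / 6 * 1 + t ^ 4 / 4 * ((\<epsilon>\<^sup>2 + tail \<epsilon> n) * 1)"
    using lB vB \<epsilon> t0 by (intro add_mono mult_left_mono) auto
  also have "\<dots> = (t\<^sup>2 + t ^ 4 / 4) * tail \<epsilon> n + (\<bar>t\<bar> ^ 3 * \<epsilon> / 6 + t ^ 4 / 4 * \<epsilon>\<^sup>2)"
    by (simp add: algebra_simps)
  finally show ?thesis .
qed

lemma char_block_sum_tendsto:
  assumes B: "\<And>n. B n \<subseteq> {1..m n}" and s: "(\<lambda>n. \<Sum>k\<in>B n. v n k) \<longlonglongrightarrow> s"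
  shows "(\<lambda>n. char (distr (M n) borel (\<lambda>\<omega>. \<Sum>k\<in>B n. X n k \<omega>)) t)
    \<longlonglongrightarrow> complex_of_real (exp (- (t\<^sup>2 * s / 2)))"
proof -
  let ?c = "\<lambda>n. char (distr (M n) borel (\<lambda>\<omega>. \<Sum>k\<in>B n. X n k \<omega>)) t"
  let ?e = "\<lambda>n. complex_of_real (exp (- (t\<^sup>2 * (\<Sum>k\<in>B n. v n k) / 2)))"
  have "(\<lambda>n. ?c n - ?e n) \<longlonglongrightarrow> 0"
  proof (rule tendstoI)
    fix e :: real assume e: "0 < e"
    have "((\<lambda>\<epsilon>. \<bar>t\<bar> ^ 3 * \<epsilon> / 6 + t ^ 4 / 4 * \<epsilon>\<^sup>2) \<longlongrightarrow> \<bar>t\<bar> ^ 3 * 0 / 6 + t ^ 4 / 4 * 0\<^sup>2) (at_right 0)"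
      by (intro tendsto_intros) simp_all
    then have "\<forall>\<^sub>F \<epsilon> in at_right 0. \<bar>t\<bar> ^ 3 * \<epsilon> / 6 + t ^ 4 / 4 * \<epsilon>\<^sup>2 < e / 2"
      by (rule order_tendstoD) (use e in simp)
    then obtain \<epsilon> where \<epsilon>: "0 < \<epsilon>" "\<bar>t\<bar> ^ 3 * \<epsilon> / 6 + t ^ 4 / 4 * \<epsilon>\<^sup>2 < e / 2"
      using eventually_at_right_0_imp_ex by blast
    have "(\<lambda>n. (t\<^sup>2 + t ^ 4 / 4) * tail \<epsilon> n) \<longlonglongrightarrow> (t\<^sup>2 + t ^ 4 / 4) * 0"
      by (intro tendsto_intros tail_tendsto_0 \<epsilon>)
    then have "\<forall>\<^sub>F n in sequentially. (t\<^sup>2 + t ^ 4 / 4) * tail \<epsilon> n < e / 2"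
      by (rule order_tendstoD) (use e in simp)
    then show "\<forall>\<^sub>F n in sequentially. dist (?c n - ?e n) 0 < e"
    proof eventually_elim
      case (elim n)
      have "cmod (?c n - ?e n) < e" using char_block_sum[OF B \<epsilon>(1), of n t] \<epsilon>(2) elim by linarith
      then show ?case by (simp add: dist_norm)
    qed
  qed
  moreover have "?e \<longlonglongrightarrow> complex_of_real (exp (- (t\<^sup>2 * s / 2)))"
    by (intro tendsto_intros s) auto
  ultimately show ?thesis by (rule Lim_transform[rotated])
qed

end

definition normal_law :: "real \<Rightarrow> real measure" where
  "normal_law s = density lborel (normal_density 0 (sqrt s))"

lemma real_distribution_normal_law: "0 < s \<Longrightarrow> real_distribution (normal_law s)"
  unfolding normal_law_def real_distribution_def real_distribution_axioms_def
  by (auto intro!: prob_space_normal_density)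

lemma char_normal_law:
  assumes s: "0 < s"
  shows "char (normal_law s) t = complex_of_real (exp (- (t\<^sup>2 * s / 2)))"
proof -
  interpret N: real_distribution "normal_law s" by (rule real_distribution_normal_law[OF s])
  have "distributed (normal_law s) lborel (\<lambda>x. x) (normal_density 0 (sqrt s))"
    unfolding distributed_def using distr_id2[of lborel "normal_law s"] by (simp add: normal_law_def)
  then have "distributed (normal_law s) lborel (\<lambda>x. (x - 0) / sqrt s) std_normal_density"
    using N.normal_standard_normal_convert[of "sqrt s" "\<lambda>x. x" 0] s by simp
  then have eq: "distr (normal_law s) lborel (\<lambda>x. x / sqrt s) = std_normal_distribution"
    by (simp add: distributed_def)
  have "complex_of_real (exp (- ((sqrt s * t)\<^sup>2) / 2)) = char std_normal_distribution (sqrt s * t)"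
    by (simp add: char_std_normal_distribution)
  also have "\<dots> = char (normal_law s) t"
    unfolding eq[symmetric] char_def using s by (subst integral_distr) auto
  finally show ?thesis using s by (simp add: power_mult_distrib mult.commute)
qed


section \<open>Polygonal lines and their coarse approximations\<close>

text \<open>Written with minima, the function is continuous and monotone on the whole line, so shifted arguments
outside the unit interval are harmless.\<close>

definition ramp :: "real \<Rightarrow> real \<Rightarrow> real \<Rightarrow> real" where
  "ramp a b t = (min t b - min t a) / (b - a)"

lemma continuous_on_ramp: "continuous_on S (ramp a b)"
  unfolding ramp_def[abs_def] divide_inverse by (intro continuous_intros)

lemma ramp_increment_nonneg: "a \<le> b \<Longrightarrow> 0 \<le> h \<Longrightarrow> ramp a b t \<le> ramp a b (t + h)"
  unfolding ramp_def by (intro divide_right_mono) (auto simp: min_def)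

lemma mono_ramp: "a \<le> b \<Longrightarrow> mono (ramp a b)"
  using ramp_increment_nonneg[of a b "y - x" x for x y] by (intro monoI) (metis add_diff_cancel_left' diff_add_cancel add.commute diff_ge_0_iff_ge)

lemma ramp_nonneg: "a \<le> b \<Longrightarrow> 0 \<le> ramp a b t"
  unfolding ramp_def by (intro divide_nonneg_nonneg) (auto simp: min_def)

lemma ramp_le_1: "a \<le> b \<Longrightarrow> ramp a b t \<le> 1"
  unfolding ramp_def by (cases "a = b") (auto simp: min_def field_simps)

lemma ramp_eq_0: "t \<le> a \<Longrightarrow> a < b \<Longrightarrow> ramp a b t = 0"
  by (simp add: ramp_def)

lemma ramp_eq_1: "b \<le> t \<Longrightarrow> a < b \<Longrightarrow> ramp a b t = 1"
  by (simp add: ramp_def)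

lemma ramp_between: "a \<le> t \<Longrightarrow> t \<le> b \<Longrightarrow> ramp a b t = (t - a) / (b - a)"
  by (simp add: ramp_def min_def)

lemma ramp_scaled: "a \<le> b \<Longrightarrow> (b - a) * ramp a b t = min t b - min t a"
  by (cases "a = b") (auto simp: ramp_def)

lemma ramp_increment_le:
  assumes "a < b" "0 \<le> h"
  shows "\<bar>ramp a b (u + h) - ramp a b u\<bar> \<le> h / (b - a)"
proof -
  have "\<bar>(min (u + h) b - min (u + h) a) - (min u b - min u a)\<bar> \<le> h" using assms by (auto simp: min_def)
  then have "\<bar>(min (u + h) b - min (u + h) a) - (min u b - min u a)\<bar> / (b - a) \<le> h / (b - a)"
    using assms by (intro divide_right_mono) auto
  then show ?thesis using assms by (simp add: ramp_def diff_divide_distrib[symmetric])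
qed

definition polygon :: "(nat \<Rightarrow> real) \<Rightarrow> nat \<Rightarrow> (nat \<Rightarrow> real) \<Rightarrow> real \<Rightarrow> real" where
  "polygon A m x t = (\<Sum>k=1..m. x k * ramp (A (k - 1)) (A k) t)"

lemma continuous_on_polygon: "continuous_on S (polygon A m x)"
  unfolding polygon_def[abs_def] by (intro continuous_intros continuous_on_ramp)

lemma polygon_diff: "polygon A m x t - polygon A m y t = polygon A m (\<lambda>k. x k - y k) t"
  by (simp add: polygon_def sum_subtractf left_diff_distrib)

lemma sum_ramp_scaled:
  fixes A :: "nat \<Rightarrow> real"
  assumes "mono A"
  shows "(\<Sum>k=1..m. (A k - A (k - 1)) * ramp (A (k - 1)) (A k) t) = min t (A m) - min t (A 0)"
proof (induction m)
  case (Suc m)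
  have "A m \<le> A (Suc m)" using assms by (auto simp: mono_def)
  then show ?case using Suc by (simp add: ramp_scaled)
qed simp

text \<open>Weighted by the lengths of their cells, the ramps add up to the identity clipped to the range of the
nodes, which is Lipschitz with constant one. This supplies the hypothesis \<open>lin\<close> of \<open>sq_osc_weighted_sum\<close>.\<close>

lemma sum_ramp_increment_le:
  fixes A :: "nat \<Rightarrow> real"
  assumes "mono A" "0 \<le> h"
  shows "(\<Sum>k=1..m. (A k - A (k - 1)) * (ramp (A (k - 1)) (A k) (u + h) - ramp (A (k - 1)) (A k) u)) \<le> h"
proof -
  have "A 0 \<le> A m" using assms by (auto simp: mono_def)
  then show ?thesis
    using assms(2) unfolding right_diff_distrib sum_subtractf sum_ramp_scaled[OF assms(1)]
    by (auto simp: min_def)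
qed

locale nodes =
  fixes A :: "nat \<Rightarrow> real" and m :: nat
  assumes mono_A: "mono A" and A_step: "\<And>k. k \<in> {1..m} \<Longrightarrow> A (k - 1) < A k"
    and A_0: "A 0 = 0" and A_m: "A m = 1"
begin

lemma m_pos: "1 \<le> m"
  using A_0 A_m by (cases m) auto

lemma A_mono: "i \<le> j \<Longrightarrow> A i \<le> A j"
  using mono_A by (auto simp: mono_def)

lemma polygon_interpolation:
  assumes k: "k \<in> {1..m}" and t: "A (k - 1) \<le> t" "t \<le> A k"
  shows "polygon A m x t = (\<Sum>j=1..k-1. x j) + x k * ((t - A (k - 1)) / (A k - A (k - 1)))"
proof -
  have "polygon A m x t = (\<Sum>j=1..k. x j * ramp (A (j - 1)) (A j) t)"
    unfolding polygon_def
  proof (rule sum.mono_neutral_right)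
    show "\<forall>j\<in>{1..m} - {1..k}. x j * ramp (A (j - 1)) (A j) t = 0"
    proof
      fix j assume j: "j \<in> {1..m} - {1..k}"
      then have "t \<le> A (j - 1)" using t(2) A_mono[of k "j - 1"] by fastforce
      then show "x j * ramp (A (j - 1)) (A j) t = 0" using j A_step by (simp add: ramp_eq_0)
    qed
  qed (use k in auto)
  also have "{1..k} = insert k {1..k-1}" using k by auto
  also have "(\<Sum>j\<in>insert k {1..k-1}. x j * ramp (A (j - 1)) (A j) t)
      = x k * ramp (A (k - 1)) (A k) t + (\<Sum>j=1..k-1. x j * ramp (A (j - 1)) (A j) t)"
    using k by (subst sum.insert) auto
  also have "(\<Sum>j=1..k-1. x j * ramp (A (j - 1)) (A j) t) = (\<Sum>j=1..k-1. x j)"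
  proof (intro sum.cong refl)
    fix j assume j: "j \<in> {1..k-1}"
    then have "A j \<le> t" using t(1) A_mono[of j "k - 1"] by fastforce
    moreover have "A (j - 1) < A j" by (rule A_step) (use j k in auto)
    ultimately show "x j * ramp (A (j - 1)) (A j) t = x j" by (simp add: ramp_eq_1)
  qed
  finally show ?thesis using t by (simp add: ramp_between)
qed

definition last_node :: "real \<Rightarrow> nat" where
  "last_node s = Max {j\<in>{0..m}. A j \<le> s}"

lemma last_node:
  assumes "0 \<le> s"
  shows "last_node s \<le> m" "A (last_node s) \<le> s" "\<And>j. j \<le> m \<Longrightarrow> A j \<le> s \<Longrightarrow> j \<le> last_node s"
proof -
  have ne: "{j\<in>{0..m}. A j \<le> s} \<noteq> {}" using A_0 assms by auto
  from Max_in[OF _ ne] show "last_node s \<le> m" "A (last_node s) \<le> s" by (auto simp: last_node_def)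
  show "\<And>j. j \<le> m \<Longrightarrow> A j \<le> s \<Longrightarrow> j \<le> last_node s" by (auto simp: last_node_def intro!: Max_ge)
qed

lemma last_node_mono: "0 \<le> s \<Longrightarrow> s \<le> t \<Longrightarrow> last_node s \<le> last_node t"
  using last_node[of s] last_node[of t] by force

lemma last_node_0: "last_node 0 = 0"
proof (rule ccontr)
  assume "last_node 0 \<noteq> 0"
  then have "A 0 < A 1" "A 1 \<le> A (last_node 0)"
    using A_step[of 1] m_pos by (auto intro: A_mono)
  then show False using last_node(2)[of 0] A_0 by simp
qed

lemma last_node_1: "1 \<le> s \<Longrightarrow> last_node s = m"
  using last_node(1,3)[of s] A_m by (simp add: dual_order.antisym)

lemma A_last_node_ge:
  assumes s: "0 \<le> s" "s \<le> 1" and \<eta>: "\<And>k. k \<in> {1..m} \<Longrightarrow> A k - A (k - 1) \<le> \<eta>"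
  shows "s - \<eta> \<le> A (last_node s)"
proof (cases "last_node s = m")
  case True
  have "A 1 - A 0 \<le> \<eta>" "A 0 \<le> A 1" using \<eta>[of 1] m_pos by (auto intro: A_mono)
  then show ?thesis using True A_m s by simp
next
  case False
  define k where "k = last_node s + 1"
  have k: "k \<in> {1..m}" using False last_node(1)[OF s(1)] by (simp add: k_def)
  then have "\<not> A k \<le> s" using last_node(3)[OF s(1), of k] by (auto simp: k_def)
  then show ?thesis using \<eta>[OF k] by (simp add: k_def)
qed

text \<open>The indices of the increments that end in the \<open>i\<close>-th cell of the grid of mesh \<open>1/K\<close>. An increment
that straddles a grid point belongs to the block of the cell that contains its right end.\<close>

definition block :: "nat \<Rightarrow> nat \<Rightarrow> nat set" where
  "block K i = {last_node (real (i - 1) / real K)<..last_node (real i / real K)}"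

lemma block_subset: "block K i \<subseteq> {1..m}"
  using last_node(1)[of "real i / real K"] by (auto simp: block_def)

lemma disjoint_blocks: "disjoint_family_on (block K) {1..K}"
  unfolding disjoint_family_on_def
proof (intro ballI impI)
  fix i j assume ij: "i \<in> {1..K}" "j \<in> {1..K}" "i \<noteq> j"
  have "block K i \<inter> block K j = {}" if "i < j" for i j
  proof -
    have "last_node (real i / real K) \<le> last_node (real (j - 1) / real K)"
      using that by (intro last_node_mono divide_right_mono) auto
    then show ?thesis by (auto simp: block_def)
  qed
  from this[of i j] this[of j i] ij show "block K i \<inter> block K j = {}" by (cases "i < j") auto
qed

lemma sum_greaterThanAtMost_diff:
  fixes x :: "nat \<Rightarrow> real"
  shows "l \<le> r \<Longrightarrow> (\<Sum>k\<in>{l<..r}. x k) = (\<Sum>k=1..r. x k) - (\<Sum>k=1..l. x k)"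
proof -
  assume "l \<le> r"
  then have eq: "{1..r} = {1..l} \<union> {l<..r}" by auto
  have "(\<Sum>k=1..r. x k) = (\<Sum>k=1..l. x k) + (\<Sum>k\<in>{l<..r}. x k)"
    unfolding eq by (rule sum.union_disjoint) auto
  then show ?thesis by simp
qed

lemma last_node_step: "last_node (real (i - 1) / real K) \<le> last_node (real i / real K)"
  by (intro last_node_mono divide_right_mono) auto

lemma block_sum: "(\<Sum>k\<in>block K i. x k)
    = (\<Sum>k=1..last_node (real i / real K). x k) - (\<Sum>k=1..last_node (real (i - 1) / real K). x k)"
  for x :: "nat \<Rightarrow> real"
  unfolding block_def by (rule sum_greaterThanAtMost_diff[OF last_node_step])

lemma sum_block_sums:
  fixes x :: "nat \<Rightarrow> real"
  shows "(\<Sum>i=1..j. \<Sum>k\<in>block K i. x k) = (\<Sum>k=1..last_node (real j / real K). x k)"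
  by (induction j) (auto simp: block_sum last_node_0)

text \<open>Both ends of a block differ from the grid points by at most one step of the node sequence.\<close>

lemma block_variance:
  assumes K: "1 \<le> K" and i: "i \<in> {1..K}" and \<eta>: "\<And>k. k \<in> {1..m} \<Longrightarrow> A k - A (k - 1) \<le> \<eta>"
  shows "\<bar>(\<Sum>k\<in>block K i. A k - A (k - 1)) - 1 / real K\<bar> \<le> \<eta>"
proof -
  have tel: "(\<Sum>k=1..r. A k - A (k - 1)) = A r" for r
    by (induction r) (auto simp: A_0)
  let ?a = "A (last_node (real i / real K))" and ?b = "A (last_node (real (i - 1) / real K))"
  have s: "(\<Sum>k\<in>block K i. A k - A (k - 1)) = ?a - ?b" by (simp only: block_sum tel)
  have ik: "real i / real K \<le> 1" "real (i - 1) / real K \<le> 1" using i by auto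
  have "?a \<le> real i / real K" "real i / real K - \<eta> \<le> ?a"
    using last_node(2)[of "real i / real K"] A_last_node_ge[OF _ ik(1) \<eta>] by auto
  moreover have "?b \<le> real (i - 1) / real K" "real (i - 1) / real K - \<eta> \<le> ?b"
    using last_node(2)[of "real (i - 1) / real K"] A_last_node_ge[OF _ ik(2) \<eta>] by auto
  moreover have "real i / real K - real (i - 1) / real K = 1 / real K"
    using i by (simp add: of_nat_diff diff_divide_distrib)
  ultimately show ?thesis unfolding s by linarith
qed

end

lemma nodes_grid: "1 \<le> K \<Longrightarrow> nodes (\<lambda>i. real i / real K) K"
  by unfold_locales (auto intro!: monoI divide_right_mono simp: divide_less_cancel)

lemma grid_cell:
  assumes K: "1 \<le> K" and t: "0 \<le> t" "t < 1"
  obtains i where "i \<in> {1..K}" "real (i - 1) / real K \<le> t" "t \<le> real i / real K"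
proof -
  define i where "i = nat \<lfloor>t * real K\<rfloor> + 1"
  have f: "0 \<le> \<lfloor>t * real K\<rfloor>" using t by simp
  have ri: "real (i - 1) = of_int \<lfloor>t * real K\<rfloor>" "real i = of_int \<lfloor>t * real K\<rfloor> + 1"
    using f by (simp_all add: i_def)
  have b: "real (i - 1) \<le> t * real K" "t * real K < real i"
    unfolding ri using floor_correct[of "t * real K"] by linarith+
  have "t * real K < real K" using K t by simp
  then have "real (i - 1) < real K" using b(1) by linarith
  then have "i \<le> K" by linarith
  moreover have "1 \<le> i" by (simp add: i_def)
  ultimately show ?thesis using b K by (intro that[of i]) (auto simp: field_simps)
qed

text \<open>After subtraction of the partial sum up to the start of the block, which both polygons contain, three terms of
size at most \<open>b\<close> remain: the partial sum from the start of the block to the last node before \<open>t\<close>, the piece of the increment that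
contains \<open>t\<close>, and the piece of the coarse increment before \<open>t\<close>.\<close>

lemma (in nodes) polygon_block_approximation:
  assumes K: "1 \<le> K" and t: "0 \<le> t" "t \<le> 1"
    and b: "\<And>k. k \<in> {1..m} \<Longrightarrow> \<bar>x k\<bar> \<le> b"
    and osc: "\<And>i j. i \<in> {1..K} \<Longrightarrow> j \<in> block K i \<Longrightarrow> \<bar>\<Sum>k\<in>{last_node (real (i - 1) / real K)<..j}. x k\<bar> \<le> b"
  shows "\<bar>polygon A m x t - polygon (\<lambda>i. real i / real K) K (\<lambda>i. \<Sum>k\<in>block K i. x k) t\<bar> \<le> 3 * b"
proof -
  interpret G: nodes "\<lambda>i. real i / real K" K by (rule nodes_grid[OF K])
  have b0: "0 \<le> b" using b[of 1] m_pos by fastforce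
  show ?thesis
  proof (cases "t = 1")
    case True
    have "polygon A m x 1 = (\<Sum>j=1..m-1. x j) + x m * ((1 - A (m - 1)) / (A m - A (m - 1)))"
      using m_pos A_m A_mono[of "m - 1" m] by (intro polygon_interpolation) auto
    also have "\<dots> = (\<Sum>j=1..m. x j)"
      using A_step[of m] m_pos A_m by (cases m) auto
    finally have 1: "polygon A m x 1 = (\<Sum>j=1..m. x j)" .
    let ?V = "\<lambda>i. \<Sum>k\<in>block K i. x k"
    have "polygon (\<lambda>i. real i / real K) K ?V 1
        = (\<Sum>j=1..K-1. ?V j) + ?V K * ((1 - real (K - 1) / real K) / (real K / real K - real (K - 1) / real K))"
      using K by (intro G.polygon_interpolation) auto
    also have "\<dots> = (\<Sum>j=1..K. ?V j)"
      using G.A_step[of K] K by (cases K) auto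
    also have "\<dots> = (\<Sum>j=1..m. x j)" unfolding sum_block_sums using K by (simp add: last_node_1)
    finally show ?thesis using 1 True b0 by simp
  next
    case False
    then have t1: "t < 1" using t by simp
    obtain i where i: "i \<in> {1..K}" "real (i - 1) / real K \<le> t" "t \<le> real i / real K"
      using grid_cell[OF K t(1) t1] .
    define k where "k = last_node t + 1"
    have kt: "A (k - 1) \<le> t" using last_node(2)[OF t(1)] by (simp add: k_def)
    have "last_node t \<noteq> m" using last_node(2)[OF t(1)] A_m t1 by auto
    then have k: "k \<in> {1..m}" using last_node(1)[OF t(1)] by (simp add: k_def)
    then have tk: "t \<le> A k" using last_node(3)[OF t(1), of k] by (force simp: k_def)
    define \<theta> where "\<theta> = (t - A (k - 1)) / (A k - A (k - 1))"
    have \<theta>: "0 \<le> \<theta>" "\<theta> \<le> 1" using kt tk A_step[OF k] by (auto simp: \<theta>_def)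
    let ?V = "\<lambda>i. \<Sum>k\<in>block K i. x k"
    define \<theta>' where "\<theta>' = (t - real (i - 1) / real K) / (real i / real K - real (i - 1) / real K)"
    have \<theta>': "0 \<le> \<theta>'" "\<theta>' \<le> 1" using i G.A_step[OF i(1)] by (auto simp: \<theta>'_def)
    let ?l = "last_node (real (i - 1) / real K)"
    have l: "?l \<le> last_node t" "last_node t \<le> last_node (real i / real K)"
      using i t by (auto intro!: last_node_mono)
    have Y: "polygon A m x t = (\<Sum>j=1..last_node t. x j) + x k * \<theta>"
      using polygon_interpolation[OF k kt tk] by (simp add: \<theta>_def k_def)
    have Q: "polygon (\<lambda>i. real i / real K) K ?V t = (\<Sum>j=1..?l. x j) + ?V i * \<theta>'"
      using G.polygon_interpolation[OF i] sum_block_sums[of x K "i - 1"] by (simp add: \<theta>'_def)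
    have "polygon A m x t - polygon (\<lambda>i. real i / real K) K ?V t
        = (\<Sum>j\<in>{?l<..last_node t}. x j) + x k * \<theta> - ?V i * \<theta>'"
      unfolding Y Q using sum_greaterThanAtMost_diff[OF l(1), of x] by simp
    moreover have "\<bar>\<Sum>j\<in>{?l<..last_node t}. x j\<bar> \<le> b"
      using osc[OF i(1), of "last_node t"] l b0 by (cases "?l = last_node t") (auto simp: block_def)
    moreover have "\<bar>x k * \<theta>\<bar> \<le> b"
    proof -
      have "\<bar>x k\<bar> * \<bar>\<theta>\<bar> \<le> b * 1" using b[OF k] \<theta> b0 by (intro mult_mono) auto
      then show ?thesis by (simp add: abs_mult)
    qed
    moreover have "\<bar>?V i * \<theta>'\<bar> \<le> b"
    proof -
      have "\<bar>?V i\<bar> \<le> b"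
        using osc[OF i(1), of "last_node (real i / real K)"] last_node_step[of i K] b0
        by (cases "?l = last_node (real i / real K)") (auto simp: block_def)
      then have "\<bar>?V i\<bar> * \<bar>\<theta>'\<bar> \<le> b * 1" using \<theta>' b0 by (intro mult_mono) auto
      then show ?thesis by (simp add: abs_mult)
    qed
    ultimately show ?thesis by linarith
  qed
qed

lemma polygon_grid_approximation:
  fixes w :: "real \<Rightarrow> real"
  assumes K: "1 \<le> K" and t: "0 \<le> t" "t \<le> 1" and w0: "w 0 = 0"
    and osc: "\<And>s t. s \<in> {0..1} \<Longrightarrow> t \<in> {0..1} \<Longrightarrow> \<bar>s - t\<bar> \<le> 1 / real K \<Longrightarrow> \<bar>w s - w t\<bar> \<le> b"
  shows "\<bar>w t - polygon (\<lambda>i. real i / real K) K (\<lambda>i. w (real i / real K) - w (real (i - 1) / real K)) t\<bar> \<le> 2 * b"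
proof -
  interpret G: nodes "\<lambda>i. real i / real K" K by (rule nodes_grid[OF K])
  have tel: "(\<Sum>i=1..j. w (real i / real K) - w (real (i - 1) / real K)) = w (real j / real K)" for j
    by (induction j) (auto simp: w0)
  have b0: "0 \<le> b" using osc[of 0 0] by simp
  obtain i where i: "i \<in> {1..K}" "real (i - 1) / real K \<le> t" "t \<le> real i / real K"
  proof (cases "t = 1")
    case True then show ?thesis using that[of K] K by auto
  next
    case False then show ?thesis using grid_cell[OF K t(1)] t that by auto
  qed
  define \<theta> where "\<theta> = (t - real (i - 1) / real K) / (real i / real K - real (i - 1) / real K)"
  have \<theta>: "0 \<le> \<theta>" "\<theta> \<le> 1" using i G.A_step[OF i(1)] by (auto simp: \<theta>_def)
  have d: "real i / real K - real (i - 1) / real K = 1 / real K"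
    using i by (simp add: of_nat_diff diff_divide_distrib)
  have in01: "real i / real K \<in> {0..1}" "real (i - 1) / real K \<in> {0..1}" using i by auto
  let ?d = "w (real i / real K) - w (real (i - 1) / real K)"
  have "polygon (\<lambda>i. real i / real K) K (\<lambda>i. w (real i / real K) - w (real (i - 1) / real K)) t
      = w (real (i - 1) / real K) + ?d * \<theta>"
    using G.polygon_interpolation[OF i] tel[of "i - 1"] by (simp add: \<theta>_def)
  moreover have "\<bar>w t - w (real (i - 1) / real K)\<bar> \<le> b" using t i d in01 by (intro osc) auto
  moreover have "\<bar>?d * \<theta>\<bar> \<le> b"
  proof -
    have "\<bar>?d\<bar> \<le> b" using d in01 by (intro osc) auto
    then have "\<bar>?d\<bar> * \<bar>\<theta>\<bar> \<le> b * 1" using \<theta> b0 by (intro mult_mono) auto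
    then show ?thesis by (simp add: abs_mult)
  qed
  ultimately show ?thesis by linarith
qed

text \<open>Families indexed by a finite set become points of the full product space, where the Borel
\<open>\<sigma>\<close>-algebra of the product topology is available.\<close>

definition pad :: "nat set \<Rightarrow> (nat \<Rightarrow> real) \<Rightarrow> nat \<Rightarrow> real" where
  "pad I y i = (if i \<in> I then y i else 0)"

lemma pad_measurable:
  assumes "\<And>i. i \<in> I \<Longrightarrow> (\<lambda>\<omega>. Z i \<omega>) \<in> borel_measurable M"
  shows "(\<lambda>\<omega>. pad I (\<lambda>i. Z i \<omega>)) \<in> borel_measurable M"
proof (rule measurable_coordinatewise_then_product)
  fix i
  show "(\<lambda>\<omega>. pad I (\<lambda>i. Z i \<omega>) i) \<in> borel_measurable M"
    by (cases "i \<in> I") (simp_all add: pad_def assms)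
qed


section \<open>Joint convergence of block sums and Ottaviani's inequality\<close>

lemma distr_PiM_coordinatewise:
  fixes \<Omega> :: "nat \<Rightarrow> 'b measure" and Y :: "nat \<Rightarrow> 'b \<Rightarrow> real"
  assumes I: "I \<noteq> {}" and \<Omega>: "\<And>i. i \<in> I \<Longrightarrow> prob_space (\<Omega> i)"
    and Y: "\<And>i. i \<in> I \<Longrightarrow> Y i \<in> borel_measurable (\<Omega> i)"
  shows "distr (Pi\<^sub>M I \<Omega>) (Pi\<^sub>M I (\<lambda>_. borel)) (\<lambda>\<omega>. \<lambda>i\<in>I. Y i (\<omega> i)) = Pi\<^sub>M I (\<lambda>i. distr (\<Omega> i) borel (Y i))"
proof -
  interpret P: prob_space "Pi\<^sub>M I \<Omega>" by (rule prob_space_PiM) (rule \<Omega>)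
  have comp: "(\<lambda>\<omega>. \<omega> i) \<in> Pi\<^sub>M I \<Omega> \<rightarrow>\<^sub>M \<Omega> i" if "i \<in> I" for i
    by (rule measurable_component_singleton) (rule that)
  have Yc: "(\<lambda>\<omega>. Y i (\<omega> i)) \<in> borel_measurable (Pi\<^sub>M I \<Omega>)" if "i \<in> I" for i
    using measurable_compose[OF comp[OF that] Y[OF that]] .
  have "distr (Pi\<^sub>M I \<Omega>) (Pi\<^sub>M I \<Omega>) (\<lambda>x. \<lambda>i\<in>I. x i) = distr (Pi\<^sub>M I \<Omega>) (Pi\<^sub>M I \<Omega>) (\<lambda>x. x)"
    by (intro distr_cong) (auto simp: space_PiM)
  also have "\<dots> = Pi\<^sub>M I \<Omega>" by simp
  also have "\<dots> = Pi\<^sub>M I (\<lambda>i. distr (Pi\<^sub>M I \<Omega>) (\<Omega> i) (\<lambda>\<omega>. \<omega> i))"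
    by (intro PiM_cong distr_PiM_component[symmetric] \<Omega>) auto
  finally have "P.indep_vars \<Omega> (\<lambda>i \<omega>. \<omega> i) I"
    using P.indep_vars_iff_distr_eq_PiM'[where M' = \<Omega> and X = "\<lambda>i \<omega>. \<omega> i", OF I comp] by simp
  then have "P.indep_vars (\<lambda>_. borel) (\<lambda>i \<omega>. Y i (\<omega> i)) I"
    by (rule P.indep_vars_compose2) (rule Y)
  then have "distr (Pi\<^sub>M I \<Omega>) (Pi\<^sub>M I (\<lambda>_. borel)) (\<lambda>\<omega>. \<lambda>i\<in>I. Y i (\<omega> i))
      = Pi\<^sub>M I (\<lambda>i. distr (Pi\<^sub>M I \<Omega>) borel (\<lambda>\<omega>. Y i (\<omega> i)))"
    using P.indep_vars_iff_distr_eq_PiM'[where M' = "\<lambda>_. borel" and X = "\<lambda>i \<omega>. Y i (\<omega> i)", OF I Yc] by simp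
  also have "\<dots> = Pi\<^sub>M I (\<lambda>i. distr (\<Omega> i) borel (Y i))"
  proof (intro PiM_cong refl)
    fix i assume i: "i \<in> I"
    have "distr (Pi\<^sub>M I \<Omega>) borel (\<lambda>\<omega>. Y i (\<omega> i)) = distr (distr (Pi\<^sub>M I \<Omega>) (\<Omega> i) (\<lambda>\<omega>. \<omega> i)) borel (Y i)"
      by (subst distr_distr[OF Y[OF i] comp[OF i]]) (simp add: comp_def)
    also have "distr (Pi\<^sub>M I \<Omega>) (\<Omega> i) (\<lambda>\<omega>. \<omega> i) = \<Omega> i"
      by (rule distr_PiM_component) (use \<Omega> i in auto)
    finally show "distr (Pi\<^sub>M I \<Omega>) borel (\<lambda>\<omega>. Y i (\<omega> i)) = distr (\<Omega> i) borel (Y i)" .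
  qed
  finally show ?thesis .
qed

text \<open>Skorohod's theorem realises each coordinate by variables that converge everywhere. On the product of
these probability spaces all coordinates converge simultaneously, and dominated convergence applies.\<close>

lemma PiM_weak_convergence:
  fixes \<mu> :: "nat \<Rightarrow> nat \<Rightarrow> real measure" and \<nu> :: "nat \<Rightarrow> real measure" and f :: "(nat \<Rightarrow> real) \<Rightarrow> real"
  assumes I: "I \<noteq> {}" "finite I"
    and \<mu>: "\<And>n i. i \<in> I \<Longrightarrow> real_distribution (\<mu> n i)" and \<nu>: "\<And>i. i \<in> I \<Longrightarrow> real_distribution (\<nu> i)"
    and conv: "\<And>i. i \<in> I \<Longrightarrow> weak_conv_m (\<lambda>n. \<mu> n i) (\<nu> i)"
    and f: "f \<in> borel_measurable (Pi\<^sub>M I (\<lambda>_. borel))" and bd: "\<And>y. \<bar>f y\<bar> \<le> C"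
    and cont: "\<And>y y'. (\<And>i. i \<in> I \<Longrightarrow> (\<lambda>n. y n i) \<longlonglongrightarrow> y' i) \<Longrightarrow>
      (\<lambda>n. f (restrict (y n) I)) \<longlonglongrightarrow> f (restrict y' I)"
  shows "(\<lambda>n. \<integral>y. f y \<partial>Pi\<^sub>M I (\<mu> n)) \<longlonglongrightarrow> (\<integral>y. f y \<partial>Pi\<^sub>M I \<nu>)"
proof -
  have "\<forall>i\<in>I. \<exists>(\<Omega> :: real measure) (Ys :: nat \<Rightarrow> real \<Rightarrow> real) (Y :: real \<Rightarrow> real).
    prob_space \<Omega> \<and> (\<forall>n. Ys n \<in> measurable \<Omega> borel) \<and> (\<forall>n. distr \<Omega> borel (Ys n) = \<mu> n i) \<and>
    Y \<in> measurable \<Omega> lborel \<and> distr \<Omega> borel Y = \<nu> i \<and> (\<forall>x \<in> space \<Omega>. (\<lambda>n. Ys n x) \<longlonglongrightarrow> Y x)"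
    using Skorohod[OF \<mu> \<nu> conv] by blast
  then obtain \<Omega> :: "nat \<Rightarrow> real measure" and Ys :: "nat \<Rightarrow> nat \<Rightarrow> real \<Rightarrow> real" and Y :: "nat \<Rightarrow> real \<Rightarrow> real"
    where *: "\<forall>i\<in>I. prob_space (\<Omega> i) \<and> (\<forall>n. Ys i n \<in> borel_measurable (\<Omega> i)) \<and>
      (\<forall>n. distr (\<Omega> i) borel (Ys i n) = \<mu> n i) \<and> Y i \<in> measurable (\<Omega> i) lborel \<and>
      distr (\<Omega> i) borel (Y i) = \<nu> i \<and> (\<forall>x \<in> space (\<Omega> i). (\<lambda>n. Ys i n x) \<longlonglongrightarrow> Y i x)"
    unfolding bchoice_iff by blast
  have \<Omega>: "prob_space (\<Omega> i)" and Ys: "Ys i n \<in> borel_measurable (\<Omega> i)"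
    and dYs: "distr (\<Omega> i) borel (Ys i n) = \<mu> n i" and Y: "Y i \<in> measurable (\<Omega> i) lborel"
    and dY: "distr (\<Omega> i) borel (Y i) = \<nu> i"
    and lim: "\<And>x. x \<in> space (\<Omega> i) \<Longrightarrow> (\<lambda>n. Ys i n x) \<longlonglongrightarrow> Y i x" if "i \<in> I" for i n
    using bspec[OF * that] by blast+
  have Y: "Y i \<in> borel_measurable (\<Omega> i)" if "i \<in> I" for i using Y[OF that] by simp
  let ?P = "Pi\<^sub>M I \<Omega>"
  interpret P: prob_space ?P by (rule prob_space_PiM) (rule \<Omega>)
  have trans: "(\<integral>y. f y \<partial>Pi\<^sub>M I \<rho>) = (\<integral>\<omega>. f (\<lambda>i\<in>I. Z i (\<omega> i)) \<partial>?P)"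
    and meas: "(\<lambda>\<omega>. f (\<lambda>i\<in>I. Z i (\<omega> i))) \<in> borel_measurable ?P"
    if Z: "\<And>i. i \<in> I \<Longrightarrow> Z i \<in> borel_measurable (\<Omega> i)" and \<rho>: "\<And>i. i \<in> I \<Longrightarrow> distr (\<Omega> i) borel (Z i) = \<rho> i"
    for Z and \<rho> :: "nat \<Rightarrow> real measure"
  proof -
    have m: "(\<lambda>\<omega>. \<lambda>i\<in>I. Z i (\<omega> i)) \<in> ?P \<rightarrow>\<^sub>M Pi\<^sub>M I (\<lambda>_. borel)"
    proof (rule measurable_restrict)
      fix i assume i: "i \<in> I"
      have "(\<lambda>\<omega>. \<omega> i) \<in> ?P \<rightarrow>\<^sub>M \<Omega> i" by (rule measurable_component_singleton[OF i])
      from measurable_compose[OF this Z[OF i]] show "(\<lambda>\<omega>. Z i (\<omega> i)) \<in> borel_measurable ?P" .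
    qed
    have "Pi\<^sub>M I \<rho> = Pi\<^sub>M I (\<lambda>i. distr (\<Omega> i) borel (Z i))"
      by (intro PiM_cong refl) (simp add: \<rho>)
    also have "\<dots> = distr ?P (Pi\<^sub>M I (\<lambda>_. borel)) (\<lambda>\<omega>. \<lambda>i\<in>I. Z i (\<omega> i))"
      by (rule distr_PiM_coordinatewise[symmetric]) (use I \<Omega> Z in auto)
    finally show "(\<integral>y. f y \<partial>Pi\<^sub>M I \<rho>) = (\<integral>\<omega>. f (\<lambda>i\<in>I. Z i (\<omega> i)) \<partial>?P)"
      using integral_distr[OF m f] by simp
    show "(\<lambda>\<omega>. f (\<lambda>i\<in>I. Z i (\<omega> i))) \<in> borel_measurable ?P" by (rule measurable_compose[OF m f])
  qed
  have "(\<lambda>n. \<integral>\<omega>. f (\<lambda>i\<in>I. Ys i n (\<omega> i)) \<partial>?P) \<longlonglongrightarrow> (\<integral>\<omega>. f (\<lambda>i\<in>I. Y i (\<omega> i)) \<partial>?P)"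
  proof (rule integral_dominated_convergence[where w = "\<lambda>_. C"])
    show "AE \<omega> in ?P. (\<lambda>n. f (\<lambda>i\<in>I. Ys i n (\<omega> i))) \<longlonglongrightarrow> f (\<lambda>i\<in>I. Y i (\<omega> i))"
    proof (rule AE_I2)
      fix \<omega> assume "\<omega> \<in> space ?P"
      then show "(\<lambda>n. f (\<lambda>i\<in>I. Ys i n (\<omega> i))) \<longlonglongrightarrow> f (\<lambda>i\<in>I. Y i (\<omega> i))"
        by (intro cont lim) (auto simp: space_PiM)
    qed
  qed (auto intro!: meas[OF Ys dYs] meas[OF Y dY] bd)
  then show ?thesis
    using trans[OF Ys dYs] trans[OF Y dY] by simp
qed

lemma (in prob_space) expectation_indep_vars_eq_PiM:
  fixes Z :: "nat \<Rightarrow> 'a \<Rightarrow> real"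
  assumes I: "I \<noteq> {}" and ind: "indep_vars (\<lambda>_. borel) Z I"
    and f: "f \<in> borel_measurable (Pi\<^sub>M I (\<lambda>_. borel))"
  shows "expectation (\<lambda>\<omega>. f (\<lambda>i\<in>I. Z i \<omega>)) = (\<integral>y. f y \<partial>Pi\<^sub>M I (\<lambda>i. distr M borel (Z i)) :: real)"
proof -
  have Z: "random_variable borel (Z i)" if "i \<in> I" for i using ind that by (auto simp: indep_vars_def)
  have m: "(\<lambda>\<omega>. \<lambda>i\<in>I. Z i \<omega>) \<in> M \<rightarrow>\<^sub>M Pi\<^sub>M I (\<lambda>_. borel)" by (intro measurable_restrict Z)
  have "distr M (Pi\<^sub>M I (\<lambda>_. borel)) (\<lambda>\<omega>. \<lambda>i\<in>I. Z i \<omega>) = Pi\<^sub>M I (\<lambda>i. distr M borel (Z i))"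
    using indep_vars_iff_distr_eq_PiM'[where M' = "\<lambda>_. borel", OF I Z] ind by simp
  then show ?thesis using integral_distr[OF m f] by simp
qed

lemma (in prob_space) indep_vars_block_sums:
  fixes X :: "nat \<Rightarrow> 'a \<Rightarrow> real" and B :: "nat \<Rightarrow> nat set"
  assumes "indep_vars (\<lambda>_. borel) X J" and "\<And>i. i \<in> I \<Longrightarrow> B i \<subseteq> J" and "disjoint_family_on B I"
  shows "indep_vars (\<lambda>_. borel) (\<lambda>i \<omega>. \<Sum>k\<in>B i. X k \<omega>) I"
proof -
  have r: "indep_vars (\<lambda>i. Pi\<^sub>M (B i) (\<lambda>_. borel)) (\<lambda>i \<omega>. restrict (\<lambda>k. X k \<omega>) (B i)) I"
    by (rule indep_vars_restrict[OF assms(1)]) (use assms(2,3) in auto)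
  have s: "(\<lambda>y. \<Sum>k\<in>B i. y k) \<in> borel_measurable (Pi\<^sub>M (B i) (\<lambda>_. borel :: real measure))" for i
    by (intro borel_measurable_sum measurable_component_singleton)
  show ?thesis
    using indep_vars_compose2[where Y = "\<lambda>i y. \<Sum>k\<in>B i. y k", OF r s] by simp
qed

text \<open>Disjoint blocks have independent sums, so their joint law is a product, and each factor converges to a
normal law by continuity of characteristic functions.\<close>

lemma (in lindeberg_array) joint_block_limit:
  fixes F :: "(nat \<Rightarrow> real) \<Rightarrow> real" and G :: "nat \<Rightarrow> 'b \<Rightarrow> real"
  assumes I: "I \<noteq> {}" "finite I"
    and B: "\<And>n i. i \<in> I \<Longrightarrow> B n i \<subseteq> {1..m n}" "\<And>n. disjoint_family_on (B n) I"
    and s: "\<And>i. i \<in> I \<Longrightarrow> 0 < s i" "\<And>i. i \<in> I \<Longrightarrow> (\<lambda>n. \<Sum>k\<in>B n i. v n k) \<longlonglongrightarrow> s i"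
    and N: "prob_space N" and G: "prob_space.indep_vars N (\<lambda>_. borel) G I"
    and dG: "\<And>i. i \<in> I \<Longrightarrow> distr N borel (G i) = normal_law (s i)"
    and F: "F \<in> borel_measurable borel" and bd: "\<And>y. \<bar>F y\<bar> \<le> C"
    and cont: "\<And>y y'. (\<And>i. (\<lambda>n. y n i) \<longlonglongrightarrow> y' i) \<Longrightarrow> (\<lambda>n. F (y n)) \<longlonglongrightarrow> F y'"
  shows "(\<lambda>n. \<integral>\<omega>. F (pad I (\<lambda>i. \<Sum>k\<in>B n i. X n k \<omega>)) \<partial>M n) \<longlonglongrightarrow> (\<integral>\<omega>. F (pad I (\<lambda>i. G i \<omega>)) \<partial>N)"
proof -
  interpret N: prob_space N by (rule N)
  define f where "f y = F (pad I y)" for y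
  have f: "f \<in> borel_measurable (Pi\<^sub>M I (\<lambda>_. borel))"
    unfolding f_def by (intro measurable_compose[OF pad_measurable F] measurable_component_singleton)
  have pr: "pad I (restrict y I) = pad I y" for y by (auto simp: pad_def fun_eq_iff)
  have indV: "prob_space.indep_vars (M n) (\<lambda>_. borel) (\<lambda>i \<omega>. \<Sum>k\<in>B n i. X n k \<omega>) I" for n
    by (rule prob_space.indep_vars_block_sums[OF prob_space_M indep B])
  have rvV: "(\<lambda>\<omega>. \<Sum>k\<in>B n i. X n k \<omega>) \<in> borel_measurable (M n)" if "i \<in> I" for n i
    using indV[of n] that unfolding prob_space.indep_vars_def[OF prob_space_M] by blast
  have "(\<lambda>n. \<integral>y. f y \<partial>Pi\<^sub>M I (\<lambda>i. distr (M n) borel (\<lambda>\<omega>. \<Sum>k\<in>B n i. X n k \<omega>)))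
      \<longlonglongrightarrow> (\<integral>y. f y \<partial>Pi\<^sub>M I (\<lambda>i. distr N borel (G i)))"
  proof (rule PiM_weak_convergence[where C = C, OF I _ _ _ f])
    fix i assume i: "i \<in> I"
    show rd: "real_distribution (distr (M n) borel (\<lambda>\<omega>. \<Sum>k\<in>B n i. X n k \<omega>))" for n
      by (rule prob_space.real_distribution_distr[OF prob_space_M rvV[OF i]])
    show rdN: "real_distribution (distr N borel (G i))"
      unfolding dG[OF i] by (rule real_distribution_normal_law[OF s(1)[OF i]])
    show "weak_conv_m (\<lambda>n. distr (M n) borel (\<lambda>\<omega>. \<Sum>k\<in>B n i. X n k \<omega>)) (distr N borel (G i))"
      by (rule levy_continuity[OF rd rdN])
        (unfold dG[OF i] char_normal_law[OF s(1)[OF i]], rule char_block_sum_tendsto[OF B(1)[OF i] s(2)[OF i]])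
  next
    fix y :: "nat \<Rightarrow> nat \<Rightarrow> real" and y' assume "\<And>i. i \<in> I \<Longrightarrow> (\<lambda>n. y n i) \<longlonglongrightarrow> y' i"
    then show "(\<lambda>n. f (restrict (y n) I)) \<longlonglongrightarrow> f (restrict y' I)"
      unfolding f_def pr by (intro cont) (auto simp: pad_def)
  qed (simp add: f_def bd)
  moreover have "(\<integral>y. f y \<partial>Pi\<^sub>M I (\<lambda>i. distr (M n) borel (\<lambda>\<omega>. \<Sum>k\<in>B n i. X n k \<omega>)))
      = (\<integral>\<omega>. F (pad I (\<lambda>i. \<Sum>k\<in>B n i. X n k \<omega>)) \<partial>M n)" for n
    using prob_space.expectation_indep_vars_eq_PiM[OF prob_space_M I(1) indV f, of n]
    by (simp add: f_def pr)
  moreover have "(\<integral>y. f y \<partial>Pi\<^sub>M I (\<lambda>i. distr N borel (G i))) = (\<integral>\<omega>. F (pad I (\<lambda>i. G i \<omega>)) \<partial>N)"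
    using N.expectation_indep_vars_eq_PiM[OF I(1) G f] by (simp add: f_def pr)
  ultimately show ?thesis by simp
qed

text \<open>When the partial sums first reach the level \<open>2 * \<epsilon>\<close> at time \<open>j\<close>, the remaining sum up to \<open>r\<close> is
independent of the past and is below \<open>\<epsilon>\<close> with probability at least one half by Chebyshev's inequality; in that
case the full sum is still at least \<open>\<epsilon>\<close>.\<close>

lemma (in prob_space) ottaviani:
  fixes X :: "nat \<Rightarrow> 'a \<Rightarrow> real"
  assumes ind: "indep_vars (\<lambda>_. borel) X {1..m}"
    and sq: "\<And>k. k \<in> {1..m} \<Longrightarrow> integrable M (\<lambda>\<omega>. (X k \<omega>)\<^sup>2)"
    and mean: "\<And>k. k \<in> {1..m} \<Longrightarrow> expectation (X k) = 0"
    and r: "r \<le> m" and \<epsilon>: "0 < \<epsilon>"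
    and var: "(\<Sum>k\<in>{l<..r}. expectation (\<lambda>\<omega>. (X k \<omega>)\<^sup>2)) \<le> \<epsilon>\<^sup>2 / 2"
  shows "prob {\<omega>\<in>space M. \<exists>j\<in>{l<..r}. 2 * \<epsilon> \<le> \<bar>\<Sum>k\<in>{l<..j}. X k \<omega>\<bar>}
    \<le> 2 * prob {\<omega>\<in>space M. \<epsilon> \<le> \<bar>\<Sum>k\<in>{l<..r}. X k \<omega>\<bar>}"
proof -
  let ?P = "\<lambda>J. Pi\<^sub>M J (\<lambda>_. borel :: real measure)"
  define S where "S j \<omega> = (\<Sum>k\<in>{l<..j}. X k \<omega>)" for j \<omega>
  have rv: "random_variable borel (X k)" if "k \<in> {1..m}" for k
    using ind that by (auto simp: indep_vars_def)
  have rv0: "(\<lambda>\<omega>. \<Sum>k\<in>K. X k \<omega>) \<in> borel_measurable M" if "K \<subseteq> {1..m}" for K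
    using that by (intro borel_measurable_sum rv) auto
  have sub: "{l<..j} \<subseteq> {1..m}" if "j \<le> r" for j using that r by auto
  have Sm: "S j \<in> borel_measurable M" if "j \<le> r" for j
    unfolding S_def by (rule rv0[OF sub[OF that]])
  \<comment> \<open>the event that the level is first reached at time j\<close>
  define T where "T j = {\<omega>\<in>space M. 2 * \<epsilon> \<le> \<bar>S j \<omega>\<bar> \<and> (\<forall>i\<in>{l<..<j}. \<bar>S i \<omega>\<bar> < 2 * \<epsilon>)}" for j
  define U where "U j = {\<omega>\<in>space M. \<bar>\<Sum>k\<in>{j<..r}. X k \<omega>\<bar> < \<epsilon>}" for j
  have Um: "U j \<in> events" for j
    unfolding U_def using rv0[of "{j<..r}"] r
    by (cases "j = 0") (auto intro!: borel_measurable_less borel_measurable_abs rv0)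
  have Tm: "T j \<in> events" if "j \<le> r" for j
  proof -
    have [measurable]: "S j \<in> borel_measurable M" by (rule Sm[OF that])
    have 1: "{\<omega>\<in>space M. \<forall>i\<in>{l<..<j}. \<bar>S i \<omega>\<bar> < 2 * \<epsilon>} \<in> events"
      using that by (intro sets.sets_Collect_finite_All borel_measurable_less borel_measurable_abs Sm) auto
    have 2: "{\<omega>\<in>space M. 2 * \<epsilon> \<le> \<bar>S j \<omega>\<bar>} \<in> events" by measurable
    have "T j = {\<omega>\<in>space M. 2 * \<epsilon> \<le> \<bar>S j \<omega>\<bar>} \<inter> {\<omega>\<in>space M. \<forall>i\<in>{l<..<j}. \<bar>S i \<omega>\<bar> < 2 * \<epsilon>}"
      unfolding T_def by blast
    then show ?thesis using sets.Int[OF 2 1] by (simp only:)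
  qed
  have ev: "{\<omega>\<in>space M. \<epsilon> \<le> \<bar>S r \<omega>\<bar>} \<in> events"
  proof -
    have [measurable]: "S r \<in> borel_measurable M" by (rule Sm) simp
    show ?thesis by measurable
  qed
  have half: "1 / 2 \<le> prob (U j)" if j: "j \<in> {l<..r}" for j
  proof -
    define c where "c k = (if j < k then 1 else 0 :: real)" for k
    have eqc: "(\<Sum>k=1..r. c k * z k) = (\<Sum>k\<in>{j<..r}. z k)" for z :: "nat \<Rightarrow> real"
      unfolding c_def by (auto simp: if_distrib[of "\<lambda>a. a * _"] intro!: sum.mono_neutral_cong_right)
    have eqc2: "(\<Sum>k=1..r. (c k)\<^sup>2 * z k) = (\<Sum>k\<in>{j<..r}. z k)" for z :: "nat \<Rightarrow> real"
      unfolding c_def by (auto simp: if_distrib[of "\<lambda>a. a * _"] if_distrib[of "\<lambda>a. a ^ 2"] intro!: sum.mono_neutral_cong_right)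
    note ws = weighted_sum_second_moment[OF ind sq mean r, of c, unfolded eqc eqc2]
    have "prob {\<omega>\<in>space M. \<epsilon> \<le> \<bar>\<Sum>k\<in>{j<..r}. X k \<omega>\<bar>} \<le> expectation (\<lambda>\<omega>. (\<Sum>k\<in>{j<..r}. X k \<omega>)\<^sup>2) / \<epsilon>\<^sup>2"
      using j r by (intro second_moment_method rv0 ws(1) \<epsilon>) auto
    also have "\<dots> \<le> (\<epsilon>\<^sup>2 / 2) / \<epsilon>\<^sup>2"
    proof (rule divide_right_mono)
      have "(\<Sum>k\<in>{j<..r}. expectation (\<lambda>\<omega>. (X k \<omega>)\<^sup>2)) \<le> (\<Sum>k\<in>{l<..r}. expectation (\<lambda>\<omega>. (X k \<omega>)\<^sup>2))"
        using j by (intro sum_mono2) auto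
      then show "expectation (\<lambda>\<omega>. (\<Sum>k\<in>{j<..r}. X k \<omega>)\<^sup>2) \<le> \<epsilon>\<^sup>2 / 2" using var ws(2) by simp
    qed simp
    also have "\<dots> = 1 / 2" using \<epsilon> by simp
    finally have "prob {\<omega>\<in>space M. \<epsilon> \<le> \<bar>\<Sum>k\<in>{j<..r}. X k \<omega>\<bar>} \<le> 1 / 2" .
    moreover have "{\<omega>\<in>space M. \<epsilon> \<le> \<bar>\<Sum>k\<in>{j<..r}. X k \<omega>\<bar>} = space M - U j" by (auto simp: U_def)
    ultimately show ?thesis using prob_compl[OF Um[of j]] by simp
  qed
  have indep: "prob (T j \<inter> U j) = prob (T j) * prob (U j)" if j: "j \<in> {l<..r}" for j
  proof -
    define s where "s i y = (\<Sum>k\<in>{l<..i} \<inter> {l<..j}. y k)" for i and y :: "nat \<Rightarrow> real"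
    define f where "f y = (if 2 * \<epsilon> \<le> \<bar>s j y\<bar> \<and> (\<forall>i\<in>{l<..<j}. \<bar>s i y\<bar> < 2 * \<epsilon>) then 1 else 0 :: real)" for y
    define g where "g y = (if \<bar>\<Sum>k\<in>{j<..r}. y k\<bar> < \<epsilon> then 1 else 0 :: real)" for y :: "nat \<Rightarrow> real"
    have sm [measurable]: "s i \<in> borel_measurable (?P {l<..j})" for i
      unfolding s_def by (intro borel_measurable_sum measurable_component_singleton) auto
    have fm: "f \<in> borel_measurable (?P {l<..j})" unfolding f_def by measurable
    have gm: "g \<in> borel_measurable (?P {j<..r})"
    proof -
      have [measurable]: "(\<lambda>y. \<Sum>k\<in>{j<..r}. y k) \<in> borel_measurable (?P {j<..r})"
        by (intro borel_measurable_sum measurable_component_singleton) auto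
      show ?thesis unfolding g_def by measurable
    qed
    have AB: "{l<..j} \<inter> {j<..r} = {}" "{l<..j} \<subseteq> {1..m}" "{j<..r} \<subseteq> {1..m}" using j r by auto
    have sX: "s i (restrict (\<lambda>k. X k \<omega>) {l<..j}) = S i \<omega>" if "i \<le> j" for i \<omega>
      unfolding s_def S_def using that by (intro sum.cong) auto
    have fX: "f (restrict (\<lambda>k. X k \<omega>) {l<..j}) = indicator (T j) \<omega>" if "\<omega> \<in> space M" for \<omega>
      using that sX by (auto simp: f_def T_def indicator_def)
    have gX: "g (restrict (\<lambda>k. X k \<omega>) {j<..r}) = indicator (U j) \<omega>" if "\<omega> \<in> space M" for \<omega>
      using that by (auto simp: g_def U_def indicator_def)
    have Tj: "T j \<in> events" using Tm j by auto
    have iT: "integrable M (indicator (T j) :: _ \<Rightarrow> real)" and iU: "integrable M (indicator (U j) :: _ \<Rightarrow> real)"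
      using Tj Um[of j] by (auto intro!: integrable_real_indicator simp: emeasure_eq_measure)
    have "expectation (\<lambda>\<omega>. indicator (T j) \<omega> * indicator (U j) \<omega>)
        = expectation (indicator (T j)) * expectation (indicator (U j) :: _ \<Rightarrow> real)"
      using indep_vars_product_split(2)[OF ind AB fm gm] Tj Um[of j] iT iU
      by (simp add: fX gX cong: Bochner_Integration.integral_cong Bochner_Integration.integrable_cong)
    then show ?thesis
      using Tj Um[of j] by (simp add: indicator_inter_arith[symmetric])
  qed
  have disj: "disjoint_family_on T {l<..r}"
    unfolding disjoint_family_on_def
  proof (intro ballI impI)
    fix i j assume ij: "i \<in> {l<..r}" "j \<in> {l<..r}" "i \<noteq> j"
    have "T i \<inter> T j = {}" if "i < j" "i \<in> {l<..r}" for i j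
    proof (rule equals0I)
      fix \<omega> assume "\<omega> \<in> T i \<inter> T j"
      then have "2 * \<epsilon> \<le> \<bar>S i \<omega>\<bar>" and less: "\<forall>k\<in>{l<..<j}. \<bar>S k \<omega>\<bar> < 2 * \<epsilon>" by (simp_all add: T_def)
      moreover have "\<bar>S i \<omega>\<bar> < 2 * \<epsilon>" by (rule bspec[OF less]) (use that in simp)
      ultimately show False by linarith
    qed
    from this[of i j] this[of j i] show "T i \<inter> T j = {}" using ij by (cases "i < j") auto
  qed
  have un: "{\<omega>\<in>space M. \<exists>j\<in>{l<..r}. 2 * \<epsilon> \<le> \<bar>S j \<omega>\<bar>} = (\<Union>j\<in>{l<..r}. T j)"
  proof (intro equalityI subsetI)
    fix \<omega> assume "\<omega> \<in> {\<omega>\<in>space M. \<exists>j\<in>{l<..r}. 2 * \<epsilon> \<le> \<bar>S j \<omega>\<bar>}"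
    then have \<omega>: "\<omega> \<in> space M" and ex: "\<exists>j. j \<in> {l<..r} \<and> 2 * \<epsilon> \<le> \<bar>S j \<omega>\<bar>" by blast+
    define j where "j = (LEAST j. j \<in> {l<..r} \<and> 2 * \<epsilon> \<le> \<bar>S j \<omega>\<bar>)"
    have j: "j \<in> {l<..r}" "2 * \<epsilon> \<le> \<bar>S j \<omega>\<bar>" using LeastI_ex[OF ex] unfolding j_def by blast+
    have "\<bar>S i \<omega>\<bar> < 2 * \<epsilon>" if "i \<in> {l<..<j}" for i
      using not_less_Least[of i "\<lambda>j. j \<in> {l<..r} \<and> 2 * \<epsilon> \<le> \<bar>S j \<omega>\<bar>"] that j(1) by (fold j_def) (auto simp: not_le)
    with \<omega> j(2) have "\<omega> \<in> T j" by (simp add: T_def)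
    with j(1) show "\<omega> \<in> (\<Union>j\<in>{l<..r}. T j)" by blast
  next
    fix \<omega> assume "\<omega> \<in> (\<Union>j\<in>{l<..r}. T j)"
    then obtain j where "j \<in> {l<..r}" "\<omega> \<in> T j" by blast
    then show "\<omega> \<in> {\<omega>\<in>space M. \<exists>j\<in>{l<..r}. 2 * \<epsilon> \<le> \<bar>S j \<omega>\<bar>}" unfolding T_def by blast
  qed
  have "prob (\<Union>j\<in>{l<..r}. T j) = (\<Sum>j\<in>{l<..r}. prob (T j))"
    using Tm disj by (intro finite_measure_finite_Union) auto
  also have "\<dots> \<le> (\<Sum>j\<in>{l<..r}. 2 * prob (T j \<inter> U j))"
  proof (rule sum_mono)
    fix j assume j: "j \<in> {l<..r}"
    have "prob (T j) * (1 / 2) \<le> prob (T j) * prob (U j)" by (intro mult_left_mono half j) auto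
    then show "prob (T j) \<le> 2 * prob (T j \<inter> U j)" using indep[OF j] by simp
  qed
  also have "\<dots> = 2 * prob (\<Union>j\<in>{l<..r}. T j \<inter> U j)"
    unfolding sum_distrib_left[symmetric]
  proof -
    have "disjoint_family_on (\<lambda>j. T j \<inter> U j) {l<..r}" using disj unfolding disjoint_family_on_def by blast
    then have "prob (\<Union>j\<in>{l<..r}. T j \<inter> U j) = (\<Sum>j\<in>{l<..r}. prob (T j \<inter> U j))"
      using Tm Um by (intro finite_measure_finite_Union) auto
    then show "2 * (\<Sum>j\<in>{l<..r}. prob (T j \<inter> U j)) = 2 * prob (\<Union>j\<in>{l<..r}. T j \<inter> U j)" by simp
  qed
  also have "\<dots> \<le> 2 * prob {\<omega>\<in>space M. \<epsilon> \<le> \<bar>S r \<omega>\<bar>}"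
  proof (intro mult_left_mono finite_measure_mono ev subsetI)
    fix \<omega> assume "\<omega> \<in> (\<Union>j\<in>{l<..r}. T j \<inter> U j)"
    then obtain j where j: "j \<in> {l<..r}" "\<omega> \<in> T j" "\<omega> \<in> U j" by blast
    have eq: "{l<..r} = {l<..j} \<union> {j<..r}" using j by auto
    have "S r \<omega> = S j \<omega> + (\<Sum>k\<in>{j<..r}. X k \<omega>)"
      unfolding S_def eq by (rule sum.union_disjoint) auto
    moreover have "\<omega> \<in> space M" "2 * \<epsilon> \<le> \<bar>S j \<omega>\<bar>" using j(2) by (simp_all add: T_def)
    moreover have "\<bar>\<Sum>k\<in>{j<..r}. X k \<omega>\<bar> < \<epsilon>" using j(3) by (simp add: U_def)
    ultimately show "\<omega> \<in> {\<omega>\<in>space M. \<epsilon> \<le> \<bar>S r \<omega>\<bar>}" by simp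
  qed simp
  finally show ?thesis using un by (simp add: S_def)
qed


section \<open>Weak convergence in metric spaces\<close>

lemma space_borel_of [simp]: "space (borel_of T) = topspace T"
  by (simp add: borel_of_def space_measure_of_conv)

lemma openin_borel_of: "openin T U \<Longrightarrow> U \<in> sets (borel_of T)"
  unfolding borel_of_def by (subst sets_measure_of) (auto dest: openin_subset)

lemma measurable_borel_ofI:
  assumes "\<And>\<omega>. \<omega> \<in> space N \<Longrightarrow> f \<omega> \<in> topspace T"
    and "\<And>U. openin T U \<Longrightarrow> {\<omega>\<in>space N. f \<omega> \<in> U} \<in> sets N"
  shows "f \<in> N \<rightarrow>\<^sub>M borel_of T"
  unfolding borel_of_def
proof (rule measurable_measure_of)
  fix U assume "U \<in> {U. openin T U}"
  moreover have "f -` U \<inter> space N = {\<omega>\<in>space N. f \<omega> \<in> U}" by auto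
  ultimately show "f -` U \<inter> space N \<in> sets N" using assms(2) by auto
qed (use assms(1) in \<open>auto dest: openin_subset\<close>)

lemma measurable_borel_of_continuous_map:
  assumes "continuous_map T euclideanreal f"
  shows "f \<in> borel_measurable (borel_of T)"
proof (rule borel_measurableI)
  fix S :: "real set" assume "open S"
  then have "openin T {x \<in> topspace T. f x \<in> S}"
    using assms by (auto simp: continuous_map_def)
  moreover have "f -` S \<inter> space (borel_of T) = {x \<in> topspace T. f x \<in> S}" by auto
  ultimately show "f -` S \<inter> space (borel_of T) \<in> sets (borel_of T)" using openin_borel_of by metis
qed

context Metric_space
begin

lemma lipschitz_continuous_map:
  assumes L: "0 \<le> L" and f: "\<And>x y. x \<in> M \<Longrightarrow> y \<in> M \<Longrightarrow> \<bar>f x - f y\<bar> \<le> L * d x y"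
  shows "continuous_map mtopology euclideanreal f"
  unfolding continuous_map_def
proof (intro conjI allI impI)
  fix U :: "real set" assume "openin euclideanreal U"
  then have U: "open U" by simp
  show "openin mtopology {x \<in> topspace mtopology. f x \<in> U}"
    unfolding openin_mtopology
  proof (intro conjI allI impI)
    fix x assume "x \<in> {x \<in> topspace mtopology. f x \<in> U}"
    then have x: "x \<in> M" "f x \<in> U" by auto
    obtain e where e: "0 < e" "ball (f x) e \<subseteq> U" using U x(2) openE by blast
    have "mball x (e / (L + 1)) \<subseteq> {x \<in> topspace mtopology. f x \<in> U}"
    proof
      fix y assume "y \<in> mball x (e / (L + 1))"
      then have y: "y \<in> M" "d x y < e / (L + 1)" by auto
      have "\<bar>f x - f y\<bar> \<le> L * d x y" by (rule f[OF x(1) y(1)])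
      also have "\<dots> \<le> (L + 1) * d x y" by (intro mult_right_mono) auto
      also have "\<dots> < e" using y(2) L by (simp add: field_simps)
      finally show "y \<in> {x \<in> topspace mtopology. f x \<in> U}"
        using e y(1) by (auto simp: dist_real_def)
    qed
    then show "\<exists>r>0. mball x r \<subseteq> {x \<in> topspace mtopology. f x \<in> U}"
      using e L by (intro exI[of _ "e / (L + 1)"]) auto
  qed auto
qed auto

text \<open>An open set is the union of the closed sets \<open>C k\<close> of points at distance at least \<open>1 / Suc k\<close> from its
complement. The limit lies in the open set exactly when the sequence is eventually in one of them.\<close>

lemma measurable_pointwise_limit:
  assumes Z: "\<And>n. Z n \<in> N \<rightarrow>\<^sub>M borel_of mtopology"
    and Z': "\<And>\<omega>. \<omega> \<in> space N \<Longrightarrow> Z' \<omega> \<in> M"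
    and lim: "\<And>\<omega>. \<omega> \<in> space N \<Longrightarrow> (\<lambda>n. d (Z n \<omega>) (Z' \<omega>)) \<longlonglongrightarrow> 0"
  shows "Z' \<in> N \<rightarrow>\<^sub>M borel_of mtopology"
proof (rule measurable_borel_ofI)
  fix U assume U: "openin mtopology U"
  \<comment> \<open>the points whose distance from the complement of U is at least 1/(k+1)\<close>
  define C where "C k = M - (\<Union>y\<in>M - U. mball y (1 / real (Suc k)))" for k
  have C: "x \<in> C k \<longleftrightarrow> x \<in> M \<and> (\<forall>y\<in>M - U. 1 / real (Suc k) \<le> d y x)" for x k
    by (auto simp: C_def not_less)
  have ZM: "Z n \<omega> \<in> M" if "\<omega> \<in> space N" for n \<omega>
    using measurable_space[OF Z that] by simp
  have Cm: "{\<omega>\<in>space N. Z j \<omega> \<in> C k} \<in> sets N" for j k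
  proof -
    have "C k \<in> sets (borel_of mtopology)"
      using sets.compl_sets[OF openin_borel_of[of mtopology "\<Union>y\<in>M - U. mball y (1 / real (Suc k))"]]
      by (auto simp: C_def)
    from measurable_sets[OF Z this] show ?thesis by (simp add: vimage_def Int_def conj_commute)
  qed
  have "{\<omega>\<in>space N. Z' \<omega> \<in> U} = {\<omega>\<in>space N. \<exists>k i. \<forall>j\<in>{i..}. Z j \<omega> \<in> C k}"
  proof (intro Collect_cong conj_cong refl iffI)
    fix \<omega> assume \<omega>: "\<omega> \<in> space N" and "Z' \<omega> \<in> U"
    then obtain r where r: "0 < r" "mball (Z' \<omega>) r \<subseteq> U" using U by (auto simp: openin_mtopology)
    obtain k where "inverse (real (Suc k)) < r / 2" using reals_Archimedean[of "r / 2"] r by auto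
    then have k: "1 / real (Suc k) < r / 2" by (simp add: inverse_eq_divide)
    have "\<forall>\<^sub>F j in sequentially. d (Z j \<omega>) (Z' \<omega>) < r / 2"
      using order_tendstoD(2)[OF lim[OF \<omega>], of "r / 2"] r by simp
    then obtain i where i: "\<And>j. i \<le> j \<Longrightarrow> d (Z j \<omega>) (Z' \<omega>) < r / 2"
      by (auto simp: eventually_sequentially)
    have "Z j \<omega> \<in> C k" if j: "i \<le> j" for j
    proof -
      have "1 / real (Suc k) \<le> d y (Z j \<omega>)" if y: "y \<in> M - U" for y
      proof -
        have "\<not> d (Z' \<omega>) y < r" using y r(2) Z'[OF \<omega>] by auto
        moreover have "d (Z' \<omega>) y \<le> d (Z' \<omega>) (Z j \<omega>) + d (Z j \<omega>) y"
          using Z'[OF \<omega>] ZM[OF \<omega>] y by (intro triangle) auto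
        ultimately show ?thesis using i[OF j] k commute[of y "Z j \<omega>"] commute[of "Z' \<omega>" "Z j \<omega>"] by linarith
      qed
      then show ?thesis using ZM[OF \<omega>] by (simp add: C)
    qed
    then show "\<exists>k i. \<forall>j\<in>{i..}. Z j \<omega> \<in> C k" by auto
  next
    fix \<omega> assume \<omega>: "\<omega> \<in> space N" and "\<exists>k i. \<forall>j\<in>{i..}. Z j \<omega> \<in> C k"
    then obtain k i where ki: "\<And>j. i \<le> j \<Longrightarrow> Z j \<omega> \<in> C k" by auto
    show "Z' \<omega> \<in> U"
    proof (rule ccontr)
      assume "Z' \<omega> \<notin> U"
      then have y: "Z' \<omega> \<in> M - U" using Z'[OF \<omega>] by auto
      have "\<forall>\<^sub>F j in sequentially. d (Z j \<omega>) (Z' \<omega>) < 1 / real (Suc k)"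
        using order_tendstoD(2)[OF lim[OF \<omega>], of "1 / real (Suc k)"] by simp
      then obtain i' where "\<And>j. i' \<le> j \<Longrightarrow> d (Z j \<omega>) (Z' \<omega>) < 1 / real (Suc k)"
        by (auto simp: eventually_sequentially)
      from this[of "max i i'"] have 1: "d (Z (max i i') \<omega>) (Z' \<omega>) < 1 / real (Suc k)" by simp
      have "Z (max i i') \<omega> \<in> C k" by (rule ki) simp
      then have "1 / real (Suc k) \<le> d (Z' \<omega>) (Z (max i i') \<omega>)" unfolding C using y by blast
      then show False using 1 commute[of "Z' \<omega>" "Z (max i i') \<omega>"] by linarith
    qed
  qed
  also have "\<dots> = (\<Union>k. \<Union>i. \<Inter>j\<in>{i..}. {\<omega>\<in>space N. Z j \<omega> \<in> C k})" by auto
  also have "\<dots> \<in> sets N" using Cm by (intro sets.countable_UN sets.countable_INT'') auto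
  finally show "{\<omega>\<in>space N. Z' \<omega> \<in> U} \<in> sets N" .
qed (use Z' in simp)

text \<open>The inf-convolution of \<open>f\<close> with \<open>k\<close> times the distance is Lipschitz with constant \<open>k\<close>. It
converges to \<open>f\<close> because points at distance at least \<open>r\<close> are penalised by \<open>k * r\<close>, which exceeds the
oscillation \<open>2 * B\<close> for large \<open>k\<close>.\<close>

lemma lipschitz_approximation_from_below:
  fixes f :: "'a \<Rightarrow> real"
  assumes f: "continuous_map mtopology euclideanreal f" and B: "\<And>x. x \<in> M \<Longrightarrow> \<bar>f x\<bar> \<le> B"
  obtains g :: "nat \<Rightarrow> 'a \<Rightarrow> real" where
    "\<And>k x y. x \<in> M \<Longrightarrow> y \<in> M \<Longrightarrow> \<bar>g k x - g k y\<bar> \<le> real k * d x y"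
    "\<And>k x. x \<in> M \<Longrightarrow> g k x \<le> f x" "\<And>k x. x \<in> M \<Longrightarrow> \<bar>g k x\<bar> \<le> B"
    "\<And>x. x \<in> M \<Longrightarrow> (\<lambda>k. g k x) \<longlonglongrightarrow> f x"
proof -
  define g where "g k x = (INF y\<in>M. f y + real k * d x y)" for k x
  have bdd: "bdd_below ((\<lambda>y. f y + real k * d x y) ` M)" for k x
  proof (rule bdd_belowI2[where m = "- B"])
    fix y assume "y \<in> M"
    then show "- B \<le> f y + real k * d x y" using B[of y] by (simp add: abs_le_iff add_increasing2)
  qed
  have up: "g k x \<le> f y + real k * d x y" if "y \<in> M" for k x y
    unfolding g_def by (rule cINF_lower[OF bdd that])
  have gf: "g k x \<le> f x" if "x \<in> M" for k x using up[OF that, of k x] that by simp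
  have lo: "- B \<le> g k x" if "x \<in> M" for k x
    unfolding g_def
  proof (rule cINF_greatest)
    fix y assume "y \<in> M"
    then show "- B \<le> f y + real k * d x y" using B[of y] by (simp add: abs_le_iff add_increasing2)
  qed (use that in auto)
  have lip1: "g k x - real k * d x y \<le> g k y" if xy: "x \<in> M" "y \<in> M" for k x y
    unfolding g_def[of k y]
  proof (rule cINF_greatest)
    fix z assume z: "z \<in> M"
    have "g k x \<le> f z + real k * d x z" by (rule up[OF z])
    also have "real k * d x z \<le> real k * (d x y + d y z)"
      using xy z by (intro mult_left_mono triangle) auto
    finally show "g k x - real k * d x y \<le> f z + real k * d y z" by (simp add: algebra_simps)
  qed (use xy in auto)
  show thesis
  proof
    show "\<bar>g k x - g k y\<bar> \<le> real k * d x y" if "x \<in> M" "y \<in> M" for k x y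
      using lip1[OF that, of k] lip1[OF that(2,1), of k] commute[of x y] by simp
    show "\<bar>g k x\<bar> \<le> B" if "x \<in> M" for k x
      using lo[OF that, of k] gf[OF that, of k] B[OF that] by simp
    show "(\<lambda>k. g k x) \<longlonglongrightarrow> f x" if x: "x \<in> M" for x
    proof (rule tendstoI)
      fix e :: real assume e: "0 < e"
      have "\<And>U. openin euclideanreal U \<Longrightarrow> openin mtopology {y \<in> topspace mtopology. f y \<in> U}"
        using f unfolding continuous_map_def by blast
      then have "openin mtopology {y \<in> topspace mtopology. f y \<in> {f x - e / 2<..}}"
        by (metis open_greaterThan open_openin)
      then obtain r where r: "0 < r" "mball x r \<subseteq> {y \<in> topspace mtopology. f y \<in> {f x - e / 2<..}}"
        using x e unfolding openin_mtopology by auto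
      have "dist (g k x) (f x) < e" if k: "2 * B / r \<le> real k" for k
      proof -
        have "f x - e / 2 \<le> g k x"
          unfolding g_def
        proof (rule cINF_greatest)
          fix y assume y: "y \<in> M"
          show "f x - e / 2 \<le> f y + real k * d x y"
          proof (cases "d x y < r")
            case True
            then have "y \<in> mball x r" using x y by simp
            then have "f x - e / 2 < f y" using r(2) by auto
            then show ?thesis by (simp add: add_increasing2)
          next
            case False
            have "2 * B \<le> real k * r" using k r(1) by (simp add: field_simps)
            also have "\<dots> \<le> real k * d x y" using False by (intro mult_left_mono) auto
            finally show ?thesis using B[OF x] B[OF y] e by linarith
          qed
        qed (use x in auto)
        then show ?thesis using gf[OF x, of k] e by (simp add: dist_real_def)
      qed
      then have "\<forall>\<^sub>F k in sequentially. 2 * B / r \<le> real k \<longrightarrow> dist (g k x) (f x) < e" by simp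
      moreover have "\<forall>\<^sub>F k in sequentially. 2 * B / r \<le> real k"
        using filterlim_real_sequentially by (simp add: filterlim_at_top)
      ultimately show "\<forall>\<^sub>F k in sequentially. dist (g k x) (f x) < e" by eventually_elim simp
    qed
  qed (rule gf)
qed

text \<open>The approximation from below gives the lower bound for the limit inferior of the integrals of \<open>f\<close>; the
same bound for \<open>- f\<close> is the upper one.\<close>

lemma weak_conv_on_of_lipschitz:
  assumes \<mu>: "\<And>n. prob_space (\<mu> n)" "\<And>n. sets (\<mu> n) = sets (borel_of mtopology)"
    and \<nu>: "prob_space \<nu>" "sets \<nu> = sets (borel_of mtopology)"
    and conv: "\<And>f L B. 0 \<le> L \<Longrightarrow> (\<And>x y. x \<in> M \<Longrightarrow> y \<in> M \<Longrightarrow> \<bar>f x - f y\<bar> \<le> L * d x y) \<Longrightarrow>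
      (\<And>x. x \<in> M \<Longrightarrow> \<bar>f x\<bar> \<le> B) \<Longrightarrow> (\<lambda>n. \<integral>x. f x \<partial>\<mu> n) \<longlonglongrightarrow> (\<integral>x. f x \<partial>\<nu>)"
  shows "weak_conv_on mtopology \<mu> \<nu>"
proof -
  have int: "integrable \<rho> f" if \<rho>: "prob_space \<rho>" "sets \<rho> = sets (borel_of mtopology)"
    and f: "continuous_map mtopology euclideanreal f" and B: "\<And>x. x \<in> M \<Longrightarrow> \<bar>f x\<bar> \<le> B" for \<rho> f B
  proof -
    interpret \<rho>: prob_space \<rho> by (rule \<rho>)
    have sp: "space \<rho> = M" using sets_eq_imp_space_eq[OF \<rho>(2)] by simp
    have "f \<in> borel_measurable \<rho>"
      using measurable_borel_of_continuous_map[OF f] measurable_cong_sets[OF \<rho>(2) refl] by blast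
    then show ?thesis using B sp by (intro \<rho>.integrable_const_bound[where B = B]) auto
  qed
  have lower: "\<forall>\<^sub>F n in sequentially. (\<integral>x. f x \<partial>\<nu>) - e < (\<integral>x. f x \<partial>\<mu> n)"
    if f: "continuous_map mtopology euclideanreal f" and B: "\<And>x. x \<in> M \<Longrightarrow> \<bar>f x\<bar> \<le> B" and e: "0 < e" for f B e
  proof -
    interpret \<nu>: prob_space \<nu> by (rule \<nu>)
    obtain g :: "nat \<Rightarrow> 'a \<Rightarrow> real" where g: "\<And>k x y. x \<in> M \<Longrightarrow> y \<in> M \<Longrightarrow> \<bar>g k x - g k y\<bar> \<le> real k * d x y"
      "\<And>k x. x \<in> M \<Longrightarrow> g k x \<le> f x" "\<And>k x. x \<in> M \<Longrightarrow> \<bar>g k x\<bar> \<le> B"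
      "\<And>x. x \<in> M \<Longrightarrow> (\<lambda>k. g k x) \<longlonglongrightarrow> f x"
      using lipschitz_approximation_from_below[OF f B] by metis
    have gc: "continuous_map mtopology euclideanreal (g k)" for k
      by (rule lipschitz_continuous_map[OF _ g(1)]) auto
    have sp: "space \<nu> = M" using sets_eq_imp_space_eq[OF \<nu>(2)] by simp
    have "(\<lambda>k. \<integral>x. g k x \<partial>\<nu>) \<longlonglongrightarrow> (\<integral>x. f x \<partial>\<nu>)"
    proof (rule integral_dominated_convergence[where w = "\<lambda>_. B"])
      show "f \<in> borel_measurable \<nu>" "g k \<in> borel_measurable \<nu>" for k
        using int[OF \<nu> f B] int[OF \<nu> gc g(3)] by auto
    qed (use g sp in auto)
    then have "\<forall>\<^sub>F k in sequentially. (\<integral>x. f x \<partial>\<nu>) - e < (\<integral>x. g k x \<partial>\<nu>)"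
      by (rule order_tendstoD) (use e in simp)
    then obtain k where k: "(\<integral>x. f x \<partial>\<nu>) - e < (\<integral>x. g k x \<partial>\<nu>)"
      using eventually_happens'[OF sequentially_bot] by blast
    have "(\<lambda>n. \<integral>x. g k x \<partial>\<mu> n) \<longlonglongrightarrow> (\<integral>x. g k x \<partial>\<nu>)"
      by (rule conv[OF _ g(1) g(3)]) auto
    then have "\<forall>\<^sub>F n in sequentially. (\<integral>x. f x \<partial>\<nu>) - e < (\<integral>x. g k x \<partial>\<mu> n)"
      by (rule order_tendstoD) (rule k)
    then show ?thesis
    proof eventually_elim
      case (elim n)
      have "(\<integral>x. g k x \<partial>\<mu> n) \<le> (\<integral>x. f x \<partial>\<mu> n)"
      proof (rule integral_mono)
        show "integrable (\<mu> n) (g k)" "integrable (\<mu> n) f" using int[OF \<mu> gc g(3)] int[OF \<mu> f B] by auto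
        fix x assume "x \<in> space (\<mu> n)"
        then show "g k x \<le> f x" using g(2) sets_eq_imp_space_eq[OF \<mu>(2)[of n]] by simp
      qed
      with elim show ?case by simp
    qed
  qed
  show ?thesis
    unfolding weak_conv_on_def
  proof (intro allI impI)
    fix f :: "'a \<Rightarrow> real" assume f: "continuous_map mtopology euclideanreal f \<and> bounded (f ` topspace mtopology)"
    then obtain B where B: "\<And>x. x \<in> M \<Longrightarrow> \<bar>f x\<bar> \<le> B" by (auto simp: bounded_iff)
    have fm: "continuous_map mtopology euclideanreal (\<lambda>x. - f x)" using f by (intro continuous_map_minus) auto
    show "(\<lambda>n. \<integral>x. f x \<partial>\<mu> n) \<longlonglongrightarrow> (\<integral>x. f x \<partial>\<nu>)"
    proof (rule tendstoI)
      fix e :: real assume e: "0 < e"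
      show "\<forall>\<^sub>F n in sequentially. dist (\<integral>x. f x \<partial>\<mu> n) (\<integral>x. f x \<partial>\<nu>) < e"
        using lower[OF conjunct1[OF f] B e] lower[OF fm _ e, of B] B
        by (auto simp: dist_real_def elim: eventually_elim2)
    qed
  qed
qed

lemma lipschitz_expectation_diff:
  assumes P: "prob_space P" and Y: "Y \<in> P \<rightarrow>\<^sub>M borel_of mtopology" and Q: "Q \<in> P \<rightarrow>\<^sub>M borel_of mtopology"
    and L: "0 \<le> L" and f: "\<And>x y. x \<in> M \<Longrightarrow> y \<in> M \<Longrightarrow> \<bar>f x - f y\<bar> \<le> L * d x y"
    and B: "\<And>x. x \<in> M \<Longrightarrow> \<bar>f x\<bar> \<le> B"
    and E: "E \<in> sets P" "measure P E \<le> e" and e: "0 \<le> e" and close: "\<And>\<omega>. \<omega> \<in> space P - E \<Longrightarrow> d (Y \<omega>) (Q \<omega>) \<le> e"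
  shows "\<bar>(\<integral>\<omega>. f (Y \<omega>) \<partial>P) - (\<integral>\<omega>. f (Q \<omega>) \<partial>P)\<bar> \<le> (L + 2 * B) * e"
proof -
  interpret P: prob_space P by (rule P)
  have fm: "f \<in> borel_measurable (borel_of mtopology)"
    by (rule measurable_borel_of_continuous_map[OF lipschitz_continuous_map[OF L f]])
  have in_M: "Y \<omega> \<in> M" "Q \<omega> \<in> M" if "\<omega> \<in> space P" for \<omega>
    using measurable_space[OF Y that] measurable_space[OF Q that] by auto
  have int: "integrable P (\<lambda>\<omega>. f (Y \<omega>))" "integrable P (\<lambda>\<omega>. f (Q \<omega>))"
    using in_M B measurable_compose[OF Y fm] measurable_compose[OF Q fm]
    by (auto intro!: P.integrable_const_bound[where B = B])
  obtain \<omega>0 where "\<omega>0 \<in> space P" using P.not_empty by blast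
  then have B0: "0 \<le> B" using B[OF in_M(1)] by fastforce
  have ie: "integrable P (\<lambda>\<omega>. L * e + 2 * B * indicator E \<omega>)"
    using E(1) by (intro Bochner_Integration.integrable_add integrable_mult_right integrable_real_indicator P.integrable_const)
      (simp_all add: P.emeasure_eq_measure)
  have "\<bar>(\<integral>\<omega>. f (Y \<omega>) \<partial>P) - (\<integral>\<omega>. f (Q \<omega>) \<partial>P)\<bar> = \<bar>\<integral>\<omega>. f (Y \<omega>) - f (Q \<omega>) \<partial>P\<bar>"
    using int by simp
  also have "\<dots> \<le> (\<integral>\<omega>. \<bar>f (Y \<omega>) - f (Q \<omega>)\<bar> \<partial>P)" by (rule integral_abs_bound)
  also have "\<dots> \<le> (\<integral>\<omega>. L * e + 2 * B * indicator E \<omega> \<partial>P)"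
  proof (intro integral_mono ie)
    show "integrable P (\<lambda>\<omega>. \<bar>f (Y \<omega>) - f (Q \<omega>)\<bar>)" using int by auto
    fix \<omega> assume \<omega>: "\<omega> \<in> space P"
    show "\<bar>f (Y \<omega>) - f (Q \<omega>)\<bar> \<le> L * e + 2 * B * indicator E \<omega>"
    proof (cases "\<omega> \<in> E")
      case True
      then show ?thesis using B[OF in_M(1)[OF \<omega>]] B[OF in_M(2)[OF \<omega>]] mult_nonneg_nonneg[OF L e] by simp
    next
      case False
      have "\<bar>f (Y \<omega>) - f (Q \<omega>)\<bar> \<le> L * d (Y \<omega>) (Q \<omega>)" by (rule f) (use in_M \<omega> in auto)
      also have "\<dots> \<le> L * e" using close[of \<omega>] \<omega> False L by (intro mult_left_mono) auto
      finally show ?thesis using False by simp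
    qed
  qed
  also have "\<dots> = (\<integral>\<omega>. L * e \<partial>P) + (\<integral>\<omega>. 2 * B * indicator E \<omega> \<partial>P)"
    using E(1) by (intro Bochner_Integration.integral_add integrable_mult_right integrable_real_indicator P.integrable_const)
      (simp_all add: P.emeasure_eq_measure)
  also have "(\<integral>\<omega>. L * e \<partial>P) = L * e" by (simp add: P.prob_space)
  also have "(\<integral>\<omega>. 2 * B * indicator E \<omega> \<partial>P) = 2 * B * measure P E"
    using E(1) by (simp add: sets.Int_space_eq2)
  also have "L * e + 2 * B * measure P E \<le> L * e + 2 * B * e" using E B0 by (intro add_left_mono mult_left_mono) auto
  finally show ?thesis by (simp add: algebra_simps)
qed

end

lemma weak_conv_on_Suc: "weak_conv_on T (\<lambda>n. \<mu> (Suc n)) \<nu> \<Longrightarrow> weak_conv_on T \<mu> \<nu>"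
  unfolding weak_conv_on_def by (auto simp: filterlim_sequentially_Suc[of "\<lambda>n. integral\<^sup>L (\<mu> n) _", symmetric])

section \<open>Polygons in the Besov space\<close>

text \<open>The squared increment is at most \<open>L\<^sup>2 * h\<^sup>2 \<le> L\<^sup>2 * h\<close>. So every polygon lies in the Besov space.\<close>

lemma sq_osc_lipschitz:
  assumes c: "continuous_on UNIV x" and L: "0 \<le> L" and h: "0 \<le> h" "h \<le> 1"
    and lip: "\<And>u. \<bar>x (u + h) - x u\<bar> \<le> L * h"
  shows "sq_osc x h \<le> L\<^sup>2 * h"
proof -
  have "sq_osc x h \<le> integral {0..1 - h} (\<lambda>u. (L * h)\<^sup>2)"
    unfolding sq_osc_def
  proof (intro integral_le sq_increment_integrable c)
    fix u show "(x (u + h) - x u)\<^sup>2 \<le> (L * h)\<^sup>2"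
      using power_mono[OF lip[of u], of 2] by simp
  qed auto
  also have "\<dots> = (1 - h) * (L * h)\<^sup>2" using h by simp
  also have "\<dots> \<le> 1 * (L * h)\<^sup>2" using h by (intro mult_right_mono) auto
  also have "\<dots> = L\<^sup>2 * (h * h)" by (simp add: power2_eq_square)
  also have "\<dots> \<le> L\<^sup>2 * (h * 1)" using h by (intro mult_left_mono) auto
  finally show ?thesis by simp
qed

lemma ae_class_cong:
  assumes "continuous_on {0..1} y" "\<And>t. t \<in> {0..1} \<Longrightarrow> x t = y t"
  shows "ae_class x = ae_class y"
proof (rule Quotient_rel_abs[OF Quotient_l0])
  have y: "y \<in> borel_measurable (lebesgue_on {0..1})"
    by (rule continuous_imp_measurable_on_sets_lebesgue[OF assms(1)]) auto
  moreover have "x \<in> borel_measurable (lebesgue_on {0..1}) \<longleftrightarrow> y \<in> borel_measurable (lebesgue_on {0..1})"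
    by (intro measurable_cong) (simp add: assms(2))
  ultimately show "ae_rel x y" unfolding ae_rel_def using assms(2) by (auto intro!: AE_I2)
qed

context besov_exponents
begin

lemma Metric_space_besov_dist: "Metric_space (besov_space p \<alpha>) (besov_dist p \<alpha>)"
  by (rule Metric_space_besov[OF p \<alpha>])

lemma besov_bound_small:
  assumes "0 < e"
  shows "\<exists>b>0. b \<le> 1 \<and> b + besov_bound A (2 * b) < e"
proof -
  have "\<forall>\<^sub>F c in at_right 0. besov_bound A c < e / 2"
    by (rule order_tendstoD(2)[OF besov_bound_tendsto_0]) (use assms in simp)
  then obtain c where c: "0 < c" "\<And>x. 0 < x \<Longrightarrow> x < c \<Longrightarrow> besov_bound A x < e / 2"
    by (auto simp: eventually_at_right_field)
  define b where "b = min (c / 4) (min (e / 4) 1)"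
  have "0 < b" "b \<le> 1" "b < e / 2" "2 * b < c" using c assms by (auto simp: b_def)
  then show ?thesis using c(2)[of "2 * b"] by (intro exI[of _ b]) auto
qed

lemma besov_dist_ae_class:
  assumes "continuous_on UNIV x" "continuous_on UNIV y"
    and "ae_class x \<in> besov_space p \<alpha>" "ae_class y \<in> besov_space p \<alpha>"
  shows "besov_dist p \<alpha> (ae_class x) (ae_class y) = besov_norm p \<alpha> (ae_class (\<lambda>t. x t - y t))"
proof -
  have "ae_rel x x" "ae_rel y y" by (intro ae_rel_continuous continuous_on_subset[OF assms(1)] continuous_on_subset[OF assms(2)]; simp)+
  then show ?thesis using assms(3,4) by (simp add: besov_dist_def minus_l0.abs_eq)
qed

text \<open>The key comparison: a common oscillation constant turns uniform closeness into closeness in the Besov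
space. The difference has oscillation constant at most \<open>4 * A\<close>, and its increments are at most \<open>2 * b\<close>.\<close>

lemma besov_dist_ae_class_le:
  assumes x: "continuous_on UNIV x" "\<And>h. 0 \<le> h \<Longrightarrow> h \<le> 1 \<Longrightarrow> sq_osc x h \<le> A * h"
    and y: "continuous_on UNIV y" "\<And>h. 0 \<le> h \<Longrightarrow> h \<le> 1 \<Longrightarrow> sq_osc y h \<le> A * h"
    and A: "0 < A" and b: "0 < b" "\<And>t. t \<in> {0..1} \<Longrightarrow> \<bar>x t - y t\<bar> \<le> b"
  shows "besov_dist p \<alpha> (ae_class x) (ae_class y) \<le> b + besov_bound (4 * A) (2 * b)"
proof -
  have s: "ae_class x \<in> besov_space p \<alpha>" "ae_class y \<in> besov_space p \<alpha>"
    by (rule besov_space_ae_class[OF x(1) A x(2)] besov_space_ae_class[OF y(1) A y(2)]; assumption)+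
  have "sq_osc (\<lambda>t. x t - y t) h \<le> 4 * A * h" if "0 \<le> h" "h \<le> 1" for h
    using sq_osc_diff_le[OF x(1) y(1), of h] x(2)[OF that] y(2)[OF that] by simp
  then show ?thesis
    unfolding besov_dist_ae_class[OF x(1) y(1) s]
    using A b by (intro besov_norm_ae_class_le continuous_on_diff x y) auto
qed

end

lemma (in nodes) polygon_lipschitz:
  "\<exists>C>0. \<forall>x u h. 0 \<le> h \<longrightarrow> \<bar>polygon A m x (u + h) - polygon A m x u\<bar> \<le> C * (\<Sum>k=1..m. \<bar>x k\<bar>) * h"
proof -
  define C where "C = (\<Sum>k=1..m. 1 / (A k - A (k - 1)))"
  have Ck: "1 / (A k - A (k - 1)) \<le> C" if "k \<in> {1..m}" for k
    unfolding C_def using that A_step by (intro member_le_sum) (auto intro: less_imp_le)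
  have C: "0 < C"
    unfolding C_def using A_step m_pos by (intro sum_pos) auto
  have "\<bar>polygon A m x (u + h) - polygon A m x u\<bar> \<le> C * (\<Sum>k=1..m. \<bar>x k\<bar>) * h" if h: "0 \<le> h" for x u h
  proof -
    have "\<bar>polygon A m x (u + h) - polygon A m x u\<bar>
        = \<bar>\<Sum>k=1..m. x k * (ramp (A (k - 1)) (A k) (u + h) - ramp (A (k - 1)) (A k) u)\<bar>"
      by (simp add: polygon_def sum_subtractf right_diff_distrib)
    also have "\<dots> \<le> (\<Sum>k=1..m. \<bar>x k\<bar> * (C * h))"
    proof (intro order_trans[OF sum_abs] sum_mono)
      fix k assume k: "k \<in> {1..m}"
      have "\<bar>ramp (A (k - 1)) (A k) (u + h) - ramp (A (k - 1)) (A k) u\<bar> \<le> h / (A k - A (k - 1))"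
        by (rule ramp_increment_le[OF A_step[OF k] h])
      also have "\<dots> \<le> C * h" using mult_right_mono[OF Ck[OF k] h] by simp
      finally show "\<bar>x k * (ramp (A (k - 1)) (A k) (u + h) - ramp (A (k - 1)) (A k) u)\<bar> \<le> \<bar>x k\<bar> * (C * h)"
        by (simp add: abs_mult mult_left_mono)
    qed
    also have "\<dots> = C * (\<Sum>k=1..m. \<bar>x k\<bar>) * h" by (simp add: sum_distrib_left mult_ac)
    finally show ?thesis .
  qed
  with C show ?thesis by blast
qed

lemma (in nodes) abs_polygon_le: "\<bar>polygon A m x t\<bar> \<le> (\<Sum>k=1..m. \<bar>x k\<bar>)"
  unfolding polygon_def
proof (intro order_trans[OF sum_abs] sum_mono)
  fix k assume "k \<in> {1..m}"
  have "A (k - 1) \<le> A k" by (rule A_mono) simp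
  then have "\<bar>ramp (A (k - 1)) (A k) t\<bar> \<le> 1" using ramp_nonneg ramp_le_1 by (simp add: abs_le_iff)
  then show "\<bar>x k * ramp (A (k - 1)) (A k) t\<bar> \<le> \<bar>x k\<bar>" by (simp add: abs_mult mult_left_le)
qed

locale besov_polygons = besov_exponents + nodes
begin

lemma polygon_in_besov_space: "ae_class (polygon A m x) \<in> besov_space p \<alpha>"
proof -
  obtain C where C: "0 < C" "\<And>u h. 0 \<le> h \<Longrightarrow> \<bar>polygon A m x (u + h) - polygon A m x u\<bar> \<le> C * (\<Sum>k=1..m. \<bar>x k\<bar>) * h"
    using polygon_lipschitz by blast
  let ?L = "C * (\<Sum>k=1..m. \<bar>x k\<bar>)"
  have L: "0 \<le> ?L" using C(1) by (intro mult_nonneg_nonneg sum_nonneg) auto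
  have "sq_osc (polygon A m x) h \<le> (?L\<^sup>2 + 1) * h" if "0 \<le> h" "h \<le> 1" for h
    using sq_osc_lipschitz[OF continuous_on_polygon L that C(2)] that by (simp add: distrib_right)
  then show ?thesis
    by (intro besov_space_ae_class[where A = "?L\<^sup>2 + 1"] continuous_on_polygon) (auto intro: add_nonneg_pos)
qed

text \<open>The difference of two polygons over the same nodes is the polygon of the differences, and both its
Lipschitz constant and its supremum are controlled by the sum of the absolute values. Hence the polygon depends continuously,
and therefore measurably, on its increments.\<close>

lemma polygon_besov_dist_small:
  assumes e: "0 < e"
  shows "\<exists>\<delta>>0. \<forall>x y. (\<Sum>k=1..m. \<bar>x k - y k\<bar>) < \<delta> \<longrightarrow>
    besov_dist p \<alpha> (ae_class (polygon A m x)) (ae_class (polygon A m y)) < e"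
proof -
  obtain C where C: "0 < C" "\<And>x u h. 0 \<le> h \<Longrightarrow> \<bar>polygon A m x (u + h) - polygon A m x u\<bar> \<le> C * (\<Sum>k=1..m. \<bar>x k\<bar>) * h"
    using polygon_lipschitz by blast
  obtain b where b: "0 < b" "b \<le> 1" "b + besov_bound (C\<^sup>2) (2 * b) < e" using besov_bound_small[OF e] by blast
  have "besov_dist p \<alpha> (ae_class (polygon A m x)) (ae_class (polygon A m y)) < e"
    if xy: "(\<Sum>k=1..m. \<bar>x k - y k\<bar>) < b" for x y
  proof -
    let ?z = "\<lambda>k. x k - y k"
    have "besov_dist p \<alpha> (ae_class (polygon A m x)) (ae_class (polygon A m y)) = besov_norm p \<alpha> (ae_class (polygon A m ?z))"
      using besov_dist_ae_class[OF continuous_on_polygon continuous_on_polygon polygon_in_besov_space polygon_in_besov_space]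
      by (simp add: polygon_diff)
    also have "\<dots> \<le> b + besov_bound (C\<^sup>2) (2 * b)"
    proof (rule besov_norm_ae_class_le[OF continuous_on_polygon])
      fix h :: real assume h: "0 \<le> h" "h \<le> 1"
      have "\<bar>polygon A m ?z (u + h) - polygon A m ?z u\<bar> \<le> C * h" for u
      proof -
        have "C * (\<Sum>k=1..m. \<bar>?z k\<bar>) * h \<le> C * 1 * h"
          using xy b C(1) h by (intro mult_right_mono mult_left_mono) auto
        then show ?thesis using C(2)[OF h(1), of ?z u] by simp
      qed
      then show "sq_osc (polygon A m ?z) h \<le> C\<^sup>2 * h"
        using C(1) h by (intro sq_osc_lipschitz continuous_on_polygon) auto
    next
      fix u :: real
      show "\<bar>polygon A m ?z u\<bar> \<le> b" using abs_polygon_le[of ?z u] xy by simp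
    qed (use C b in auto)
    finally show ?thesis using b(3) by simp
  qed
  then show ?thesis using b(1) by blast
qed

lemma measurable_polygon_borel: "(\<lambda>x. ae_class (polygon A m x)) \<in> borel \<rightarrow>\<^sub>M borel_of (besov_topology p \<alpha>)"
proof (rule measurable_borel_ofI)
  interpret B: Metric_space "besov_space p \<alpha>" "besov_dist p \<alpha>" by (rule Metric_space_besov_dist)
  fix U assume "openin (besov_topology p \<alpha>) U"
  then have U: "openin B.mtopology U" by (simp add: besov_topology_def)
  have "open {x. ae_class (polygon A m x) \<in> U}"
  proof (subst open_subopen, intro ballI)
    fix x assume "x \<in> {x. ae_class (polygon A m x) \<in> U}"
    then obtain r where r: "0 < r" "B.mball (ae_class (polygon A m x)) r \<subseteq> U"
      using U by (auto simp: B.openin_mtopology)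
    obtain \<delta> where \<delta>: "0 < \<delta>" "\<And>y. (\<Sum>k=1..m. \<bar>x k - y k\<bar>) < \<delta> \<Longrightarrow>
        besov_dist p \<alpha> (ae_class (polygon A m x)) (ae_class (polygon A m y)) < r"
      using polygon_besov_dist_small[OF r(1)] by blast
    let ?T = "{y. (\<Sum>k=1..m. \<bar>x k - y k\<bar>) < \<delta>}"
    have "open ?T"
      by (intro open_Collect_less continuous_intros continuous_on_product_coordinates)
    moreover have "x \<in> ?T" using \<delta>(1) by simp
    moreover have "?T \<subseteq> {x. ae_class (polygon A m x) \<in> U}"
      using \<delta>(2) r(2) polygon_in_besov_space by (auto simp: subset_iff)
    ultimately show "\<exists>T. open T \<and> x \<in> T \<and> T \<subseteq> {x. ae_class (polygon A m x) \<in> U}" by blast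
  qed
  then show "{\<omega> \<in> space borel. ae_class (polygon A m \<omega>) \<in> U} \<in> sets borel" by simp
qed (simp add: topspace_besov_topology[OF p \<alpha>] polygon_in_besov_space)

lemma polygon_pad: "polygon A m (pad {1..m} x) = polygon A m x"
  unfolding polygon_def[abs_def] by (intro ext sum.cong) (auto simp: pad_def)

lemma measurable_polygon:
  assumes "\<And>k. k \<in> {1..m} \<Longrightarrow> (\<lambda>\<omega>. Z k \<omega>) \<in> borel_measurable N"
  shows "(\<lambda>\<omega>. ae_class (polygon A m (\<lambda>k. Z k \<omega>))) \<in> N \<rightarrow>\<^sub>M borel_of (besov_topology p \<alpha>)"
  using measurable_compose[OF pad_measurable measurable_polygon_borel, of "{1..m}" Z N, unfolded polygon_pad] assms
  by blast

end


section \<open>The Wiener process and its interpolations\<close>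

text \<open>The hypothesis \<open>s2\<close> says that each variance is at most twice the mesh, so the constant \<open>c\<close> of
\<open>sq_osc_weighted_sum\<close> is \<open>2\<close>, and \<open>2 + 32 * 2\<^sup>2 = 130\<close>. The factor two leaves room for block sums whose
variances are only asymptotically equal to the mesh.\<close>

lemma (in prob_space) grid_polygon_sq_osc:
  fixes V :: "nat \<Rightarrow> 'a \<Rightarrow> real"
  assumes K: "1 \<le> K" and ind: "indep_vars (\<lambda>_. borel) V {1..K}"
    and sq: "\<And>i. i \<in> {1..K} \<Longrightarrow> integrable M (\<lambda>\<omega>. (V i \<omega>)\<^sup>2)"
    and mean: "\<And>i. i \<in> {1..K} \<Longrightarrow> expectation (V i) = 0"
    and s: "\<And>i. i \<in> {1..K} \<Longrightarrow> expectation (\<lambda>\<omega>. (V i \<omega>)\<^sup>2) = s i"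
    and s2: "\<And>i. i \<in> {1..K} \<Longrightarrow> s i \<le> 2 / real K" and tot: "(\<Sum>i=1..K. s i) \<le> 1" and a: "1 \<le> a"
  shows "\<exists>E\<in>events. prob E \<le> 130 / a \<and> (\<forall>\<omega>\<in>space M - E. \<forall>h\<in>{0..1}.
    sq_osc (polygon (\<lambda>i. real i / real K) K (\<lambda>i. V i \<omega>)) h \<le> 32 * a * h)"
proof -
  interpret G: nodes "\<lambda>i. real i / real K" K by (rule nodes_grid[OF K])
  have le: "real (i - 1) / real K \<le> real i / real K" for i by (rule G.A_mono) simp
  have "(\<Sum>k=1..K. s k * (ramp (real (k - 1) / real K) (real k / real K) (u + h)
      - ramp (real (k - 1) / real K) (real k / real K) u)) \<le> 2 * h" if h: "0 \<le> h" for u h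
  proof -
    have "(\<Sum>k=1..K. s k * (ramp (real (k - 1) / real K) (real k / real K) (u + h)
        - ramp (real (k - 1) / real K) (real k / real K) u))
      \<le> (\<Sum>k=1..K. 2 * ((real k / real K - real (k - 1) / real K) *
        (ramp (real (k - 1) / real K) (real k / real K) (u + h) - ramp (real (k - 1) / real K) (real k / real K) u)))"
      unfolding mult.assoc[symmetric]
    proof (intro sum_mono mult_right_mono)
      fix k assume k: "k \<in> {1..K}"
      then have "real k / real K - real (k - 1) / real K = 1 / real K" by (simp add: of_nat_diff diff_divide_distrib)
      then show "s k \<le> 2 * (real k / real K - real (k - 1) / real K)" using s2[OF k] by simp
      show "0 \<le> ramp (real (k - 1) / real K) (real k / real K) (u + h) - ramp (real (k - 1) / real K) (real k / real K) u"
        using ramp_increment_nonneg[OF le h] by simp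
    qed
    also have "\<dots> \<le> 2 * h"
      unfolding sum_distrib_left[symmetric] using sum_ramp_increment_le[OF G.mono_A h] by (intro mult_left_mono) auto
    finally show ?thesis .
  qed
  from sq_osc_weighted_sum[OF ind sq mean s tot continuous_on_ramp mono_ramp[OF le] ramp_nonneg[OF le] ramp_le_1[OF le] this a]
  show ?thesis by (simp add: polygon_def[abs_def])
qed

lemma (in prob_space) normal_even_moment:
  assumes \<sigma>: "0 < \<sigma>" and X: "distributed M lborel X (normal_density 0 \<sigma>)"
  shows "integrable M (\<lambda>\<omega>. X \<omega> ^ (2 * k))"
    and "expectation (\<lambda>\<omega>. X \<omega> ^ (2 * k)) = fact (2 * k) / ((2 / \<sigma>\<^sup>2) ^ k * fact k)"
proof -
  have D: "distributed M lborel X (\<lambda>x. ennreal (normal_density 0 \<sigma> x))" using X by simp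
  have b: "has_bochner_integral lborel (\<lambda>x. normal_density 0 \<sigma> x * x ^ (2 * k)) (fact (2 * k) / ((2 / \<sigma>\<^sup>2) ^ k * fact k))"
    using normal_moment_even[OF \<sigma>, of 0 k] by simp
  show "integrable M (\<lambda>\<omega>. X \<omega> ^ (2 * k))"
    using distributed_integrable[OF D, of "\<lambda>x. x ^ (2 * k)"] b by (auto simp: has_bochner_integral_iff)
  show "expectation (\<lambda>\<omega>. X \<omega> ^ (2 * k)) = fact (2 * k) / ((2 / \<sigma>\<^sup>2) ^ k * fact k)"
    using distributed_integral[OF D, of "\<lambda>x. x ^ (2 * k)"] b by (auto simp: has_bochner_integral_iff)
qed

locale wiener_process =
  fixes N :: "'b measure" and W :: "real \<Rightarrow> 'b \<Rightarrow> real"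
  assumes standard_wiener: "standard_wiener N W"
begin

sublocale prob_space N
  using standard_wiener by (simp add: standard_wiener_def)

text \<open>The path is extended by constants outside the unit interval, so that it is continuous on the whole line
and all its values are measurable.\<close>

definition trajectory :: "'b \<Rightarrow> real \<Rightarrow> real" where
  "trajectory \<omega> t = W (max 0 (min 1 t)) \<omega>"

definition regular :: "'b \<Rightarrow> bool" where
  "regular \<omega> \<longleftrightarrow> W 0 \<omega> = 0 \<and> continuous_on {0..1} (\<lambda>t. W t \<omega>)"

definition increment :: "nat \<Rightarrow> nat \<Rightarrow> 'b \<Rightarrow> real" where
  "increment K i \<omega> = W (real i / real K) \<omega> - W (real (i - 1) / real K) \<omega>"

definition interpolation :: "nat \<Rightarrow> 'b \<Rightarrow> real \<Rightarrow> real" where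
  "interpolation K \<omega> = polygon (\<lambda>i. real i / real K) K (\<lambda>i. increment K i \<omega>)"

lemma AE_regular: "AE \<omega> in N. regular \<omega>"
  using standard_wiener unfolding standard_wiener_def regular_def by (auto intro: AE_conjI)

lemma trajectory_eq: "t \<in> {0..1} \<Longrightarrow> trajectory \<omega> t = W t \<omega>"
  by (simp add: trajectory_def)

lemma trajectory_measurable [measurable]: "(\<lambda>\<omega>. trajectory \<omega> t) \<in> borel_measurable N"
  using standard_wiener unfolding standard_wiener_def trajectory_def by auto

lemma continuous_trajectory: "regular \<omega> \<Longrightarrow> continuous_on UNIV (trajectory \<omega>)"
  unfolding trajectory_def[abs_def] regular_def
  by (rule continuous_on_compose2[of "{0..1}" "\<lambda>t. W t \<omega>"]) (auto intro!: continuous_intros)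

lemma increment_trajectory: "i \<in> {1..K} \<Longrightarrow> increment K i \<omega> = trajectory \<omega> (real i / real K) - trajectory \<omega> (real (i - 1) / real K)"
  unfolding increment_def by (subst (1 2) trajectory_eq) auto

lemma increment_measurable:
  assumes i: "i \<in> {1..K}"
  shows "increment K i \<in> borel_measurable N"
proof -
  have "increment K i = (\<lambda>\<omega>. trajectory \<omega> (real i / real K) - trajectory \<omega> (real (i - 1) / real K))"
    by (rule ext) (rule increment_trajectory[OF i])
  moreover have "(\<lambda>\<omega>. trajectory \<omega> (real i / real K) - trajectory \<omega> (real (i - 1) / real K)) \<in> borel_measurable N"
    by measurable
  ultimately show ?thesis by simp
qed

lemma interpolation_trajectory:
  "interpolation K \<omega> = polygon (\<lambda>i. real i / real K) K (\<lambda>i. trajectory \<omega> (real i / real K) - trajectory \<omega> (real (i - 1) / real K))"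
  unfolding interpolation_def polygon_def[abs_def] by (intro ext sum.cong) (auto simp: increment_trajectory)

lemma continuous_interpolation: "continuous_on S (interpolation K \<omega>)"
  unfolding interpolation_def by (rule continuous_on_polygon)

lemma interpolation_measurable [measurable]: "(\<lambda>\<omega>. interpolation K \<omega> t) \<in> borel_measurable N"
  unfolding interpolation_trajectory polygon_def by measurable

lemma indep_increments:
  assumes K: "1 \<le> K"
  shows "indep_vars (\<lambda>_. borel) (increment K) {1..K}"
proof -
  have "strict_mono_on {..K} (\<lambda>i. real i / real K)" "(\<lambda>i. real i / real K) ` {..K} \<subseteq> {0..1}"
    using K by (auto intro!: strict_mono_onI divide_strict_right_mono)
  then have "indep_vars (\<lambda>_. borel) (\<lambda>i \<omega>. W (real (Suc i) / real K) \<omega> - W (real i / real K) \<omega>) {..<K}"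
    using standard_wiener unfolding standard_wiener_def by blast
  then have "indep_vars (\<lambda>_. borel) (\<lambda>i \<omega>. \<Sum>k\<in>{i - 1}. W (real (Suc k) / real K) \<omega> - W (real k / real K) \<omega>) {1..K}"
  proof (rule indep_vars_block_sums)
    fix i assume "i \<in> {1..K}"
    then have "1 \<le> i" "i \<le> K" by auto
    then have "i - 1 < K" by linarith
    then show "{i - 1} \<subseteq> {..<K}" by simp
  next
    show "disjoint_family_on (\<lambda>i. {i - 1}) {1..K}"
      unfolding disjoint_family_on_def
    proof (intro ballI impI)
      fix i j assume "i \<in> {1..K}" "j \<in> {1..K}" "i \<noteq> j"
      then have "1 \<le> i" "1 \<le> j" "i \<noteq> j" by auto
      then have "i - 1 \<noteq> j - 1" by linarith
      then show "{i - 1} \<inter> {j - 1} = {}" by blast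
    qed
  qed
  moreover have "indep_vars (\<lambda>_. borel) (\<lambda>i \<omega>. \<Sum>k\<in>{i - 1}. W (real (Suc k) / real K) \<omega> - W (real k / real K) \<omega>) {1..K}
      = indep_vars (\<lambda>_. borel) (increment K) {1..K}"
  proof (rule indep_vars_cong)
    fix i assume "i \<in> {1..K}"
    then obtain j where j: "i = Suc j" by (cases i) auto
    show "(\<lambda>\<omega>. \<Sum>k\<in>{i - 1}. W (real (Suc k) / real K) \<omega> - W (real k / real K) \<omega>) = increment K i"
      by (rule ext) (simp add: increment_def j)
  qed auto
  ultimately show ?thesis by simp
qed

lemma increment_distributed:
  assumes i: "i \<in> {1..K}"
  shows "distributed N lborel (increment K i) (normal_density 0 (sqrt (1 / real K)))"
proof -
  have "0 \<le> real (i - 1) / real K \<and> real (i - 1) / real K < real i / real K \<and> real i / real K \<le> 1"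
    using i by (auto intro!: divide_strict_right_mono)
  then have "distributed N lborel (\<lambda>\<omega>. W (real i / real K) \<omega> - W (real (i - 1) / real K) \<omega>)
      (normal_density 0 (sqrt (real i / real K - real (i - 1) / real K)))"
    using standard_wiener unfolding standard_wiener_def by blast
  moreover have "real i / real K - real (i - 1) / real K = 1 / real K"
    using i by (simp add: of_nat_diff diff_divide_distrib)
  ultimately show ?thesis by (simp only: increment_def[abs_def])
qed

lemma distr_increment:
  assumes "i \<in> {1..K}"
  shows "distr N borel (increment K i) = normal_law (1 / real K)"
proof -
  have "distr N borel (increment K i) = distr N lborel (increment K i)" by (rule distr_cong) auto
  then show ?thesis
    using increment_distributed[OF assms] by (simp add: distributed_def normal_law_def)
qed

lemma increment_moments:
  assumes i: "i \<in> {1..K}"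
  shows "integrable N (\<lambda>\<omega>. (increment K i \<omega>)\<^sup>2)" "expectation (increment K i) = 0"
    "expectation (\<lambda>\<omega>. (increment K i \<omega>)\<^sup>2) = 1 / real K"
    "integrable N (\<lambda>\<omega>. (increment K i \<omega>) ^ 4)"
    "expectation (\<lambda>\<omega>. (increment K i \<omega>) ^ 4) = 3 / (real K)\<^sup>2"
proof -
  have K: "0 < real K" using i by auto
  have s0: "0 < sqrt (1 / real K)" using K by simp
  note even = normal_even_moment[OF s0 increment_distributed[OF i]]
  show "expectation (increment K i) = 0"
    by (rule normal_distributed_expectation[OF s0 increment_distributed[OF i]])
  show "integrable N (\<lambda>\<omega>. (increment K i \<omega>)\<^sup>2)"
    using even(1)[of 1] by simp
  show "expectation (\<lambda>\<omega>. (increment K i \<omega>)\<^sup>2) = 1 / real K"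
    using even(2)[of 1] K by (simp add: fact_numeral)
  show "integrable N (\<lambda>\<omega>. (increment K i \<omega>) ^ 4)"
    using even(1)[of 2] by simp
  show "expectation (\<lambda>\<omega>. (increment K i \<omega>) ^ 4) = 3 / (real K)\<^sup>2"
    using even(2)[of 2] K
    by (simp add: fact_numeral power2_eq_square field_simps)
qed

lemma interpolation_sq_osc:
  assumes K: "1 \<le> K" and a: "1 \<le> a"
  shows "\<exists>E\<in>events. prob E \<le> 130 / a \<and>
    (\<forall>\<omega>\<in>space N - E. \<forall>h\<in>{0..1}. sq_osc (interpolation K \<omega>) h \<le> 32 * a * h)"
  unfolding interpolation_def
  by (rule grid_polygon_sq_osc[OF K indep_increments[OF K] increment_moments(1-3)])
    (use K a in \<open>auto simp: divide_right_mono\<close>)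

lemma interpolation_uniform_limit:
  assumes \<omega>: "regular \<omega>" and b: "0 < b"
  shows "\<exists>K0\<ge>1. \<forall>K\<ge>K0. \<forall>t\<in>{0..1}. \<bar>trajectory \<omega> t - interpolation K \<omega> t\<bar> \<le> b"
proof -
  have "uniformly_continuous_on {0..1} (trajectory \<omega>)"
    by (intro compact_uniformly_continuous continuous_on_subset[OF continuous_trajectory[OF \<omega>]]) auto
  then obtain d where d: "0 < d"
    "\<And>s t. s \<in> {0..1} \<Longrightarrow> t \<in> {0..1} \<Longrightarrow> dist t s < d \<Longrightarrow> dist (trajectory \<omega> t) (trajectory \<omega> s) < b / 2"
    using b half_gt_zero[OF b] unfolding uniformly_continuous_on_def by metis
  obtain K0 :: nat where K0: "1 / d < real K0" using reals_Archimedean2 by blast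
  have "\<bar>trajectory \<omega> t - interpolation K \<omega> t\<bar> \<le> b" if K: "max K0 1 \<le> K" and t: "t \<in> {0..1}" for K t
  proof -
    have "1 / real K < d"
    proof -
      have "1 / d < real K" using K0 K by linarith
      then show ?thesis using d(1) K by (simp add: field_simps)
    qed
    then have "\<bar>trajectory \<omega> s - trajectory \<omega> t\<bar> \<le> b / 2" if "s \<in> {0..1}" "t \<in> {0..1}" "\<bar>s - t\<bar> \<le> 1 / real K" for s t
      using d(2)[OF that(2,1)] that(3) by (simp add: dist_real_def)
    moreover have "trajectory \<omega> 0 = 0" using \<omega> by (simp add: trajectory_def regular_def)
    ultimately show ?thesis
      unfolding interpolation_trajectory
      using polygon_grid_approximation[of K t "trajectory \<omega>" "b / 2"] K t by auto
  qed
  then show ?thesis by (intro exI[of _ "max K0 1"]) auto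
qed

lemma interpolation_bounded:
  assumes \<omega>: "regular \<omega>"
  shows "\<exists>C. \<forall>K\<ge>1. \<forall>t\<in>{0..1}. \<bar>interpolation K \<omega> t\<bar> \<le> C"
proof -
  have "compact (trajectory \<omega> ` {0..1})"
    by (intro compact_continuous_image continuous_on_subset[OF continuous_trajectory[OF \<omega>]]) auto
  then obtain C where C: "\<And>t. t \<in> {0..1} \<Longrightarrow> \<bar>trajectory \<omega> t\<bar> \<le> C"
    by (metis compact_imp_bounded bounded_iff imageI real_norm_def)
  have p0: "trajectory \<omega> 0 = 0" using \<omega> by (simp add: trajectory_def regular_def)
  have "\<bar>interpolation K \<omega> t\<bar> \<le> 5 * C" if K: "1 \<le> K" and t: "t \<in> {0..1}" for K t
  proof -
    have "\<bar>trajectory \<omega> s - trajectory \<omega> t\<bar> \<le> 2 * C" if "s \<in> {0..1}" "t \<in> {0..1}" for s t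
      using C[OF that(1)] C[OF that(2)] by linarith
    then have "\<bar>trajectory \<omega> t - interpolation K \<omega> t\<bar> \<le> 2 * (2 * C)"
      unfolding interpolation_trajectory using K t p0 by (intro polygon_grid_approximation) auto
    then show ?thesis using C[OF t] by linarith
  qed
  then show ?thesis by blast
qed

text \<open>If the bound fails for the path, it fails for all sufficiently fine interpolations. The events \<open>F i\<close>
that it fails for all interpolations from the \<open>i\<close>-th on increase with \<open>i\<close> and have probability at most \<open>130 / a\<close>
each, so their union has the same bound.\<close>

lemma trajectory_sq_osc:
  assumes a: "1 \<le> a"
  shows "\<exists>E\<in>events. prob E \<le> 130 / a \<and>
    (\<forall>\<omega>\<in>space N - E. regular \<omega> \<longrightarrow> (\<forall>h\<in>{0..1}. sq_osc (trajectory \<omega>) h \<le> 32 * a * h))"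
proof -
  have "\<forall>K. \<exists>E\<in>events. prob E \<le> 130 / a \<and>
    (\<forall>\<omega>\<in>space N - E. \<forall>h\<in>{0..1}. sq_osc (interpolation (Suc K) \<omega>) h \<le> 32 * a * h)"
    using interpolation_sq_osc[OF _ a] by simp
  then obtain H where H: "\<And>K. H K \<in> events" "\<And>K. prob (H K) \<le> 130 / a"
    "\<And>K \<omega> h. \<omega> \<in> space N - H K \<Longrightarrow> h \<in> {0..1} \<Longrightarrow> sq_osc (interpolation (Suc K) \<omega>) h \<le> 32 * a * h"
    by metis
  define F where "F i = (\<Inter>L\<in>{i..}. H L)" for i
  have F: "F i \<in> events" for i unfolding F_def using H(1) by (intro sets.countable_INT') auto
  have "(\<lambda>i. prob (F i)) \<longlonglongrightarrow> prob (\<Union>i. F i)"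
  proof (rule finite_Lim_measure_incseq)
    show "incseq F" unfolding incseq_def F_def by (intro allI impI INF_superset_mono) auto
  qed (use F in auto)
  moreover have "prob (F i) \<le> 130 / a" for i
    by (rule order_trans[OF finite_measure_mono H(2)[of i]]) (auto simp: F_def H(1))
  ultimately have PF: "prob (\<Union>i. F i) \<le> 130 / a" by (auto intro: LIMSEQ_le_const2)
  have "sq_osc (trajectory \<omega>) h \<le> 32 * a * h"
    if \<omega>: "\<omega> \<in> space N - (\<Union>i. F i)" and r: "regular \<omega>" and h: "h \<in> {0..1}" for \<omega> h
  proof -
    have "\<forall>i. \<exists>L\<ge>i. \<omega> \<notin> H L" using \<omega> by (auto simp: F_def)
    then obtain L where L: "\<And>i. i \<le> L i" "\<And>i. \<omega> \<notin> H (L i)" by metis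
    obtain C where C: "\<And>K t. 1 \<le> K \<Longrightarrow> t \<in> {0..1} \<Longrightarrow> \<bar>interpolation K \<omega> t\<bar> \<le> C"
      using interpolation_bounded[OF r] by blast
    have lim: "(\<lambda>i. interpolation (Suc (L i)) \<omega> t) \<longlonglongrightarrow> trajectory \<omega> t" if t: "t \<in> {0..1}" for t
    proof (rule LIMSEQ_I)
      fix e :: real assume e: "0 < e"
      obtain K0 where "\<And>K. K0 \<le> K \<Longrightarrow> \<bar>trajectory \<omega> t - interpolation K \<omega> t\<bar> \<le> e / 2"
        using interpolation_uniform_limit[OF r half_gt_zero[OF e]] t by blast
      then have near: "\<bar>trajectory \<omega> t - interpolation K \<omega> t\<bar> \<le> e / 2" if "K0 \<le> K" for K using that by blast
      have "norm (interpolation (Suc (L i)) \<omega> t - trajectory \<omega> t) < e" if "K0 \<le> i" for i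
      proof -
        have "K0 \<le> Suc (L i)" using that L(1)[of i] by linarith
        from near[OF this] show ?thesis using e by (simp add: abs_minus_commute)
      qed
      then show "\<exists>no. \<forall>i\<ge>no. norm (interpolation (Suc (L i)) \<omega> t - trajectory \<omega> t) < e" by blast
    qed
    show ?thesis
    proof (rule sq_osc_le_of_limit[OF continuous_trajectory[OF r] continuous_interpolation, where k = "\<lambda>_. h" and C = C])
      fix u :: real assume "0 \<le> u" "u \<le> 1 - h"
      then show "(\<lambda>i. interpolation (Suc (L i)) \<omega> (u + h) - interpolation (Suc (L i)) \<omega> u)
          \<longlonglongrightarrow> trajectory \<omega> (u + h) - trajectory \<omega> u"
        using h by (intro tendsto_diff lim) auto
    next
      fix i show "sq_osc (interpolation (Suc (L i)) \<omega>) h \<le> 32 * a * h"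
        using H(3)[of \<omega> "L i" h] L(2) \<omega> h by auto
    qed (use h C in auto)
  qed
  then show ?thesis using F PF by (intro bexI[of _ "\<Union>i. F i"]) auto
qed

text \<open>Uniform continuity gives almost sure uniform convergence of the interpolations, and dominated convergence
turns this into convergence in probability. By continuity the supremum may be taken over the rationals, which makes the
exceptional event measurable.\<close>

lemma interpolation_sup_small:
  assumes b: "0 < b" and e: "0 < e"
  shows "\<exists>K0\<ge>1. \<forall>K\<ge>K0. \<exists>E\<in>events. prob E \<le> e \<and>
    (\<forall>\<omega>\<in>space N - E. regular \<omega> \<longrightarrow> (\<forall>t\<in>{0..1}. \<bar>trajectory \<omega> t - interpolation K \<omega> t\<bar> \<le> b))"
proof -
  define cl where "cl t = max 0 (min 1 t)" for t :: real
  define E where "E K = {\<omega>\<in>space N. \<exists>t\<in>\<rat>. b < \<bar>trajectory \<omega> (cl t) - interpolation K \<omega> (cl t)\<bar>}" for K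
  have E: "E K \<in> events" for K
  proof -
    have "{\<omega>\<in>space N. b < \<bar>trajectory \<omega> (cl t) - interpolation K \<omega> (cl t)\<bar>} \<in> events" for t by measurable
    then have "(\<Union>t\<in>\<rat>. {\<omega>\<in>space N. b < \<bar>trajectory \<omega> (cl t) - interpolation K \<omega> (cl t)\<bar>}) \<in> events"
      by (intro sets.countable_UN'' countable_rat)
    moreover have "(\<Union>t\<in>\<rat>. {\<omega>\<in>space N. b < \<bar>trajectory \<omega> (cl t) - interpolation K \<omega> (cl t)\<bar>}) = E K"
      unfolding E_def by blast
    ultimately show ?thesis by simp
  qed
  have "AE \<omega> in N. \<forall>\<^sub>F K in sequentially. \<omega> \<notin> E K"
    using AE_regular
  proof eventually_elim
    case (elim \<omega>)
    obtain K0 where "\<And>K t. K0 \<le> K \<Longrightarrow> t \<in> {0..1} \<Longrightarrow> \<bar>trajectory \<omega> t - interpolation K \<omega> t\<bar> \<le> b"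
      using interpolation_uniform_limit[OF elim b] by blast
    then have "\<omega> \<notin> E K" if "K0 \<le> K" for K using that by (auto simp: E_def cl_def not_less)
    then show ?case by (auto simp: eventually_sequentially)
  qed
  then have "AE \<omega> in N. (\<lambda>K. indicator (E K) \<omega> :: real) \<longlonglongrightarrow> 0"
    by eventually_elim (rule tendsto_eventually, erule eventually_mono, simp)
  then have "(\<lambda>K. \<integral>\<omega>. indicator (E K) \<omega> \<partial>N) \<longlonglongrightarrow> (\<integral>\<omega>. 0 \<partial>N :: real)"
    using E by (intro integral_dominated_convergence[where w = "\<lambda>_. 1"]) (auto simp: indicator_def)
  then have "(\<lambda>K. prob (E K)) \<longlonglongrightarrow> 0" using E by simp
  then have "\<forall>\<^sub>F K in sequentially. prob (E K) < e" by (rule order_tendstoD) (rule e)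
  then obtain K0 where K0: "\<And>K. K0 \<le> K \<Longrightarrow> prob (E K) < e" by (auto simp: eventually_sequentially)
  have "\<bar>trajectory \<omega> t - interpolation K \<omega> t\<bar> \<le> b"
    if \<omega>: "\<omega> \<in> space N - E K" and r: "regular \<omega>" and t: "t \<in> {0..1}" for \<omega> K t
  proof -
    define D where "D t = \<bar>trajectory \<omega> (cl t) - interpolation K \<omega> (cl t)\<bar>" for t
    have clc: "continuous_on UNIV cl" unfolding cl_def[abs_def] by (intro continuous_intros)
    have "continuous_on UNIV D"
      unfolding D_def[abs_def]
      by (intro continuous_intros continuous_on_compose2[OF continuous_trajectory[OF r] clc]
          continuous_on_compose2[OF continuous_interpolation clc]) auto
    then have "closed {t. D t \<le> b}" by (intro closed_Collect_le continuous_intros)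
    moreover have "\<rat> \<subseteq> {t. D t \<le> b}" using \<omega> by (auto simp: E_def D_def not_less)
    ultimately have "closure \<rat> \<subseteq> {t. D t \<le> b}" by (rule closure_minimal[rotated])
    then have "D t \<le> b" by (auto simp: Rats_closure_real)
    then show ?thesis using t by (simp add: D_def cl_def)
  qed
  note close = this
  show ?thesis
  proof (intro exI[of _ "max K0 1"] conjI allI impI)
    fix K assume "max K0 1 \<le> K"
    then have "prob (E K) \<le> e" using K0[of K] by simp
    then show "\<exists>E\<in>events. prob E \<le> e \<and>
        (\<forall>\<omega>\<in>space N - E. regular \<omega> \<longrightarrow> (\<forall>t\<in>{0..1}. \<bar>trajectory \<omega> t - interpolation K \<omega> t\<bar> \<le> b))"
      using E close by blast
  qed simp
qed

end


section \<open>The polygonal line of a Lindeberg array\<close>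

lemma (in nodes) cell:
  assumes "0 \<le> t" "t \<le> 1"
  shows "\<exists>k\<in>{1..m}. A (k - 1) \<le> t \<and> t \<le> A k"
proof (cases "t = 1")
  case True
  then show ?thesis using m_pos A_m A_mono[of "m - 1" m] by (intro bexI[of _ m]) auto
next
  case False
  then have "last_node t \<noteq> m" using last_node(2)[OF assms(1)] A_m assms(2) by auto
  then have "last_node t + 1 \<in> {1..m}" using last_node(1)[OF assms(1)] by simp
  moreover have "t \<le> A (last_node t + 1)"
    using last_node(3)[OF assms(1), of "last_node t + 1"] calculation by force
  ultimately show ?thesis using last_node(2)[OF assms(1)] by (intro bexI[of _ "last_node t + 1"]) auto
qed

context lindeberg_array
begin

text \<open>The partial sums are frozen after index \<open>m n\<close>, so that the sequence of nodes is monotone on all natural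
numbers.\<close>

definition node :: "nat \<Rightarrow> nat \<Rightarrow> real" where
  "node n j = (\<Sum>i=1..min j (m n). v n i)"

lemma node_diff: "k \<in> {1..m n} \<Longrightarrow> node n k - node n (k - 1) = v n k"
  by (cases k) (auto simp: node_def min_def)

lemma nodes_array: "nodes (node n) (m n)"
proof
  show "mono (node n)"
  proof (rule monoI)
    fix i j :: nat assume "i \<le> j"
    then show "node n i \<le> node n j"
      unfolding node_def by (intro sum_mono2) (auto intro!: less_imp_le[OF v_pos])
  qed
  show "node n (k - 1) < node n k" if "k \<in> {1..m n}" for k
    using node_diff[OF that] v_pos[OF that] by linarith
  show "node n (m n) = 1" by (simp only: node_def min.idem v_total)
qed (simp add: node_def)

definition polyline :: "nat \<Rightarrow> 'a \<Rightarrow> real \<Rightarrow> real" where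
  "polyline n \<omega> = polygon (node n) (m n) (\<lambda>k. X n k \<omega>)"

definition grid_block :: "nat \<Rightarrow> nat \<Rightarrow> nat \<Rightarrow> nat set" where
  "grid_block n K i = nodes.block (node n) (m n) K i"

definition block_sum :: "nat \<Rightarrow> nat \<Rightarrow> nat \<Rightarrow> 'a \<Rightarrow> real" where
  "block_sum n K i \<omega> = (\<Sum>k\<in>grid_block n K i. X n k \<omega>)"

definition coarse :: "nat \<Rightarrow> nat \<Rightarrow> 'a \<Rightarrow> real \<Rightarrow> real" where
  "coarse n K \<omega> = polygon (\<lambda>i. real i / real K) K (\<lambda>i. block_sum n K i \<omega>)"

lemma grid_block_subset: "grid_block n K i \<subseteq> {1..m n}"
  unfolding grid_block_def by (rule nodes.block_subset[OF nodes_array])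

lemma disjoint_grid_blocks: "disjoint_family_on (grid_block n K) {1..K}"
  unfolding grid_block_def[abs_def] by (rule nodes.disjoint_blocks[OF nodes_array])

lemma polygonal_line_eq_polygon:
  assumes t: "t \<in> {0..1}"
  shows "polygonal_line (v n) x t = polygon (node n) (m n) x t"
proof -
  interpret nodes "node n" "m n" by (rule nodes_array)
  have "\<exists>k\<in>{1..m n}. node n (k - 1) \<le> t \<and> t \<le> node n k" using t by (intro cell) auto
  then obtain k where k: "k \<in> {1..m n}" "node n (k - 1) \<le> t" "t \<le> node n k" by blast
  have nd: "node n (k - 1) = (\<Sum>i=1..k-1. v n i)" "node n k = (\<Sum>i=1..k. v n i)"
    using k(1) by (auto simp: node_def min_def)
  have "polygonal_line (v n) x t = (\<Sum>i=1..k-1. x i) + (t - (\<Sum>i=1..k-1. v n i)) / v n k * x k"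
  proof (rule polygonal_line_eq[of "m n"])
    show "k \<in> {1..m n}" by (rule k(1))
    show "0 < v n j" if "j \<in> {1..m n}" for j by (rule v_pos[OF that])
    show "(\<Sum>i=1..k-1. v n i) \<le> t" using k(2) unfolding nd(1) .
    show "t \<le> (\<Sum>i=1..k. v n i)" using k(3) unfolding nd(2) .
  qed
  also have "\<dots> = polygon (node n) (m n) x t"
    by (subst polygon_interpolation[OF k], subst node_diff[OF k(1)], subst nd(1)) (simp add: mult.commute)
  finally show ?thesis .
qed

lemma ae_class_polygonal_line: "ae_class (polygonal_line (v n) (\<lambda>k. X n k \<omega>)) = ae_class (polyline n \<omega>)"
  unfolding polyline_def by (rule ae_class_cong[OF continuous_on_polygon polygonal_line_eq_polygon])

lemma sum_second_moment:
  assumes B: "B \<subseteq> {1..m n}"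
  shows "integrable (M n) (\<lambda>\<omega>. (\<Sum>k\<in>B. X n k \<omega>)\<^sup>2)"
    and "(\<integral>\<omega>. (\<Sum>k\<in>B. X n k \<omega>)\<^sup>2 \<partial>M n) = (\<Sum>k\<in>B. v n k)"
    and "(\<integral>\<omega>. (\<Sum>k\<in>B. X n k \<omega>) \<partial>M n) = 0"
proof -
  interpret prob_space "M n" by (rule prob_space_M)
  define c where "c k = (if k \<in> B then 1 else 0 :: real)" for k
  have eq: "(\<Sum>k=1..m n. c k * z k) = (\<Sum>k\<in>B. z k)" for z :: "nat \<Rightarrow> real"
    unfolding c_def using B by (auto simp: if_distrib[of "\<lambda>a. a * _"] intro!: sum.mono_neutral_cong_right)
  have eq2: "(\<Sum>k=1..m n. (c k)\<^sup>2 * z k) = (\<Sum>k\<in>B. z k)" for z :: "nat \<Rightarrow> real"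
    unfolding c_def using B
    by (auto simp: if_distrib[of "\<lambda>a. a * _"] if_distrib[of "\<lambda>a. a ^ 2"] intro!: sum.mono_neutral_cong_right)
  note ws = weighted_sum_second_moment[OF indep sq_integrable mean_0 order_refl, of c, unfolded eq eq2]
  show "integrable (M n) (\<lambda>\<omega>. (\<Sum>k\<in>B. X n k \<omega>)\<^sup>2)" by (rule ws(1))
  show "(\<integral>\<omega>. (\<Sum>k\<in>B. X n k \<omega>)\<^sup>2 \<partial>M n) = (\<Sum>k\<in>B. v n k)"
  proof -
    have "expectation (\<lambda>\<omega>. (\<Sum>k\<in>B. X n k \<omega>)\<^sup>2) = (\<Sum>k\<in>B. expectation (\<lambda>\<omega>. (X n k \<omega>)\<^sup>2))"
      by (rule ws(2))
    also have "\<dots> = (\<Sum>k\<in>B. v n k)" using B by (intro sum.cong refl second_moment) auto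
    finally show ?thesis .
  qed
  have "integrable (M n) (X n k)" if "k \<in> B" for k
    by (rule square_integrable_imp_integrable) (use that B X_measurable sq_integrable in auto)
  then have "(\<integral>\<omega>. (\<Sum>k\<in>B. X n k \<omega>) \<partial>M n) = (\<Sum>k\<in>B. expectation (X n k))"
    by (rule Bochner_Integration.integral_sum)
  also have "\<dots> = 0" using B mean_0 by (intro sum.neutral) auto
  finally show "(\<integral>\<omega>. (\<Sum>k\<in>B. X n k \<omega>) \<partial>M n) = 0" .
qed

lemma sum_measurable: "B \<subseteq> {1..m n} \<Longrightarrow> (\<lambda>\<omega>. \<Sum>k\<in>B. X n k \<omega>) \<in> borel_measurable (M n)"
  by (intro borel_measurable_sum X_measurable) auto

text \<open>Under the Lindeberg condition the individual variances are uniformly negligible, since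
\<open>v n k \<le> \<epsilon>\<^sup>2 + tail \<epsilon> n\<close>.\<close>

lemma eventually_v_le:
  assumes "0 < \<eta>"
  shows "\<forall>\<^sub>F n in sequentially. \<forall>k\<in>{1..m n}. v n k \<le> \<eta>"
proof -
  define \<epsilon> where "\<epsilon> = sqrt (\<eta> / 2)"
  have \<epsilon>: "0 < \<epsilon>" "\<epsilon>\<^sup>2 = \<eta> / 2" using assms by (auto simp: \<epsilon>_def)
  have "\<forall>\<^sub>F n in sequentially. tail \<epsilon> n < \<eta> / 2"
    by (rule order_tendstoD(2)[OF tail_tendsto_0[OF \<epsilon>(1)]]) (use assms in simp)
  then show ?thesis
  proof eventually_elim
    case (elim n)
    then show ?case using v_le[OF _ \<epsilon>(1), of _ n] \<epsilon>(2) by fastforce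
  qed
qed

lemma block_variance_tendsto:
  assumes i: "i \<in> {1..K}"
  shows "(\<lambda>n. \<Sum>k\<in>grid_block n K i. v n k) \<longlonglongrightarrow> 1 / real K"
proof (rule tendstoI)
  fix e :: real assume e: "0 < e"
  have "\<forall>\<^sub>F n in sequentially. \<forall>k\<in>{1..m n}. v n k \<le> e / 2" by (rule eventually_v_le) (use e in simp)
  then show "\<forall>\<^sub>F n in sequentially. dist (\<Sum>k\<in>grid_block n K i. v n k) (1 / real K) < e"
  proof eventually_elim
    case (elim n)
    interpret nodes "node n" "m n" by (rule nodes_array)
    have "(\<Sum>k\<in>grid_block n K i. v n k) = (\<Sum>k\<in>nodes.block (node n) (m n) K i. node n k - node n (k - 1))"
      unfolding grid_block_def
    proof (intro sum.cong refl)
      fix k assume "k \<in> nodes.block (node n) (m n) K i"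
      then have "k \<in> {1..m n}" using nodes.block_subset[OF nodes_array] by blast
      then show "v n k = node n k - node n (k - 1)" by (rule node_diff[symmetric])
    qed
    moreover have "\<bar>(\<Sum>k\<in>nodes.block (node n) (m n) K i. node n k - node n (k - 1)) - 1 / real K\<bar> \<le> e / 2"
    proof (rule nodes.block_variance[OF nodes_array _ i])
      show "1 \<le> K" using i by simp
      show "node n k - node n (k - 1) \<le> e / 2" if "k \<in> {1..m n}" for k
        unfolding node_diff[OF that] using elim that by blast
    qed
    ultimately show ?case using e by (simp add: dist_real_def)
  qed
qed

lemma polyline_sq_osc:
  assumes a: "1 \<le> a"
  shows "\<exists>E\<in>sets (M n). measure (M n) E \<le> 130 / a \<and>
    (\<forall>\<omega>\<in>space (M n) - E. \<forall>h\<in>{0..1}. sq_osc (polyline n \<omega>) h \<le> 32 * a * h)"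
proof -
  interpret prob_space "M n" by (rule prob_space_M)
  interpret nodes "node n" "m n" by (rule nodes_array)
  have le: "node n (k - 1) \<le> node n k" for k by (rule A_mono) simp
  have lin: "(\<Sum>k=1..m n. v n k * (ramp (node n (k - 1)) (node n k) (u + h) - ramp (node n (k - 1)) (node n k) u)) \<le> 1 * h"
    if "0 \<le> h" for u h
    using sum_ramp_increment_le[OF mono_A that, where m = "m n" and u = u] by (simp add: node_diff[simplified])
  obtain E where E: "E \<in> events" "prob E \<le> (2 + 32 * 1\<^sup>2) / a"
    "\<And>\<omega> h. \<omega> \<in> space (M n) - E \<Longrightarrow> h \<in> {0..1} \<Longrightarrow> sq_osc (polyline n \<omega>) h \<le> 32 * a * h"
    using sq_osc_weighted_sum[OF indep sq_integrable mean_0 second_moment eq_refl[OF v_total] continuous_on_ramp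
        mono_ramp[OF le] ramp_nonneg[OF le] ramp_le_1[OF le] lin a]
    unfolding polyline_def polygon_def[abs_def] by blast
  have "(2 + 32 * 1\<^sup>2) / a \<le> 130 / a" using a by (intro divide_right_mono) auto
  with E(2) have "prob E \<le> 130 / a" by linarith
  with E(1,3) show ?thesis by blast
qed

lemma indep_block_sums: "prob_space.indep_vars (M n) (\<lambda>_. borel) (block_sum n K) {1..K}"
  unfolding block_sum_def[abs_def]
  by (rule prob_space.indep_vars_block_sums[OF prob_space_M indep grid_block_subset disjoint_grid_blocks])

lemma coarse_sq_osc:
  assumes K: "1 \<le> K" and a: "1 \<le> a"
  shows "\<forall>\<^sub>F n in sequentially. \<exists>E\<in>sets (M n). measure (M n) E \<le> 130 / a \<and>
    (\<forall>\<omega>\<in>space (M n) - E. \<forall>h\<in>{0..1}. sq_osc (coarse n K \<omega>) h \<le> 32 * a * h)"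
proof -
  have "\<forall>\<^sub>F n in sequentially. \<forall>i\<in>{1..K}. (\<Sum>k\<in>grid_block n K i. v n k) < 2 / real K"
    by (intro eventually_ball_finite ballI order_tendstoD(2)[OF block_variance_tendsto])
      (use K in \<open>auto simp: divide_strict_right_mono\<close>)
  then show ?thesis
  proof eventually_elim
    case (elim n)
    interpret nodes "node n" "m n" by (rule nodes_array)
    have tot: "(\<Sum>i=1..K. \<Sum>k\<in>grid_block n K i. v n k) = 1"
      unfolding grid_block_def sum_block_sums using K by (simp add: last_node_1 v_total[simplified])
    have "\<And>i. i \<in> {1..K} \<Longrightarrow> (\<Sum>k\<in>grid_block n K i. v n k) \<le> 2 / real K" using elim by (auto intro: less_imp_le)
    from prob_space.grid_polygon_sq_osc[OF prob_space_M K indep_block_sums _ _ _ this eq_refl[OF tot] a]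
    show ?case unfolding coarse_def block_sum_def using sum_second_moment[OF grid_block_subset] by simp
  qed
qed

lemma prob_large_le_tail:
  assumes k: "k \<in> {1..m n}" and b: "0 < b"
  shows "measure (M n) {\<omega>\<in>space (M n). b \<le> \<bar>X n k \<omega>\<bar>}
    \<le> prob_space.expectation (M n) (\<lambda>\<omega>. (X n k \<omega>)\<^sup>2 * indicator {\<omega>. b \<le> \<bar>X n k \<omega>\<bar>} \<omega>) / b\<^sup>2"
proof -
  interpret prob_space "M n" by (rule prob_space_M)
  have [measurable]: "X n k \<in> borel_measurable (M n)" by (rule X_measurable[OF k])
  let ?T = "{\<omega>\<in>space (M n). b \<le> \<bar>X n k \<omega>\<bar>}"
  have T: "?T \<in> events" by measurable
  have i: "integrable (M n) (\<lambda>\<omega>. (X n k \<omega>)\<^sup>2 * indicator {\<omega>. b \<le> \<bar>X n k \<omega>\<bar>} \<omega>)"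
    by (rule Bochner_Integration.integrable_bound[OF sq_integrable[OF k]]) (auto simp: indicator_def)
  have "b\<^sup>2 * prob ?T = expectation (\<lambda>\<omega>. b\<^sup>2 * indicator ?T \<omega>)" using T by simp
  also have "\<dots> \<le> expectation (\<lambda>\<omega>. (X n k \<omega>)\<^sup>2 * indicator {\<omega>. b \<le> \<bar>X n k \<omega>\<bar>} \<omega>)"
  proof (intro integral_mono i)
    show "integrable (M n) (\<lambda>\<omega>. b\<^sup>2 * indicator ?T \<omega>)"
      by (intro integrable_mult_right integrable_real_indicator T) (simp add: emeasure_eq_measure)
    fix \<omega>
    show "b\<^sup>2 * indicator ?T \<omega> \<le> (X n k \<omega>)\<^sup>2 * indicator {\<omega>. b \<le> \<bar>X n k \<omega>\<bar>} \<omega>"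
      using power_mono[of b "\<bar>X n k \<omega>\<bar>" 2] b by (auto simp: indicator_def)
  qed
  finally show ?thesis using b by (simp add: pos_le_divide_eq mult.commute)
qed

lemma prob_max_le_tail:
  assumes b: "0 < b"
  shows "{\<omega>\<in>space (M n). \<exists>k\<in>{1..m n}. b \<le> \<bar>X n k \<omega>\<bar>} \<in> sets (M n)"
    and "measure (M n) {\<omega>\<in>space (M n). \<exists>k\<in>{1..m n}. b \<le> \<bar>X n k \<omega>\<bar>} \<le> tail b n / b\<^sup>2"
proof -
  interpret prob_space "M n" by (rule prob_space_M)
  have eq: "{\<omega>\<in>space (M n). \<exists>k\<in>{1..m n}. b \<le> \<bar>X n k \<omega>\<bar>} = (\<Union>k\<in>{1..m n}. {\<omega>\<in>space (M n). b \<le> \<bar>X n k \<omega>\<bar>})"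
    by auto
  have ev: "{\<omega>\<in>space (M n). b \<le> \<bar>X n k \<omega>\<bar>} \<in> events" if "k \<in> {1..m n}" for k
    using X_measurable[OF that] by measurable
  show "{\<omega>\<in>space (M n). \<exists>k\<in>{1..m n}. b \<le> \<bar>X n k \<omega>\<bar>} \<in> events"
    unfolding eq using ev by (intro sets.finite_UN) auto
  have "prob (\<Union>k\<in>{1..m n}. {\<omega>\<in>space (M n). b \<le> \<bar>X n k \<omega>\<bar>})
      \<le> (\<Sum>k=1..m n. prob {\<omega>\<in>space (M n). b \<le> \<bar>X n k \<omega>\<bar>})"
    using ev by (intro measure_UNION_le) auto
  also have "\<dots> \<le> (\<Sum>k=1..m n. expectation (\<lambda>\<omega>. (X n k \<omega>)\<^sup>2 * indicator {\<omega>. b \<le> \<bar>X n k \<omega>\<bar>} \<omega>) / b\<^sup>2)"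
    by (intro sum_mono prob_large_le_tail b)
  finally show "prob {\<omega>\<in>space (M n). \<exists>k\<in>{1..m n}. b \<le> \<bar>X n k \<omega>\<bar>} \<le> tail b n / b\<^sup>2"
    unfolding eq by (simp add: tail_def sum_divide_distrib)
qed

definition block_max :: "real \<Rightarrow> nat \<Rightarrow> nat \<Rightarrow> nat \<Rightarrow> 'a set" where
  "block_max b n K i = {\<omega>\<in>space (M n). \<exists>j\<in>grid_block n K i.
     b \<le> \<bar>\<Sum>k\<in>{nodes.last_node (node n) (m n) (real (i - 1) / real K)<..j}. X n k \<omega>\<bar>}"

lemma block_max_event: "block_max b n K i \<in> sets (M n)"
proof -
  let ?S = "\<lambda>j \<omega>. \<Sum>k\<in>{nodes.last_node (node n) (m n) (real (i - 1) / real K)<..j}. X n k \<omega>"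
  have ev: "{\<omega>\<in>space (M n). b \<le> \<bar>?S j \<omega>\<bar>} \<in> sets (M n)" if j: "j \<in> grid_block n K i" for j
  proof -
    have "j \<le> m n" using j grid_block_subset[of n K i] by auto
    then have [measurable]: "?S j \<in> borel_measurable (M n)" by (intro sum_measurable) auto
    show ?thesis by measurable
  qed
  have fin: "finite (grid_block n K i)" by (rule finite_subset[OF grid_block_subset finite_atLeastAtMost])
  have "block_max b n K i = (\<Union>j\<in>grid_block n K i. {\<omega>\<in>space (M n). b \<le> \<bar>?S j \<omega>\<bar>})"
    unfolding block_max_def by blast
  then show ?thesis using sets.finite_UN[OF fin ev] by (simp only:)
qed

text \<open>Ottaviani's inequality at level \<open>b / 2\<close>, followed by Markov's inequality for the fourth power. The
truncation by one makes the integrand a bounded continuous function of the block sum, so its expectation has a limit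
although the fourth moment of the block sum may be infinite.\<close>

lemma prob_block_max_le:
  assumes b: "0 < b" and var: "(\<Sum>k\<in>grid_block n K i. v n k) \<le> b\<^sup>2 / 8"
  shows "measure (M n) (block_max b n K i)
    \<le> 2 * (\<integral>\<omega>. min 1 ((block_sum n K i \<omega>) ^ 4 / (b / 2) ^ 4) \<partial>M n)"
proof -
  interpret prob_space "M n" by (rule prob_space_M)
  let ?l = "nodes.last_node (node n) (m n) (real (i - 1) / real K)"
  let ?r = "nodes.last_node (node n) (m n) (real i / real K)"
  have B: "grid_block n K i = {?l<..?r}" by (simp add: grid_block_def nodes.block_def[OF nodes_array])
  have r: "?r \<le> m n" by (rule nodes.last_node(1)[OF nodes_array]) simp
  have "(\<Sum>k\<in>{?l<..?r}. expectation (\<lambda>\<omega>. (X n k \<omega>)\<^sup>2)) = (\<Sum>k\<in>grid_block n K i. v n k)"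
    unfolding B[symmetric] using grid_block_subset[of n K i] by (intro sum.cong refl second_moment) auto
  also have "\<dots> \<le> (b / 2)\<^sup>2 / 2" using var by (simp add: power_divide)
  finally have "prob {\<omega>\<in>space (M n). \<exists>j\<in>{?l<..?r}. 2 * (b / 2) \<le> \<bar>\<Sum>k\<in>{?l<..j}. X n k \<omega>\<bar>}
      \<le> 2 * prob {\<omega>\<in>space (M n). b / 2 \<le> \<bar>\<Sum>k\<in>{?l<..?r}. X n k \<omega>\<bar>}"
    by (intro ottaviani[OF indep sq_integrable mean_0 r]) (use b in auto)
  then have "prob (block_max b n K i) \<le> 2 * prob {\<omega>\<in>space (M n). b / 2 \<le> \<bar>block_sum n K i \<omega>\<bar>}"
    by (simp add: block_max_def block_sum_def B)
  also have "prob {\<omega>\<in>space (M n). b / 2 \<le> \<bar>block_sum n K i \<omega>\<bar>}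
      \<le> (\<integral>\<omega>. min 1 ((block_sum n K i \<omega>) ^ 4 / (b / 2) ^ 4) \<partial>M n)"
  proof -
    have [measurable]: "block_sum n K i \<in> borel_measurable (M n)"
      unfolding block_sum_def[abs_def] by (rule sum_measurable[OF grid_block_subset])
    let ?T = "{\<omega>\<in>space (M n). b / 2 \<le> \<bar>block_sum n K i \<omega>\<bar>}"
    have T: "?T \<in> events" by measurable
    have "prob ?T = expectation (indicator ?T)" using T by simp
    also have "\<dots> \<le> (\<integral>\<omega>. min 1 ((block_sum n K i \<omega>) ^ 4 / (b / 2) ^ 4) \<partial>M n)"
    proof (rule integral_mono)
      show "integrable (M n) (indicator ?T :: _ \<Rightarrow> real)"
        by (intro integrable_real_indicator T) (simp add: emeasure_eq_measure)
      show "integrable (M n) (\<lambda>\<omega>. min 1 ((block_sum n K i \<omega>) ^ 4 / (b / 2) ^ 4))"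
        by (rule integrable_const_bound[where B = 1]) auto
      fix \<omega>
      show "indicator ?T \<omega> \<le> min 1 ((block_sum n K i \<omega>) ^ 4 / (b / 2) ^ 4)"
      proof (cases "\<omega> \<in> ?T")
        case True
        then have "(b / 2) ^ 4 \<le> \<bar>block_sum n K i \<omega>\<bar> ^ 4" using b by (intro power_mono) auto
        then have "1 \<le> (block_sum n K i \<omega>) ^ 4 / (b / 2) ^ 4" using b by (simp add: le_divide_eq power_even_abs)
        then show ?thesis using True by simp
      qed simp
    qed
    finally show ?thesis .
  qed
  finally show ?thesis by simp
qed

end


section \<open>Convergence in the Besov space\<close>

lemma (in prob_space) AE_null_event:
  assumes "AE \<omega> in M. P \<omega>"
  obtains G where "G \<in> events" "prob G = 0" "\<And>\<omega>. \<omega> \<in> space M - G \<Longrightarrow> P \<omega>"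
proof -
  obtain G where G: "{\<omega>\<in>space M. \<not> P \<omega>} \<subseteq> G" "emeasure M G = 0" "G \<in> sets M"
    using assms by (rule AE_E)
  show thesis
  proof (rule that[OF G(3)])
    show "prob G = 0" using G(2) by (simp add: emeasure_eq_measure)
    show "P \<omega>" if "\<omega> \<in> space M - G" for \<omega> using G(1) that by blast
  qed
qed

locale besov_donsker =
  besov_exponents p \<alpha> q + lindeberg_array M m X v + wiener_process N W
  for p \<alpha> q :: real and M :: "nat \<Rightarrow> 'a measure" and m X v and N :: "'b measure" and W
begin

text \<open>Outside the event that some variable or some partial sum inside a block exceeds \<open>b = \<beta> / 3\<close>, the two
polygons differ by at most \<open>3 * b\<close>. Single variables are controlled by the Lindeberg sum, blocks by
\<open>prob_block_max_le\<close>.\<close>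

lemma coarse_uniformly_close:
  assumes \<beta>: "0 < \<beta>" and e: "0 < e"
  shows "\<exists>K0\<ge>1. \<forall>K\<ge>K0. \<forall>\<^sub>F n in sequentially. \<exists>E\<in>sets (M n). measure (M n) E \<le> e \<and>
    (\<forall>\<omega>\<in>space (M n) - E. \<forall>t\<in>{0..1}. \<bar>polyline n \<omega> t - coarse n K \<omega> t\<bar> \<le> \<beta>)"
proof -
  define b where "b = \<beta> / 3"
  have b: "0 < b" using \<beta> by (simp add: b_def)
  \<comment> \<open>the limit \<open>48 / (K\<^sup>2 * b ^ 4)\<close> of the truncated fourth moments must be below \<open>c = e / (4 * K)\<close>, and the limiting block variance \<open>1 / K\<close> below \<open>b\<^sup>2 / 8\<close>\<close>
  define D where "D = 384 / (b ^ 4 * e) + 8 / b\<^sup>2"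
  obtain K0 :: nat where K0: "D < real K0" using reals_Archimedean2 by blast
  have "\<forall>\<^sub>F n in sequentially. \<exists>E\<in>sets (M n). measure (M n) E \<le> e \<and>
    (\<forall>\<omega>\<in>space (M n) - E. \<forall>t\<in>{0..1}. \<bar>polyline n \<omega> t - coarse n K \<omega> t\<bar> \<le> \<beta>)" if K: "max K0 1 \<le> K" for K
  proof -
    have K1: "1 \<le> K" using K by simp
    have DK: "D < real K" using K0 K by linarith
    have K8: "8 / b\<^sup>2 < real K" and K384: "384 / (b ^ 4 * e) < real K"
      using DK b e by (auto simp: D_def intro: le_less_trans[rotated])
    define P where "P n i = (\<integral>\<omega>. min 1 ((block_sum n K i \<omega>) ^ 4 / (b / 2) ^ 4) \<partial>M n)" for n i
    define c where "c = e / (4 * real K)"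
    \<comment> \<open>a normal variable of variance \<open>1 / K\<close> has fourth moment \<open>3 / K\<^sup>2\<close>, and \<open>3 / (b / 2) ^ 4 = 48 / b ^ 4\<close>\<close>
    have P: "\<forall>\<^sub>F n in sequentially. P n i < c" if i: "i \<in> {1..K}" for i
    proof -
      define F where "F y = min 1 ((y i) ^ 4 / (b / 2) ^ 4)" for y :: "nat \<Rightarrow> real"
      have "(\<lambda>n. \<integral>\<omega>. F (pad {i} (\<lambda>i. \<Sum>k\<in>grid_block n K i. X n k \<omega>)) \<partial>M n)
          \<longlonglongrightarrow> (\<integral>\<omega>. F (pad {i} (\<lambda>i. increment K i \<omega>)) \<partial>N)"
      proof (rule joint_block_limit[where s = "\<lambda>_. 1 / real K" and C = 1])
        show "indep_vars (\<lambda>_. borel) (increment K) {i}"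
          by (rule indep_vars_subset[OF indep_increments[OF K1]]) (use i in auto)
        show "F \<in> borel_measurable borel"
          unfolding F_def[abs_def]
          by (intro borel_measurable_continuous_onI continuous_intros continuous_on_product_coordinates) (use b in auto)
        show "\<bar>F y\<bar> \<le> 1" for y by (simp add: F_def)
        fix y :: "nat \<Rightarrow> nat \<Rightarrow> real" and y' assume "\<And>j. (\<lambda>n. y n j) \<longlonglongrightarrow> y' j"
        then show "(\<lambda>n. F (y n)) \<longlonglongrightarrow> F y'" unfolding F_def by (intro tendsto_intros) (use b in auto)
      qed (use i grid_block_subset block_variance_tendsto distr_increment prob_space_axioms in \<open>auto simp: disjoint_family_on_def\<close>)
      then have lim: "(\<lambda>n. P n i) \<longlonglongrightarrow> (\<integral>\<omega>. min 1 ((increment K i \<omega>) ^ 4 / (b / 2) ^ 4) \<partial>N)"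
        by (simp add: F_def pad_def P_def block_sum_def)
      have [measurable]: "increment K i \<in> borel_measurable N" by (rule increment_measurable[OF i])
      have "(\<integral>\<omega>. min 1 ((increment K i \<omega>) ^ 4 / (b / 2) ^ 4) \<partial>N) \<le> (\<integral>\<omega>. (increment K i \<omega>) ^ 4 / (b / 2) ^ 4 \<partial>N)"
      proof (rule integral_mono)
        show "integrable N (\<lambda>\<omega>. min 1 ((increment K i \<omega>) ^ 4 / (b / 2) ^ 4))"
          by (rule integrable_const_bound[where B = 1]) auto
        show "integrable N (\<lambda>\<omega>. (increment K i \<omega>) ^ 4 / (b / 2) ^ 4)"
          by (intro integrable_divide_zero) (use increment_moments(4)[OF i] in auto)
      qed simp
      also have "\<dots> = 48 / ((real K)\<^sup>2 * b ^ 4)"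
        using increment_moments(5)[OF i] b by (simp add: power_divide)
      also have "\<dots> < c"
      proof -
        have "384 < real K * (b ^ 4 * e)" using K384 b e by (simp add: pos_divide_less_eq)
        then have "192 < real K * (b ^ 4 * e)" by simp
        then have "48 * (4 * real K) < e * ((real K)\<^sup>2 * b ^ 4)"
          using K1 by (simp add: power2_eq_square mult_ac)
        then show ?thesis unfolding c_def using K1 b by (simp add: divide_less_eq less_divide_eq mult_ac)
      qed
      finally show ?thesis by (rule order_tendstoD(2)[OF lim])
    qed
    have var: "\<forall>\<^sub>F n in sequentially. \<forall>i\<in>{1..K}. (\<Sum>k\<in>grid_block n K i. v n k) < b\<^sup>2 / 8"
    proof (intro eventually_ball_finite ballI order_tendstoD(2)[OF block_variance_tendsto])
      have "8 < real K * b\<^sup>2" using K8 b by (simp add: pos_divide_less_eq)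
      then show "1 / real K < b\<^sup>2 / 8" using K1 by (simp add: field_simps)
    qed auto
    have tail: "\<forall>\<^sub>F n in sequentially. tail b n < b\<^sup>2 * (e / 2)"
      by (rule order_tendstoD(2)[OF tail_tendsto_0[OF b]]) (use b e in simp)
    have "\<forall>\<^sub>F n in sequentially. \<forall>i\<in>{1..K}. P n i < c"
      by (intro eventually_ball_finite ballI P) auto
    with var tail show ?thesis
    proof eventually_elim
      case (elim n)
      interpret Mn: prob_space "M n" by (rule prob_space_M)
      define E0 where "E0 = {\<omega>\<in>space (M n). \<exists>k\<in>{1..m n}. b \<le> \<bar>X n k \<omega>\<bar>}"
      define E1 where "E1 = (\<Union>i\<in>{1..K}. block_max b n K i)"
      have E: "E0 \<in> Mn.events" "E1 \<in> Mn.events"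
        unfolding E0_def E1_def using prob_max_le_tail(1)[OF b] block_max_event by (auto intro!: sets.finite_UN)
      have "Mn.prob E0 \<le> tail b n / b\<^sup>2" unfolding E0_def by (rule prob_max_le_tail(2)[OF b])
      also have "\<dots> \<le> e / 2" using elim(2) b by (simp add: pos_divide_le_eq mult.commute less_imp_le)
      finally have p0: "Mn.prob E0 \<le> e / 2" .
      have "Mn.prob E1 \<le> (\<Sum>i=1..K. Mn.prob (block_max b n K i))"
        unfolding E1_def by (intro measure_UNION_le) (auto simp: block_max_event)
      also have "\<dots> \<le> (\<Sum>i=1..K. 2 * c)"
      proof (rule sum_mono)
        fix i assume i: "i \<in> {1..K}"
        have "Mn.prob (block_max b n K i) \<le> 2 * P n i"
          unfolding P_def using elim(1) i by (intro prob_block_max_le[OF b]) (auto intro: less_imp_le)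
        moreover have "P n i < c" using elim(3) i by blast
        ultimately show "Mn.prob (block_max b n K i) \<le> 2 * c" by linarith
      qed
      also have "\<dots> = e / 2" using K1 by (simp add: c_def)
      finally have p1: "Mn.prob E1 \<le> e / 2" .
      have "Mn.prob (E0 \<union> E1) \<le> Mn.prob E0 + Mn.prob E1" using E by (intro measure_Un_le)
      then have pE: "Mn.prob (E0 \<union> E1) \<le> e" using p0 p1 by linarith
      have "\<bar>polyline n \<omega> t - coarse n K \<omega> t\<bar> \<le> \<beta>" if \<omega>: "\<omega> \<in> space (M n) - (E0 \<union> E1)" and t: "t \<in> {0..1}" for \<omega> t
      proof -
        have x: "\<bar>X n k \<omega>\<bar> \<le> b" if "k \<in> {1..m n}" for k
          using \<omega> that unfolding E0_def by (force simp: not_le)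
        have osc: "\<bar>\<Sum>k\<in>{nodes.last_node (node n) (m n) (real (i - 1) / real K)<..j}. X n k \<omega>\<bar> \<le> b"
          if "i \<in> {1..K}" "j \<in> nodes.block (node n) (m n) K i" for i j
          using \<omega> that unfolding E1_def block_max_def grid_block_def by (force simp: not_le)
        have "\<bar>polyline n \<omega> t - coarse n K \<omega> t\<bar> \<le> 3 * b"
          unfolding polyline_def coarse_def block_sum_def grid_block_def
          by (rule nodes.polygon_block_approximation[OF nodes_array K1 _ _ x osc]) (use t in auto)
        then show ?thesis by (simp add: b_def)
      qed
      then show ?case using E pE by (intro bexI[of _ "E0 \<union> E1"]) auto
    qed
  qed
  then show ?thesis by (intro exI[of _ "max K0 1"]) auto
qed

text \<open>First \<open>a\<close> is chosen so that the oscillation bound \<open>32 * a\<close> fails with small probability, then \<open>b\<close>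
so small that uniform \<open>b\<close>-closeness gives \<open>e\<close>-closeness in the Besov space at that oscillation bound.\<close>

lemma approximation_constants:
  assumes e: "0 < e"
  obtains a b where "1 \<le> a" "130 / a \<le> e / 4" "0 < b" "b + besov_bound (4 * (32 * a)) (2 * b) \<le> e"
proof -
  define a where "a = max 1 (520 / e)"
  have a: "1 \<le> a" "520 / e \<le> a" by (auto simp: a_def)
  then have "520 \<le> a * e" using e by (simp add: pos_divide_le_eq)
  then have "130 / a \<le> e / 4" using a(1) by (simp add: divide_le_eq mult.commute)
  moreover obtain b where "0 < b" "b + besov_bound (4 * (32 * a)) (2 * b) < e" using besov_bound_small[OF e] by blast
  ultimately show thesis using that[of a b] a(1) by simp
qed

lemma array_approximation:
  assumes e: "0 < e"
  shows "\<exists>K0\<ge>1. \<forall>K\<ge>K0. \<forall>\<^sub>F n in sequentially. \<exists>E\<in>sets (M n). measure (M n) E \<le> e \<and>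
    (\<forall>\<omega>\<in>space (M n) - E. besov_dist p \<alpha> (ae_class (polyline n \<omega>)) (ae_class (coarse n K \<omega>)) \<le> e)"
proof -
  obtain a b where ab: "1 \<le> a" "130 / a \<le> e / 4" "0 < b" "b + besov_bound (4 * (32 * a)) (2 * b) \<le> e"
    using approximation_constants[OF e] .
  obtain K0 where K0: "1 \<le> K0" "\<And>K. K0 \<le> K \<Longrightarrow> \<forall>\<^sub>F n in sequentially. \<exists>E\<in>sets (M n). measure (M n) E \<le> e / 4 \<and>
    (\<forall>\<omega>\<in>space (M n) - E. \<forall>t\<in>{0..1}. \<bar>polyline n \<omega> t - coarse n K \<omega> t\<bar> \<le> b)"
    using coarse_uniformly_close[OF ab(3), of "e / 4"] e by auto
  have "\<forall>\<^sub>F n in sequentially. \<exists>E\<in>sets (M n). measure (M n) E \<le> e \<and>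
    (\<forall>\<omega>\<in>space (M n) - E. besov_dist p \<alpha> (ae_class (polyline n \<omega>)) (ae_class (coarse n K \<omega>)) \<le> e)" if K: "K0 \<le> K" for K
    using K0(2)[OF K] coarse_sq_osc[OF order_trans[OF K0(1) K] ab(1)]
  proof eventually_elim
    case (elim n)
    interpret Mn: prob_space "M n" by (rule prob_space_M)
    obtain E1 where E1: "E1 \<in> Mn.events" "Mn.prob E1 \<le> e / 4"
      "\<And>\<omega> t. \<omega> \<in> space (M n) - E1 \<Longrightarrow> t \<in> {0..1} \<Longrightarrow> \<bar>polyline n \<omega> t - coarse n K \<omega> t\<bar> \<le> b" using elim(1) by blast
    obtain E2 where E2: "E2 \<in> Mn.events" "Mn.prob E2 \<le> 130 / a"
      "\<And>\<omega> h. \<omega> \<in> space (M n) - E2 \<Longrightarrow> h \<in> {0..1} \<Longrightarrow> sq_osc (coarse n K \<omega>) h \<le> 32 * a * h" using elim(2) by blast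
    obtain E3 where E3: "E3 \<in> Mn.events" "Mn.prob E3 \<le> 130 / a"
      "\<And>\<omega> h. \<omega> \<in> space (M n) - E3 \<Longrightarrow> h \<in> {0..1} \<Longrightarrow> sq_osc (polyline n \<omega>) h \<le> 32 * a * h" using polyline_sq_osc[OF ab(1), of n] by blast
    have "Mn.prob (E1 \<union> (E2 \<union> E3)) \<le> Mn.prob E1 + Mn.prob (E2 \<union> E3)" using E1 E2 E3 by (intro measure_Un_le) auto
    also have "Mn.prob (E2 \<union> E3) \<le> Mn.prob E2 + Mn.prob E3" using E2 E3 by (intro measure_Un_le)
    finally have "Mn.prob (E1 \<union> (E2 \<union> E3)) \<le> e" using E1(2) E2(2) E3(2) ab(2) e by linarith
    moreover have "besov_dist p \<alpha> (ae_class (polyline n \<omega>)) (ae_class (coarse n K \<omega>)) \<le> e"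
      if \<omega>: "\<omega> \<in> space (M n) - (E1 \<union> (E2 \<union> E3))" for \<omega>
    proof -
      have "besov_dist p \<alpha> (ae_class (polyline n \<omega>)) (ae_class (coarse n K \<omega>)) \<le> b + besov_bound (4 * (32 * a)) (2 * b)"
      proof (rule besov_dist_ae_class_le)
        show "continuous_on UNIV (polyline n \<omega>)" "continuous_on UNIV (coarse n K \<omega>)"
          unfolding polyline_def coarse_def by (rule continuous_on_polygon)+
      qed (use \<omega> E1(3) E2(3) E3(3) ab in auto)
      then show ?thesis using ab(4) by simp
    qed
    ultimately show ?case using E1 E2 E3 by (intro bexI[of _ "E1 \<union> (E2 \<union> E3)"]) auto
  qed
  then show ?thesis using K0(1) by blast
qed

lemma ae_class_trajectory: "regular \<omega> \<Longrightarrow> ae_class (\<lambda>t. W t \<omega>) = ae_class (trajectory \<omega>)"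
  by (rule ae_class_cong) (auto simp: trajectory_eq intro: continuous_on_subset[OF continuous_trajectory])

lemma wiener_approximation:
  assumes e: "0 < e"
  shows "\<exists>K0\<ge>1. \<forall>K\<ge>K0. \<exists>E\<in>events. prob E \<le> e \<and> (\<forall>\<omega>\<in>space N - E. ae_class (\<lambda>t. W t \<omega>) \<in> besov_space p \<alpha> \<and>
    besov_dist p \<alpha> (ae_class (\<lambda>t. W t \<omega>)) (ae_class (interpolation K \<omega>)) \<le> e)"
proof -
  obtain a b where ab: "1 \<le> a" "130 / a \<le> e / 4" "0 < b" "b + besov_bound (4 * (32 * a)) (2 * b) \<le> e"
    using approximation_constants[OF e] .
  obtain K0 where K0: "1 \<le> K0" "\<And>K. K0 \<le> K \<Longrightarrow> \<exists>E\<in>events. prob E \<le> e / 4 \<and>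
    (\<forall>\<omega>\<in>space N - E. regular \<omega> \<longrightarrow> (\<forall>t\<in>{0..1}. \<bar>trajectory \<omega> t - interpolation K \<omega> t\<bar> \<le> b))"
    using interpolation_sup_small[OF ab(3), of "e / 4"] e by auto
  obtain E0 where E0: "E0 \<in> events" "prob E0 = 0" "\<And>\<omega>. \<omega> \<in> space N - E0 \<Longrightarrow> regular \<omega>"
    using AE_null_event[OF AE_regular] by blast
  obtain E3 where E3: "E3 \<in> events" "prob E3 \<le> 130 / a"
    "\<And>\<omega> h. \<omega> \<in> space N - E3 \<Longrightarrow> regular \<omega> \<Longrightarrow> h \<in> {0..1} \<Longrightarrow> sq_osc (trajectory \<omega>) h \<le> 32 * a * h"
    using trajectory_sq_osc[OF ab(1)] by blast
  have "\<exists>E\<in>events. prob E \<le> e \<and> (\<forall>\<omega>\<in>space N - E. ae_class (\<lambda>t. W t \<omega>) \<in> besov_space p \<alpha> \<and>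
    besov_dist p \<alpha> (ae_class (\<lambda>t. W t \<omega>)) (ae_class (interpolation K \<omega>)) \<le> e)" if K: "K0 \<le> K" for K
  proof -
    obtain E1 where E1: "E1 \<in> events" "prob E1 \<le> e / 4"
      "\<And>\<omega> t. \<omega> \<in> space N - E1 \<Longrightarrow> regular \<omega> \<Longrightarrow> t \<in> {0..1} \<Longrightarrow> \<bar>trajectory \<omega> t - interpolation K \<omega> t\<bar> \<le> b"
      using K0(2)[OF K] by blast
    obtain E2 where E2: "E2 \<in> events" "prob E2 \<le> 130 / a"
      "\<And>\<omega> h. \<omega> \<in> space N - E2 \<Longrightarrow> h \<in> {0..1} \<Longrightarrow> sq_osc (interpolation K \<omega>) h \<le> 32 * a * h"
      using interpolation_sq_osc[OF order_trans[OF K0(1) K] ab(1)] by blast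
    define E where "E = (E0 \<union> E1) \<union> (E2 \<union> E3)"
    have "prob E \<le> prob (E0 \<union> E1) + prob (E2 \<union> E3)" unfolding E_def using E0 E1 E2 E3 by (intro measure_Un_le) auto
    moreover have "prob (E0 \<union> E1) \<le> prob E0 + prob E1" using E0 E1 by (intro measure_Un_le)
    moreover have "prob (E2 \<union> E3) \<le> prob E2 + prob E3" using E2 E3 by (intro measure_Un_le)
    ultimately have "prob E \<le> e" using E0(2) E1(2) E2(2) E3(2) ab(2) e by linarith
    moreover have "ae_class (\<lambda>t. W t \<omega>) \<in> besov_space p \<alpha> \<and>
      besov_dist p \<alpha> (ae_class (\<lambda>t. W t \<omega>)) (ae_class (interpolation K \<omega>)) \<le> e" if \<omega>: "\<omega> \<in> space N - E" for \<omega>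
    proof -
      have r: "regular \<omega>" using E0(3) \<omega> by (auto simp: E_def)
      have W: "sq_osc (trajectory \<omega>) h \<le> 32 * a * h" if "0 \<le> h" "h \<le> 1" for h
        using E3(3)[OF _ r] \<omega> that by (auto simp: E_def)
      have "besov_dist p \<alpha> (ae_class (trajectory \<omega>)) (ae_class (interpolation K \<omega>)) \<le> b + besov_bound (4 * (32 * a)) (2 * b)"
        by (rule besov_dist_ae_class_le[OF continuous_trajectory[OF r] W continuous_interpolation])
          (use \<omega> r E1(3) E2(3) ab in \<open>auto simp: E_def\<close>)
      moreover have "ae_class (trajectory \<omega>) \<in> besov_space p \<alpha>"
        by (rule besov_space_ae_class[OF continuous_trajectory[OF r] _ W]) (use ab in auto)
      ultimately show ?thesis using ab(4) ae_class_trajectory[OF r] by simp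
    qed
    ultimately show ?thesis using E0 E1 E2 E3 by (intro bexI[of _ E]) (auto simp: E_def)
  qed
  then show ?thesis using K0(1) by blast
qed

lemma besov_polygons_grid: "1 \<le> K \<Longrightarrow> besov_polygons p \<alpha> q (\<lambda>i. real i / real K) K"
  by (intro besov_polygons.intro besov_exponents_axioms nodes_grid)

lemma besov_polygons_array: "besov_polygons p \<alpha> q (node n) (m n)"
  by (intro besov_polygons.intro besov_exponents_axioms nodes_array)

lemma polyline_measurable: "(\<lambda>\<omega>. ae_class (polyline n \<omega>)) \<in> M n \<rightarrow>\<^sub>M borel_of (besov_topology p \<alpha>)"
  unfolding polyline_def by (rule besov_polygons.measurable_polygon[OF besov_polygons_array X_measurable])

lemma coarse_measurable: "1 \<le> K \<Longrightarrow> (\<lambda>\<omega>. ae_class (coarse n K \<omega>)) \<in> M n \<rightarrow>\<^sub>M borel_of (besov_topology p \<alpha>)"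
  unfolding coarse_def block_sum_def
  by (rule besov_polygons.measurable_polygon[OF besov_polygons_grid sum_measurable[OF grid_block_subset]])

lemma interpolation_random_element:
  "1 \<le> K \<Longrightarrow> (\<lambda>\<omega>. ae_class (interpolation K \<omega>)) \<in> N \<rightarrow>\<^sub>M borel_of (besov_topology p \<alpha>)"
  unfolding interpolation_def
  by (rule besov_polygons.measurable_polygon[OF besov_polygons_grid increment_measurable])

text \<open>Measurability of the Wiener path as an element of the Besov space comes from its interpolations: along
a sequence of grids with summable exceptional probabilities they converge almost surely by the Borel-Cantelli lemma, and
a limit of measurable maps into a metric space is measurable.\<close>

lemma wiener_random_element:
  "\<exists>Z. Z \<in> N \<rightarrow>\<^sub>M borel_of (besov_topology p \<alpha>) \<and> (AE \<omega> in N. Z \<omega> = ae_class (\<lambda>t. W t \<omega>))"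
proof -
  interpret B: Metric_space "besov_space p \<alpha>" "besov_dist p \<alpha>" by (rule Metric_space_besov_dist)
  have "\<forall>j. \<exists>K\<ge>1. \<exists>E\<in>events. prob E \<le> (1 / 2) ^ j \<and> (\<forall>\<omega>\<in>space N - E. ae_class (\<lambda>t. W t \<omega>) \<in> besov_space p \<alpha> \<and>
    besov_dist p \<alpha> (ae_class (\<lambda>t. W t \<omega>)) (ae_class (interpolation K \<omega>)) \<le> (1 / 2) ^ j)"
  proof
    fix j :: nat
    have "(0::real) < (1 / 2) ^ j" by simp
    from wiener_approximation[OF this] obtain K where "1 \<le> K" "\<exists>E\<in>events. prob E \<le> (1 / 2) ^ j \<and>
        (\<forall>\<omega>\<in>space N - E. ae_class (\<lambda>t. W t \<omega>) \<in> besov_space p \<alpha> \<and>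
        besov_dist p \<alpha> (ae_class (\<lambda>t. W t \<omega>)) (ae_class (interpolation K \<omega>)) \<le> (1 / 2) ^ j)" by blast
    then show "\<exists>K\<ge>1. \<exists>E\<in>events. prob E \<le> (1 / 2) ^ j \<and> (\<forall>\<omega>\<in>space N - E. ae_class (\<lambda>t. W t \<omega>) \<in> besov_space p \<alpha> \<and>
      besov_dist p \<alpha> (ae_class (\<lambda>t. W t \<omega>)) (ae_class (interpolation K \<omega>)) \<le> (1 / 2) ^ j)" by blast
  qed
  then obtain K E where K: "\<And>j. 1 \<le> K j" and E: "\<And>j. E j \<in> events" "\<And>j. prob (E j) \<le> (1 / 2) ^ j"
    and close: "\<And>j \<omega>. \<omega> \<in> space N - E j \<Longrightarrow> ae_class (\<lambda>t. W t \<omega>) \<in> besov_space p \<alpha> \<and>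
      besov_dist p \<alpha> (ae_class (\<lambda>t. W t \<omega>)) (ae_class (interpolation (K j) \<omega>)) \<le> (1 / 2) ^ j"
    by metis
  have "summable (\<lambda>j. prob (E j))"
    by (rule summable_comparison_test[OF _ summable_geometric[of "1 / 2 :: real"]]) (use E in auto)
  then have "AE \<omega> in N. \<forall>\<^sub>F j in sequentially. \<omega> \<in> space N - E j"
    using E by (intro borel_cantelli_AE1) (auto simp: emeasure_eq_measure)
  then obtain G where G: "G \<in> events" "prob G = 0"
    "\<And>\<omega>. \<omega> \<in> space N - G \<Longrightarrow> \<forall>\<^sub>F j in sequentially. \<omega> \<in> space N - E j"
    using AE_null_event by blast
  have zero: "ae_class (polygon (\<lambda>i. real i / real 1) 1 (\<lambda>_. 0)) \<in> besov_space p \<alpha>"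
    by (rule besov_polygons.polygon_in_besov_space[OF besov_polygons_grid]) simp
  \<comment> \<open>a default element of the space, used on the null event \<open>G\<close>; it is the zero function\<close>
  define z where "z = ae_class (polygon (\<lambda>i. real i / real 1) 1 (\<lambda>_. 0))"
  have z: "z \<in> besov_space p \<alpha>" unfolding z_def by (rule zero)
  define Z where "Z \<omega> = (if \<omega> \<in> G then z else ae_class (\<lambda>t. W t \<omega>))" for \<omega>
  define Zs where "Zs j \<omega> = (if \<omega> \<in> G then z else ae_class (interpolation (K j) \<omega>))" for j \<omega>
  have "Z \<in> N \<rightarrow>\<^sub>M borel_of B.mtopology"
  proof (rule B.measurable_pointwise_limit)
    fix j
    have "G \<inter> space N \<in> sets N" using G(1) by auto
    then show "Zs j \<in> N \<rightarrow>\<^sub>M borel_of B.mtopology"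
      unfolding Zs_def[abs_def] using interpolation_random_element[OF K[of j]] zero
      by (intro measurable_If_set) (auto simp: besov_topology_def z_def)
  next
    fix \<omega> assume \<omega>: "\<omega> \<in> space N"
    show "Z \<omega> \<in> besov_space p \<alpha>"
    proof (cases "\<omega> \<in> G")
      case False
      then have "\<forall>\<^sub>F j in sequentially. \<omega> \<in> space N - E j" using G(3) \<omega> by blast
      then obtain j where j: "\<omega> \<in> space N - E j" using eventually_happens'[OF sequentially_bot] by blast
      show ?thesis using close[OF j] False by (simp add: Z_def)
    qed (simp add: Z_def z)
    show "(\<lambda>j. besov_dist p \<alpha> (Zs j \<omega>) (Z \<omega>)) \<longlonglongrightarrow> 0"
    proof (cases "\<omega> \<in> G")
      case False
      then have "\<forall>\<^sub>F j in sequentially. \<omega> \<in> space N - E j" using G(3) \<omega> by blast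
      then have le: "\<forall>\<^sub>F j in sequentially. norm (besov_dist p \<alpha> (Zs j \<omega>) (Z \<omega>)) \<le> (1 / 2) ^ j"
      proof eventually_elim
        case (elim j)
        then show ?case using close[OF elim] False B.commute[of "Zs j \<omega>" "Z \<omega>"] by (simp add: Z_def Zs_def)
      qed
      show ?thesis by (rule Lim_null_comparison[OF le]) (intro LIMSEQ_power_zero, simp)
    qed (use zero in \<open>simp add: Z_def Zs_def z_def\<close>)
  qed
  moreover have "AE \<omega> in N. Z \<omega> = ae_class (\<lambda>t. W t \<omega>)"
    by (rule AE_I[of _ _ G]) (use G in \<open>auto simp: Z_def emeasure_eq_measure\<close>)
  ultimately show ?thesis by (auto simp: besov_topology_def)
qed

lemma coarse_limit:
  assumes K: "1 \<le> K" and L: "0 \<le> L"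
    and f: "\<And>x y. x \<in> besov_space p \<alpha> \<Longrightarrow> y \<in> besov_space p \<alpha> \<Longrightarrow> \<bar>f x - f y\<bar> \<le> L * besov_dist p \<alpha> x y"
    and B: "\<And>x. x \<in> besov_space p \<alpha> \<Longrightarrow> \<bar>f x\<bar> \<le> B"
  shows "(\<lambda>n. \<integral>\<omega>. f (ae_class (coarse n K \<omega>)) \<partial>M n) \<longlonglongrightarrow> (\<integral>\<omega>. f (ae_class (interpolation K \<omega>)) \<partial>N)"
proof -
  interpret G: besov_polygons p \<alpha> q "\<lambda>i. real i / real K" K by (rule besov_polygons_grid[OF K])
  interpret B: Metric_space "besov_space p \<alpha>" "besov_dist p \<alpha>" by (rule Metric_space_besov_dist)
  define F where "F y = f (ae_class (polygon (\<lambda>i. real i / real K) K y))" for y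
  have fm: "f \<in> borel_measurable (borel_of (besov_topology p \<alpha>))"
    unfolding besov_topology_def
    by (rule measurable_borel_of_continuous_map[OF B.lipschitz_continuous_map[OF L f]])
  have "(\<lambda>n. \<integral>\<omega>. F (pad {1..K} (\<lambda>i. \<Sum>k\<in>grid_block n K i. X n k \<omega>)) \<partial>M n)
      \<longlonglongrightarrow> (\<integral>\<omega>. F (pad {1..K} (\<lambda>i. increment K i \<omega>)) \<partial>N)"
  proof (rule joint_block_limit[where s = "\<lambda>_. 1 / real K" and C = B])
    show "F \<in> borel_measurable borel"
      unfolding F_def[abs_def] by (rule measurable_compose[OF G.measurable_polygon_borel fm])
    show "\<bar>F y\<bar> \<le> B" for y unfolding F_def by (rule B[OF G.polygon_in_besov_space])
    fix y :: "nat \<Rightarrow> nat \<Rightarrow> real" and y' assume lim: "\<And>j. (\<lambda>n. y n j) \<longlonglongrightarrow> y' j"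
    show "(\<lambda>n. F (y n)) \<longlonglongrightarrow> F y'"
    proof (rule tendstoI)
      fix e :: real assume e: "0 < e"
      then have "0 < e / (L + 1)" using L by simp
      from G.polygon_besov_dist_small[OF this] obtain \<delta> where \<delta>: "0 < \<delta>"
        "\<And>x y. (\<Sum>k=1..K. \<bar>x k - y k\<bar>) < \<delta> \<Longrightarrow> besov_dist p \<alpha> (ae_class (polygon (\<lambda>i. real i / real K) K x))
          (ae_class (polygon (\<lambda>i. real i / real K) K y)) < e / (L + 1)" by blast
      have "(\<lambda>n. \<Sum>k=1..K. \<bar>y n k - y' k\<bar>) \<longlonglongrightarrow> (\<Sum>k=1..K. \<bar>y' k - y' k\<bar>)" by (intro tendsto_intros lim)
      then have "\<forall>\<^sub>F n in sequentially. (\<Sum>k=1..K. \<bar>y n k - y' k\<bar>) < \<delta>"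
        by (rule order_tendstoD) (use \<delta> in simp)
      then show "\<forall>\<^sub>F n in sequentially. dist (F (y n)) (F y') < e"
      proof eventually_elim
        case (elim n)
        let ?d = "besov_dist p \<alpha> (ae_class (polygon (\<lambda>i. real i / real K) K (y n)))
          (ae_class (polygon (\<lambda>i. real i / real K) K y'))"
        have "\<bar>F (y n) - F y'\<bar> \<le> L * ?d" unfolding F_def by (intro f G.polygon_in_besov_space)
        also have "\<dots> \<le> (L + 1) * ?d" by (intro mult_right_mono B.nonneg) simp
        also have "\<dots> < e" using \<delta>(2)[OF elim] L by (simp add: less_divide_eq mult.commute)
        finally show ?case by (simp add: dist_real_def)
      qed
    qed
  qed (use K grid_block_subset disjoint_grid_blocks block_variance_tendsto indep_increments[OF K] distr_increment prob_space_axioms in auto)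
  then show ?thesis
    unfolding F_def G.polygon_pad coarse_def interpolation_def block_sum_def .
qed

text \<open>A chain of three comparisons: the polygonal line with its coarse polygon, the coarse polygon with the
interpolation of the Wiener process on the same grid in the limit of the array, and the interpolation with the Wiener path.
The first and the last cost at most \<open>(L + 2 * B) * e\<close> each.\<close>

lemma lipschitz_limit:
  assumes L: "0 \<le> L"
    and f: "\<And>x y. x \<in> besov_space p \<alpha> \<Longrightarrow> y \<in> besov_space p \<alpha> \<Longrightarrow> \<bar>f x - f y\<bar> \<le> L * besov_dist p \<alpha> x y"
    and B: "\<And>x. x \<in> besov_space p \<alpha> \<Longrightarrow> \<bar>f x\<bar> \<le> B"
    and Z: "Z \<in> N \<rightarrow>\<^sub>M borel_of (besov_topology p \<alpha>)" "AE \<omega> in N. Z \<omega> = ae_class (\<lambda>t. W t \<omega>)"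
  shows "(\<lambda>n. \<integral>\<omega>. f (ae_class (polyline n \<omega>)) \<partial>M n) \<longlonglongrightarrow> (\<integral>\<omega>. f (Z \<omega>) \<partial>N)"
proof (rule tendstoI)
  interpret B: Metric_space "besov_space p \<alpha>" "besov_dist p \<alpha>" by (rule Metric_space_besov_dist)
  fix \<epsilon> :: real assume \<epsilon>: "0 < \<epsilon>"
  obtain \<omega>0 where "\<omega>0 \<in> space N" using not_empty by blast
  then have "Z \<omega>0 \<in> besov_space p \<alpha>"
    using measurable_space[OF Z(1)] by (simp add: topspace_besov_topology[OF p \<alpha>])
  then have B0: "0 \<le> B" using B by fastforce
  define s where "s = L + 2 * B + 1"
  define e where "e = \<epsilon> / (4 * s)"
  have pos: "0 < s" using L B0 by (simp add: s_def)
  have e: "0 < e" using \<epsilon> pos by (simp add: e_def)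
  have "(L + 2 * B) * e \<le> s * e" using e by (intro mult_right_mono) (auto simp: s_def)
  also have "\<dots> = \<epsilon> / 4" using pos by (simp add: e_def)
  finally have Le: "(L + 2 * B) * e \<le> \<epsilon> / 4" .
  obtain K1 where K1: "1 \<le> K1" "\<And>K. K1 \<le> K \<Longrightarrow> \<forall>\<^sub>F n in sequentially. \<exists>E\<in>sets (M n). measure (M n) E \<le> e \<and>
    (\<forall>\<omega>\<in>space (M n) - E. besov_dist p \<alpha> (ae_class (polyline n \<omega>)) (ae_class (coarse n K \<omega>)) \<le> e)"
    using array_approximation[OF e] by blast
  obtain K2 where K2: "\<And>K. K2 \<le> K \<Longrightarrow> \<exists>E\<in>events. prob E \<le> e \<and> (\<forall>\<omega>\<in>space N - E. ae_class (\<lambda>t. W t \<omega>) \<in> besov_space p \<alpha> \<and>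
    besov_dist p \<alpha> (ae_class (\<lambda>t. W t \<omega>)) (ae_class (interpolation K \<omega>)) \<le> e)"
    using wiener_approximation[OF e] by blast
  define K where "K = max K1 K2"
  have K: "1 \<le> K" "K1 \<le> K" "K2 \<le> K" using K1(1) by (auto simp: K_def)
  obtain E where E: "E \<in> events" "prob E \<le> e" "\<And>\<omega>. \<omega> \<in> space N - E \<Longrightarrow>
      besov_dist p \<alpha> (ae_class (\<lambda>t. W t \<omega>)) (ae_class (interpolation K \<omega>)) \<le> e"
    using K2[OF K(3)] by blast
  obtain G where G: "G \<in> events" "prob G = 0" "\<And>\<omega>. \<omega> \<in> space N - G \<Longrightarrow> Z \<omega> = ae_class (\<lambda>t. W t \<omega>)"
    using AE_null_event[OF Z(2)] by blast
  have "prob (E \<union> G) \<le> prob E + prob G" using E G by (intro measure_Un_le)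
  then have EG: "prob (E \<union> G) \<le> e" using E(2) G(2) by simp
  have Nw: "\<bar>(\<integral>\<omega>. f (Z \<omega>) \<partial>N) - (\<integral>\<omega>. f (ae_class (interpolation K \<omega>)) \<partial>N)\<bar> \<le> (L + 2 * B) * e"
    using Z(1) interpolation_random_element[OF K(1)] E G EG e
    by (intro B.lipschitz_expectation_diff[OF prob_space_axioms _ _ L f B _ EG]) (auto simp: besov_topology_def)
  have "\<forall>\<^sub>F n in sequentially. dist (\<integral>\<omega>. f (ae_class (coarse n K \<omega>)) \<partial>M n) (\<integral>\<omega>. f (ae_class (interpolation K \<omega>)) \<partial>N) < \<epsilon> / 4"
    by (rule tendstoD[OF coarse_limit[OF K(1) L f B]]) (use \<epsilon> in auto)
  then show "\<forall>\<^sub>F n in sequentially. dist (\<integral>\<omega>. f (ae_class (polyline n \<omega>)) \<partial>M n) (\<integral>\<omega>. f (Z \<omega>) \<partial>N) < \<epsilon>"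
    using K1(2)[OF K(2)]
  proof eventually_elim
    case (elim n)
    then obtain E' where E': "E' \<in> sets (M n)" "measure (M n) E' \<le> e"
      "\<And>\<omega>. \<omega> \<in> space (M n) - E' \<Longrightarrow> besov_dist p \<alpha> (ae_class (polyline n \<omega>)) (ae_class (coarse n K \<omega>)) \<le> e" by blast
    have "\<bar>(\<integral>\<omega>. f (ae_class (polyline n \<omega>)) \<partial>M n) - (\<integral>\<omega>. f (ae_class (coarse n K \<omega>)) \<partial>M n)\<bar> \<le> (L + 2 * B) * e"
      using polyline_measurable[of n] coarse_measurable[OF K(1), of n] E' e
      by (intro B.lipschitz_expectation_diff[OF prob_space_M _ _ L f B E'(1,2)]) (auto simp: besov_topology_def)
    then show ?case using elim(1) Nw Le \<epsilon> unfolding dist_real_def by linarith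
  qed
qed

theorem polyline_converges:
  "\<exists>Z. Z \<in> N \<rightarrow>\<^sub>M borel_of (besov_topology p \<alpha>) \<and> (AE \<omega> in N. Z \<omega> = ae_class (\<lambda>t. W t \<omega>)) \<and>
    weak_conv_on (besov_topology p \<alpha>) (\<lambda>n. distr (M n) (borel_of (besov_topology p \<alpha>)) (\<lambda>\<omega>. ae_class (polyline n \<omega>)))
      (distr N (borel_of (besov_topology p \<alpha>)) Z)"
proof -
  interpret B: Metric_space "besov_space p \<alpha>" "besov_dist p \<alpha>" by (rule Metric_space_besov_dist)
  let ?T = "besov_topology p \<alpha>"
  obtain Z where Z: "Z \<in> N \<rightarrow>\<^sub>M borel_of ?T" "AE \<omega> in N. Z \<omega> = ae_class (\<lambda>t. W t \<omega>)"
    using wiener_random_element by blast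
  have "weak_conv_on B.mtopology (\<lambda>n. distr (M n) (borel_of ?T) (\<lambda>\<omega>. ae_class (polyline n \<omega>))) (distr N (borel_of ?T) Z)"
  proof (rule B.weak_conv_on_of_lipschitz)
    show "prob_space (distr (M n) (borel_of ?T) (\<lambda>\<omega>. ae_class (polyline n \<omega>)))" for n
      by (rule prob_space.prob_space_distr[OF prob_space_M polyline_measurable])
    show "prob_space (distr N (borel_of ?T) Z)" by (rule prob_space_distr[OF Z(1)])
    fix f :: "l0 \<Rightarrow> real" and L B assume L: "0 \<le> L"
      and f: "\<And>x y. x \<in> besov_space p \<alpha> \<Longrightarrow> y \<in> besov_space p \<alpha> \<Longrightarrow> \<bar>f x - f y\<bar> \<le> L * besov_dist p \<alpha> x y"
      and B: "\<And>x. x \<in> besov_space p \<alpha> \<Longrightarrow> \<bar>f x\<bar> \<le> B"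
    have fm: "f \<in> borel_measurable (borel_of ?T)"
      unfolding besov_topology_def by (rule measurable_borel_of_continuous_map[OF B.lipschitz_continuous_map[OF L f]])
    show "(\<lambda>n. \<integral>x. f x \<partial>distr (M n) (borel_of ?T) (\<lambda>\<omega>. ae_class (polyline n \<omega>))) \<longlonglongrightarrow> (\<integral>x. f x \<partial>distr N (borel_of ?T) Z)"
      unfolding integral_distr[OF polyline_measurable fm] integral_distr[OF Z(1) fm]
      by (rule lipschitz_limit[OF L f B Z])
  qed (simp_all add: besov_topology_def)
  with Z show ?thesis unfolding besov_topology_def by blast
qed

end

theorem theorem4:
  fixes p \<alpha> :: real
    and M :: "nat \<Rightarrow> 'a measure" and m :: "nat \<Rightarrow> nat" and X :: "nat \<Rightarrow> nat \<Rightarrow> 'a \<Rightarrow> real"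
    and N :: "'b measure" and W :: "real \<Rightarrow> 'b \<Rightarrow> real"
  assumes "p \<ge> 1" and "\<alpha> \<in> {0..<1/2} \<inter> {0..1/p}"
    and "\<And>n. n \<ge> 1 \<Longrightarrow> prob_space (M n)"
    and "\<And>n. n \<ge> 1 \<Longrightarrow> prob_space.indep_vars (M n) (\<lambda>_. borel) (X n) {1..m n}"
    and "\<And>n k. n \<ge> 1 \<Longrightarrow> k \<in> {1..m n} \<Longrightarrow> integrable (M n) (\<lambda>\<omega>. (X n k \<omega>)\<^sup>2)"
    and "\<And>n k. n \<ge> 1 \<Longrightarrow> k \<in> {1..m n} \<Longrightarrow> prob_space.expectation (M n) (X n k) = 0"
    and "\<And>n k. n \<ge> 1 \<Longrightarrow> k \<in> {1..m n} \<Longrightarrow> prob_space.variance (M n) (X n k) > 0"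
    and "\<And>n. n \<ge> 1 \<Longrightarrow> (\<Sum>k=1..m n. prob_space.variance (M n) (X n k)) = 1"
    and "\<And>\<epsilon>. \<epsilon> > 0 \<Longrightarrow>
      (\<lambda>n. \<Sum>k=1..m n. prob_space.expectation (M n)
         (\<lambda>\<omega>. (X n k \<omega>)\<^sup>2 * indicator {\<omega>. \<bar>X n k \<omega>\<bar> \<ge> \<epsilon>} \<omega>)) \<longlonglongrightarrow> 0"
    and "standard_wiener N W"
  shows "conv_in_distr (besov_topology p \<alpha>)
    M (\<lambda>n \<omega>. ae_class (polygonal_line (\<lambda>k. prob_space.variance (M n) (X n k)) (\<lambda>k. X n k \<omega>)))
    N (\<lambda>\<omega>. ae_class (\<lambda>t. W t \<omega>))"
proof -
  obtain q where q: "besov_exponents p \<alpha> q" using besov_exponents_exist[of p \<alpha>] assms(1,2) by auto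
  define v where "v n k = prob_space.variance (M n) (X n k)" for n k
  have lind: "lindeberg_array (\<lambda>n. M (Suc n)) (\<lambda>n. m (Suc n)) (\<lambda>n. X (Suc n)) (\<lambda>n. v (Suc n))"
  proof (rule lindeberg_array.intro)
    show "prob_space (M (Suc n))" for n by (rule assms(3)) simp
    show "prob_space.indep_vars (M (Suc n)) (\<lambda>_. borel) (X (Suc n)) {1..m (Suc n)}" for n by (rule assms(4)) simp
    show "(\<Sum>k=1..m (Suc n). v (Suc n) k) = 1" for n unfolding v_def by (rule assms(8)) simp
    show "integrable (M (Suc n)) (\<lambda>\<omega>. (X (Suc n) k \<omega>)\<^sup>2)" if k: "k \<in> {1..m (Suc n)}" for n k
      by (rule assms(5)[OF _ k]) simp
    show "prob_space.expectation (M (Suc n)) (X (Suc n) k) = 0" if k: "k \<in> {1..m (Suc n)}" for n k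
      by (rule assms(6)[OF _ k]) simp
    show "0 < v (Suc n) k" if k: "k \<in> {1..m (Suc n)}" for n k
      unfolding v_def by (rule assms(7)[OF _ k]) simp
    show "prob_space.expectation (M (Suc n)) (\<lambda>\<omega>. (X (Suc n) k \<omega>)\<^sup>2) = v (Suc n) k"
      if k: "k \<in> {1..m (Suc n)}" for n k
      unfolding v_def using assms(6)[OF _ k] by simp
  next
    fix \<epsilon> :: real assume "0 < \<epsilon>"
    from LIMSEQ_Suc[OF assms(9)[OF this]]
    show "(\<lambda>n. \<Sum>k=1..m (Suc n). prob_space.expectation (M (Suc n))
         (\<lambda>\<omega>. (X (Suc n) k \<omega>)\<^sup>2 * indicator {\<omega>. \<epsilon> \<le> \<bar>X (Suc n) k \<omega>\<bar>} \<omega>)) \<longlonglongrightarrow> 0" .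
  qed
  interpret D: besov_donsker p \<alpha> q "\<lambda>n. M (Suc n)" "\<lambda>n. m (Suc n)" "\<lambda>n. X (Suc n)" "\<lambda>n. v (Suc n)" N W
    by (intro besov_donsker.intro q lind wiener_process.intro assms(10))
  let ?T = "besov_topology p \<alpha>"
  let ?Y = "\<lambda>n \<omega>. ae_class (polygonal_line (v n) (\<lambda>k. X n k \<omega>))"
  have Y: "?Y (Suc n) = (\<lambda>\<omega>. ae_class (D.polyline n \<omega>))" for n by (intro ext D.ae_class_polygonal_line)
  obtain Z where Z: "Z \<in> N \<rightarrow>\<^sub>M borel_of ?T" "AE \<omega> in N. Z \<omega> = ae_class (\<lambda>t. W t \<omega>)"
    "weak_conv_on ?T (\<lambda>n. distr (M (Suc n)) (borel_of ?T) (?Y (Suc n))) (distr N (borel_of ?T) Z)"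
    using D.polyline_converges unfolding Y by blast
  have "?Y n \<in> M n \<rightarrow>\<^sub>M borel_of ?T" if n: "1 \<le> n" for n
  proof (cases n)
    case (Suc n')
    show ?thesis unfolding Suc Y by (rule D.polyline_measurable)
  qed (use n in simp)
  moreover have "weak_conv_on ?T (\<lambda>n. distr (M n) (borel_of ?T) (?Y n)) (distr N (borel_of ?T) Z)"
    by (rule weak_conv_on_Suc[OF Z(3)])
  ultimately have "conv_in_distr ?T M ?Y N (\<lambda>\<omega>. ae_class (\<lambda>t. W t \<omega>))"
    unfolding conv_in_distr_def using Z(1,2) by blast
  then show ?thesis unfolding v_def .
qed

end
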